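(* Let $r\ge 0$ be real, let $a:\mathbb Z\to\mathbb C$ satisfy $\|a\|_r:=\sum_{m\in\mathbb Z}|a(m)||m|^r<\infty$, $a(0)=0$ and $a(m)=\overline{a(-m)}$ for all $m\in\mathbb Z$. Let $0<\eta<1$, let $T_\eta$ be the operator on $\ell^2(\mathbb Z)$ given by $$(T_\eta u)(n)=\sum_{m\in\mathbb Z}a(n-m)u(m)+\operatorname{sgn}(n)|n|^\eta u(n)$$ on the domain $\{u\in\ell^2(\mathbb Z):\sum_{n\in\mathbb Z}|n|^{2\eta}|u(n)|^2<\infty\}$, and let $b\in\ell^\infty(\mathbb Z,\mathbb R)$, acting as a multiplication operator. Then: (i) $T_\eta+b$ has purely discrete spectrum, and there exists $\gamma>0$ such that its eigenvalues $\{\lambda_n\}_{n\in\mathbb Z}$ (enumerated as described in the context) satisfy $$\bigl|\lambda_n-\operatorname{sgn}(n)|n|^\eta\bigr|\le\gamma,\qquad n\in\mathbb Z.$$ (ii) Any orthonormal basis $\{\varphi_m\}_{m\in\mathbb Z}$ of $\ell^2(\mathbb Z)$ of eigenvectors, with $(T_\eta+b)\varphi_m=\lambda_m\varphi_m$ for all $m\in\mathbb Z$, satisfies $$|\varphi_m(n)|\le\gamma_{r,\eta}\,\frac{\langle m\rangle^{(r+1)(1-\eta)}}{\langle m-n\rangle^{(r+1)\eta}}\qquad\text{for all } m,n\in\mathbb Z,$$ for some constant $\gamma_{r,\eta}>0$ not depending on $m$ and $n$. (iii) For every $k\in\mathbb Z$ and all $0<q<(r+1)(4\eta-2)-2$,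 $$\sup_{t\in\mathbb R}\sum_{n\in\mathbb Z}\langle n\rangle^q\,\bigl|\langle e^{-it(T_\eta+b)}\delta_k,\delta_n\rangle\bigr|^2<\infty .$$
   Context: For $n\in\mathbb Z$, $\langle n\rangle:=|n|+1$. $\{\delta_n\}_{n\in\mathbb Z}$ is the canonical basis of $\ell^2(\mathbb Z)$, and $\langle u,v\rangle$ with two arguments in $\ell^2(\mathbb Z)$ denotes the inner product. Purely discrete spectrum means that the spectrum consists of isolated eigenvalues of finite multiplicity. The eigenvalues of $T_\eta+b$ are enumerated, with multiplicity, in nondecreasing order by $\mathbb Z$: $$\cdots\le\lambda_{-2}\le\lambda_{-1}\le\lambda_0\le\lambda_1\le\lambda_2\le\cdots,\qquad \lambda_0=\min\{\lambda_n:\lambda_n\ge 0\}.$$ *)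

theory Defs
  imports "HOL-Analysis.Analysis"
begin

section \<open>The complex Hilbert space of square-summable sequences indexed by the integers\<close>

typedef l2 = "{u :: int \<Rightarrow> complex. (\<lambda>n. (cmod (u n))\<^sup>2) summable_on UNIV}"
  by (rule exI[of _ "\<lambda>_. 0"]) simp

setup_lifting type_definition_l2

lemma l2_summable [simp]: "(\<lambda>n. (cmod (Rep_l2 u n))\<^sup>2) summable_on UNIV"
  using Rep_l2[of u] by simp

lemma Rep_l2_Abs_l2:
  "(\<lambda>n. (cmod (u n))\<^sup>2) summable_on UNIV \<Longrightarrow> Rep_l2 (Abs_l2 u) = u"
  by (rule Abs_l2_inverse) simp

lemma l2_eqI: "(\<And>n. Rep_l2 u n = Rep_l2 v n) \<Longrightarrow> u = v"
  by (metis Rep_l2_inject ext)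

lemma square_summable_add:
  fixes u v :: "int \<Rightarrow> complex"
  assumes "(\<lambda>n. (cmod (u n))\<^sup>2) summable_on UNIV" "(\<lambda>n. (cmod (v n))\<^sup>2) summable_on UNIV"
  shows "(\<lambda>n. (cmod (u n + v n))\<^sup>2) summable_on UNIV"
proof (rule summable_on_comparison_test)
  show "(\<lambda>n. 2 * (cmod (u n))\<^sup>2 + 2 * (cmod (v n))\<^sup>2) summable_on UNIV"
    by (intro summable_on_add summable_on_cmult_right assms)
  fix n
  have "(cmod (u n + v n))\<^sup>2 \<le> (cmod (u n) + cmod (v n))\<^sup>2"
    by (intro power_mono norm_triangle_ineq) auto
  also have "\<dots> \<le> 2 * (cmod (u n))\<^sup>2 + 2 * (cmod (v n))\<^sup>2"
    using sum_squares_bound[of "cmod (u n)" "cmod (v n)"] by (simp add: power2_sum)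
  finally show "(cmod (u n + v n))\<^sup>2 \<le> 2 * (cmod (u n))\<^sup>2 + 2 * (cmod (v n))\<^sup>2" .
qed auto

lemma square_summable_mult:
  fixes u c :: "int \<Rightarrow> complex"
  assumes "(\<lambda>n. (cmod (u n))\<^sup>2) summable_on UNIV" "\<And>n. cmod (c n) \<le> C"
  shows "(\<lambda>n. (cmod (c n * u n))\<^sup>2) summable_on UNIV"
proof (rule summable_on_comparison_test)
  show "(\<lambda>n. C\<^sup>2 * (cmod (u n))\<^sup>2) summable_on UNIV"
    by (intro summable_on_cmult_right assms)
  fix n
  have "(cmod (c n))\<^sup>2 \<le> C\<^sup>2"
    by (rule power_mono) (use assms in auto)
  then show "(cmod (c n * u n))\<^sup>2 \<le> C\<^sup>2 * (cmod (u n))\<^sup>2"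
    by (simp add: norm_mult power_mult_distrib mult_right_mono)
qed auto

lemma square_summable_product:
  fixes u v :: "int \<Rightarrow> complex"
  assumes "(\<lambda>n. (cmod (u n))\<^sup>2) summable_on UNIV" "(\<lambda>n. (cmod (v n))\<^sup>2) summable_on UNIV"
  shows "(\<lambda>n. cmod (u n) * cmod (v n)) summable_on UNIV"
proof (rule summable_on_comparison_test)
  show "(\<lambda>n. (cmod (u n))\<^sup>2 + (cmod (v n))\<^sup>2) summable_on UNIV"
    by (intro summable_on_add assms)
  fix n
  have "0 \<le> cmod (u n) * cmod (v n)" by simp
  moreover have "2 * (cmod (u n) * cmod (v n)) \<le> (cmod (u n))\<^sup>2 + (cmod (v n))\<^sup>2"
    using sum_squares_bound[of "cmod (u n)" "cmod (v n)"] by (simp add: mult.assoc)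
  ultimately show "cmod (u n) * cmod (v n) \<le> (cmod (u n))\<^sup>2 + (cmod (v n))\<^sup>2"
    by linarith
qed auto

instantiation l2 :: ab_group_add
begin
lift_definition zero_l2 :: l2 is "\<lambda>_. 0" by simp
lift_definition plus_l2 :: "l2 \<Rightarrow> l2 \<Rightarrow> l2" is "\<lambda>u v n. u n + v n"
  by (rule square_summable_add)
lift_definition uminus_l2 :: "l2 \<Rightarrow> l2" is "\<lambda>u n. - u n" by simp
definition minus_l2 :: "l2 \<Rightarrow> l2 \<Rightarrow> l2" where "u - v = u + - v" for u v :: l2
instance
  by (standard; (unfold minus_l2_def)?; (transfer; simp add: fun_eq_iff algebra_simps)?)
end

lift_definition scaleC :: "complex \<Rightarrow> l2 \<Rightarrow> l2" (infixr "*\<^sub>C" 75) is "\<lambda>c u n. c * u n"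
  by (rule square_summable_mult) auto

global_interpretation l2: vector_space "(*\<^sub>C)"
  by standard (transfer; simp add: fun_eq_iff algebra_simps)+

definition cinner :: "l2 \<Rightarrow> l2 \<Rightarrow> complex" where
  "cinner u v = (\<Sum>\<^sub>\<infinity>n. Rep_l2 u n * cnj (Rep_l2 v n))"

text \<open>
  The real Hilbert space structure underlying \<^const>\<open>cinner\<close>; it provides the norm
  and the topology.
\<close>

instantiation l2 :: real_vector
begin
definition scaleR_l2 :: "real \<Rightarrow> l2 \<Rightarrow> l2" where "scaleR c u = complex_of_real c *\<^sub>C u"
instance
  by standard
     (simp_all add: scaleR_l2_def l2.scale_right_distrib l2.scale_left_distrib)
end

instantiation l2 :: real_inner
begin
definition inner_l2 :: "l2 \<Rightarrow> l2 \<Rightarrow> real" where "inner u v = Re (cinner u v)"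
definition norm_l2 :: "l2 \<Rightarrow> real" where "norm u = sqrt (\<Sum>\<^sub>\<infinity>n. (cmod (Rep_l2 u n))\<^sup>2)"
definition sgn_l2 :: "l2 \<Rightarrow> l2" where "sgn u = u /\<^sub>R norm u" for u :: l2
definition dist_l2 :: "l2 \<Rightarrow> l2 \<Rightarrow> real" where "dist u v = norm (u - v)" for u v :: l2
definition uniformity_l2 :: "(l2 \<times> l2) filter" where
  "uniformity_l2 = (INF e\<in>{0<..}. principal {(u, v). dist u v < e})"
definition open_l2 :: "l2 set \<Rightarrow> bool" where
  "open_l2 U \<longleftrightarrow> (\<forall>x\<in>U. eventually (\<lambda>(x', y). x' = x \<longrightarrow> y \<in> U) uniformity)"
instance
proof
  have sm: "(\<lambda>n. Rep_l2 u n * cnj (Rep_l2 v n)) summable_on UNIV" for u v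
    by (rule abs_summable_summable)
       (use square_summable_product[of "Rep_l2 u" "Rep_l2 v"] in \<open>simp add: norm_mult\<close>)
  fix c :: real and u v w :: l2
  show "dist u v = norm (u - v)" "sgn u = u /\<^sub>R norm u"
    by (rule dist_l2_def, rule sgn_l2_def)
  show "uniformity = (INF e\<in>{0<..}. principal {(x, y). dist x (y::l2) < e})"
    by (rule uniformity_l2_def)
  show "open U = (\<forall>x\<in>U. \<forall>\<^sub>F (x', y) in uniformity. x' = x \<longrightarrow> y \<in> U)" for U :: "l2 set"
    by (rule open_l2_def)
  have "cinner v u = cnj (cinner u v)"
    by (simp add: cinner_def mult.commute flip: infsum_cnj)
  then show "inner u v = inner v u" by (simp add: inner_l2_def)
  have "cinner (u + v) w = cinner u w + cinner v w"
    by (simp add: cinner_def plus_l2.rep_eq distrib_right infsum_add sm)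
  then show "inner (u + v) w = inner u w + inner v w" by (simp add: inner_l2_def)
  have "cinner (c *\<^sub>R u) v = complex_of_real c * cinner u v"
    by (simp add: cinner_def scaleR_l2_def scaleC.rep_eq mult.assoc infsum_cmult_right')
  then show "inner (c *\<^sub>R u) v = c * inner u v" by (simp add: inner_l2_def)
  have "cinner u u = complex_of_real (\<Sum>\<^sub>\<infinity>n. (cmod (Rep_l2 u n))\<^sup>2)"
    unfolding cinner_def complex_norm_square[symmetric] of_real_power[symmetric]
    by (intro infsumI has_sum_of_real has_sum_infsum l2_summable)
  then have eq: "inner u u = (\<Sum>\<^sub>\<infinity>n. (cmod (Rep_l2 u n))\<^sup>2)"
    by (simp add: inner_l2_def)
  show "norm u = sqrt (inner u u)" by (simp add: norm_l2_def eq)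
  show "0 \<le> inner u u" by (simp add: eq infsum_nonneg)
  show "inner u u = 0 \<longleftrightarrow> u = 0"
  proof
    assume "inner u u = 0"
    then have "(cmod (Rep_l2 u n))\<^sup>2 = 0" for n
      using nonneg_infsum_le_0D[of "\<lambda>n. (cmod (Rep_l2 u n))\<^sup>2" UNIV n] by (simp add: eq)
    then show "u = 0" by (intro l2_eqI) (simp add: zero_l2.rep_eq)
  next
    assume "u = 0"
    then show "inner u u = 0" unfolding eq by (simp add: zero_l2.rep_eq)
  qed
qed
end

lift_definition delta :: "int \<Rightarrow> l2" is "\<lambda>k n. if n = k then 1 else 0"
proof -
  fix k :: int
  show "(\<lambda>n. (cmod (if n = k then 1 else 0))\<^sup>2) summable_on UNIV"
    by (rule finite_nonzero_values_imp_summable_on)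
       (rule finite_subset[of _ "{k}"], auto split: if_splits)
qed

definition orthonormal_basis :: "(int \<Rightarrow> l2) \<Rightarrow> bool" where
  "orthonormal_basis \<phi> \<longleftrightarrow>
     (\<forall>m m'. cinner (\<phi> m) (\<phi> m') = (if m = m' then 1 else 0)) \<and>
     closure (l2.span (range \<phi>)) = UNIV"


section \<open>Unbounded operators\<close>

text \<open>
  An operator is given by its domain together with its action; values of the action outside
  the domain carry no meaning.
\<close>

type_synonym l2_operator = "l2 set \<times> (l2 \<Rightarrow> l2)"

abbreviation op_dom :: "l2_operator \<Rightarrow> l2 set" where "op_dom H \<equiv> fst H"
abbreviation op_app :: "l2_operator \<Rightarrow> l2 \<Rightarrow> l2" where "op_app H \<equiv> snd H"

definition add_bounded :: "l2_operator \<Rightarrow> (l2 \<Rightarrow> l2) \<Rightarrow> l2_operator" where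
  "add_bounded H B = (op_dom H, \<lambda>u. op_app H u + B u)"

definition resolvent_set :: "l2_operator \<Rightarrow> complex set" where
  "resolvent_set H = {z. bij_betw (\<lambda>u. op_app H u - z *\<^sub>C u) (op_dom H) UNIV \<and>
     (\<exists>C. \<forall>u\<in>op_dom H. norm u \<le> C * norm (op_app H u - z *\<^sub>C u))}"

definition spectrum :: "l2_operator \<Rightarrow> complex set" where
  "spectrum H = - resolvent_set H"

definition eigenspace :: "l2_operator \<Rightarrow> complex \<Rightarrow> l2 set" where
  "eigenspace H z = {u \<in> op_dom H. op_app H u = z *\<^sub>C u}"

definition is_eigenvalue :: "l2_operator \<Rightarrow> complex \<Rightarrow> bool" where
  "is_eigenvalue H z \<longleftrightarrow> (\<exists>u\<in>eigenspace H z. u \<noteq> 0)"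

text \<open>
  Finiteness of the multiplicity is a separate notion because \<^const>\<open>l2.dim\<close> is \<open>0\<close>
  on infinite-dimensional subspaces.
\<close>

definition finite_multiplicity :: "l2_operator \<Rightarrow> complex \<Rightarrow> bool" where
  "finite_multiplicity H z \<longleftrightarrow> (\<exists>B. finite B \<and> eigenspace H z \<subseteq> l2.span B)"

definition multiplicity :: "l2_operator \<Rightarrow> complex \<Rightarrow> nat" where
  "multiplicity H z = l2.dim (eigenspace H z)"

definition purely_discrete_spectrum :: "l2_operator \<Rightarrow> bool" where
  "purely_discrete_spectrum H \<longleftrightarrow>
     (\<forall>z\<in>spectrum H. z isolated_in spectrum H \<and> is_eigenvalue H z \<and> finite_multiplicity H z)"

text \<open>
  The last two conjuncts of the following definition say that \<open>ev 0\<close> is the minimum of the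
  nonnegative eigenvalues. If this minimum is a multiple eigenvalue, it leaves open which of its
  occurrences carries the index \<open>0\<close>.
\<close>

definition eigenvalue_enumeration :: "l2_operator \<Rightarrow> (int \<Rightarrow> real) \<Rightarrow> bool" where
  "eigenvalue_enumeration H ev \<longleftrightarrow>
     mono ev \<and>
     (\<forall>z. finite {n. complex_of_real (ev n) = z} \<and> finite_multiplicity H z \<and>
          card {n. complex_of_real (ev n) = z} = multiplicity H z) \<and>
     0 \<le> ev 0 \<and> (\<forall>n. 0 \<le> ev n \<longrightarrow> ev 0 \<le> ev n)"

text \<open>
  For self-adjoint \<open>H\<close>, the family \<open>exp (- i t H)\<close> is the strongly continuous one-parameter
  unitary group with generator \<open>- i H\<close> (Stone). The last conjunct expresses equality of
  operators, including their domains: \<open>u\<close> lies in the domain of \<open>H\<close> iff its orbit is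
  differentiable at \<open>0\<close>, and then the derivative is \<open>- i H u\<close>. The group is unique since a strongly
  continuous group is determined by its generator.
\<close>

definition is_unitary_group_of :: "l2_operator \<Rightarrow> (real \<Rightarrow> l2 \<Rightarrow> l2) \<Rightarrow> bool" where
  "is_unitary_group_of H U \<longleftrightarrow>
     (\<forall>t. Vector_Spaces.linear (*\<^sub>C) (*\<^sub>C) (U t) \<and> surj (U t) \<and>
          (\<forall>u v. cinner (U t u) (U t v) = cinner u v)) \<and>
     U 0 = id \<and> (\<forall>s t. U (s + t) = U s \<circ> U t) \<and>
     (\<forall>u. continuous_on UNIV (\<lambda>t. U t u)) \<and>
     (\<forall>u w. ((\<lambda>t. U t u) has_vector_derivative w) (at 0) \<longleftrightarrow>
            u \<in> op_dom H \<and> w = (- \<i>) *\<^sub>C op_app H u)"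

definition exp_group :: "l2_operator \<Rightarrow> real \<Rightarrow> l2 \<Rightarrow> l2" where
  "exp_group H = (THE U. is_unitary_group_of H U)"


section \<open>The operator under study\<close>

definition bracket :: "int \<Rightarrow> real" where
  "bracket n = real_of_int \<bar>n\<bar> + 1"

definition potential :: "real \<Rightarrow> int \<Rightarrow> real" where
  "potential \<eta> n = real_of_int (sgn n) * real_of_int \<bar>n\<bar> powr \<eta>"

definition T_dom :: "real \<Rightarrow> l2 set" where
  "T_dom \<eta> = {u. (\<lambda>n. real_of_int \<bar>n\<bar> powr (2 * \<eta>) * (cmod (Rep_l2 u n))\<^sup>2) summable_on UNIV}"

definition T_seq :: "(int \<Rightarrow> complex) \<Rightarrow> real \<Rightarrow> l2 \<Rightarrow> int \<Rightarrow> complex" where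
  "T_seq a \<eta> u n =
     (\<Sum>\<^sub>\<infinity>m. a (n - m) * Rep_l2 u m) + complex_of_real (potential \<eta> n) * Rep_l2 u n"

definition T_op :: "(int \<Rightarrow> complex) \<Rightarrow> real \<Rightarrow> l2_operator" where
  "T_op a \<eta> = (T_dom \<eta>, \<lambda>u. Abs_l2 (T_seq a \<eta> u))"

definition mult_op :: "(int \<Rightarrow> real) \<Rightarrow> l2 \<Rightarrow> l2" where
  "mult_op b u = Abs_l2 (\<lambda>n. complex_of_real (b n) * Rep_l2 u n)"

text \<open>
  The arguments of \<^const>\<open>Abs_l2\<close> above are square-summable in the cases of interest, so that
  \<^const>\<open>T_op\<close> and \<^const>\<open>mult_op\<close> act by the formulas for sequences.
\<close>

lemma Rep_l2_mult_op:
  assumes "bounded (range b)"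
  shows "Rep_l2 (mult_op b u) n = complex_of_real (b n) * Rep_l2 u n"
proof -
  obtain C where "\<And>n. cmod (complex_of_real (b n)) \<le> C"
    using assms by (auto simp: bounded_iff)
  from square_summable_mult[OF l2_summable[of u] this] show ?thesis
    unfolding mult_op_def by (subst Rep_l2_Abs_l2) auto
qed

lemma square_summable_convolution:
  fixes a :: "int \<Rightarrow> complex" and u :: l2
  assumes a: "(\<lambda>m. cmod (a m)) summable_on UNIV"
  shows "(\<lambda>m. cmod (a (n - m) * Rep_l2 u m)) summable_on UNIV" (is ?th1)
    and "(\<lambda>n. (cmod (\<Sum>\<^sub>\<infinity>m. a (n - m) * Rep_l2 u m))\<^sup>2) summable_on UNIV" (is ?th2)
proof -
  define x where "x m = cmod (Rep_l2 u m)" for m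
  define w where "w n m = cmod (a (n - m))" for n m
  define A where "A = (\<Sum>\<^sub>\<infinity>m. cmod (a m))"
  have x2: "(\<lambda>m. (x m)\<^sup>2) summable_on UNIV" and x0: "x m \<ge> 0" and w0: "w n m \<ge> 0" for n m
    by (simp_all add: x_def w_def)
  have A0: "A \<ge> 0" by (simp add: A_def infsum_nonneg)
  have bij1: "bij_betw (\<lambda>m. n - m) (UNIV::int set) UNIV" for n
    by (rule bij_betwI[of _ _ _ "\<lambda>m. n - m"]) auto
  have bij2: "bij_betw (\<lambda>n. n - m) (UNIV::int set) UNIV" for m
    by (rule bij_betwI[of _ _ _ "\<lambda>n. n + m"]) auto
  have w1: "(\<lambda>m. w n m) summable_on UNIV" and W1: "(\<Sum>\<^sub>\<infinity>m. w n m) = A" for n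
    using summable_on_reindex_bij_betw[OF bij1, of "\<lambda>m. cmod (a m)" n] a
      infsum_reindex_bij_betw[OF bij1, of "\<lambda>m. cmod (a m)" n] by (auto simp: w_def A_def)
  have w2: "(\<lambda>n. w n m) summable_on UNIV" and W2: "(\<Sum>\<^sub>\<infinity>n. w n m) = A" for m
    using summable_on_reindex_bij_betw[OF bij2, of "\<lambda>m. cmod (a m)" m] a
      infsum_reindex_bij_betw[OF bij2, of "\<lambda>m. cmod (a m)" m] by (auto simp: w_def A_def)
  have "(\<lambda>(m, n). w n m * (x m)\<^sup>2) summable_on UNIV \<times> UNIV"
  proof (rule summable_on_SigmaI)
    fix m
    show "((\<lambda>n. case (m, n) of (m, n) \<Rightarrow> w n m * (x m)\<^sup>2) has_sum A * (x m)\<^sup>2) UNIV"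
      using has_sum_cmult_left[OF has_sum_infsum[OF w2[of m]], of "(x m)\<^sup>2"] by (simp add: W2)
  qed (use w0 x2 in \<open>auto intro: summable_on_cmult_right\<close>)
  then have joint: "(\<lambda>(n, m). w n m * (x m)\<^sup>2) summable_on UNIV \<times> UNIV"
    by (subst (asm) summable_on_swap) (simp add: case_prod_unfold)
  have s2: "(\<lambda>m. w n m * (x m)\<^sup>2) summable_on UNIV" for n
    by (rule summable_on_SigmaD1[OF joint]) (auto simp: w0)
  have S2: "(\<lambda>n. \<Sum>\<^sub>\<infinity>m. w n m * (x m)\<^sup>2) summable_on UNIV"
    by (rule summable_on_Sigma_banach[OF joint])
  have s1: "(\<lambda>m. w n m * x m) summable_on UNIV" for n
  proof (rule summable_on_comparison_test)
    show "(\<lambda>m. w n m + w n m * (x m)\<^sup>2) summable_on UNIV"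
      by (intro summable_on_add w1 s2)
    fix m
    have "x m \<le> 1 + (x m)\<^sup>2"
      using sum_squares_bound[of 1 "x m"] x0[of m] by simp
    from mult_left_mono[OF this w0] show "w n m * x m \<le> w n m + w n m * (x m)\<^sup>2"
      by (simp add: algebra_simps)
  qed (simp add: w0 x0)
  then show ?th1 by (simp add: norm_mult w_def x_def)
  have cs: "(\<Sum>\<^sub>\<infinity>m. w n m * x m)\<^sup>2 \<le> A * (\<Sum>\<^sub>\<infinity>m. w n m * (x m)\<^sup>2)" for n
  proof (cases "A = 0")
    case True
    then have "w n m = 0" for m
      using nonneg_infsum_le_0D[of "w n" UNIV m] w1[of n] W1[of n] w0 by simp
    then show ?thesis by simp
  next
    case False
    define X where "X = (\<Sum>\<^sub>\<infinity>m. w n m * x m)"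
    define Y where "Y = (\<Sum>\<^sub>\<infinity>m. w n m * (x m)\<^sup>2)"
    have "((\<lambda>m. A\<^sup>2 * (w n m * (x m)\<^sup>2) + (- 2 * A * X) * (w n m * x m) + X\<^sup>2 * w n m)
        has_sum (A\<^sup>2 * Y + (- 2 * A * X) * X + X\<^sup>2 * A)) UNIV"
      unfolding X_def Y_def W1[of n, symmetric]
      by (intro has_sum_add has_sum_cmult_right has_sum_infsum s1 s2 w1)
    moreover have "0 \<le> A\<^sup>2 * (w n m * (x m)\<^sup>2) + (- 2 * A * X) * (w n m * x m) + X\<^sup>2 * w n m" for m
    proof -
      have "A\<^sup>2 * (w n m * (x m)\<^sup>2) + (- 2 * A * X) * (w n m * x m) + X\<^sup>2 * w n m
          = w n m * (A * x m - X)\<^sup>2"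
        by (simp add: power2_eq_square algebra_simps)
      then show ?thesis by (simp add: w0)
    qed
    ultimately have "0 \<le> A\<^sup>2 * Y + (- 2 * A * X) * X + X\<^sup>2 * A"
      by (rule has_sum_nonneg)
    also have "\<dots> = A * (A * Y - X\<^sup>2)" by (simp add: power2_eq_square algebra_simps)
    finally show ?thesis
      using A0 False by (simp add: X_def Y_def zero_le_mult_iff)
  qed
  show ?th2
  proof (rule summable_on_comparison_test)
    show "(\<lambda>n. A * (\<Sum>\<^sub>\<infinity>m. w n m * (x m)\<^sup>2)) summable_on UNIV"
      by (intro summable_on_cmult_right S2)
    fix n
    have "cmod (\<Sum>\<^sub>\<infinity>m. a (n - m) * Rep_l2 u m) \<le> (\<Sum>\<^sub>\<infinity>m. w n m * x m)"
      using norm_infsum_bound[of "\<lambda>m. a (n - m) * Rep_l2 u m" UNIV] s1[of n]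
      by (simp add: norm_mult w_def x_def)
    then have "(cmod (\<Sum>\<^sub>\<infinity>m. a (n - m) * Rep_l2 u m))\<^sup>2 \<le> (\<Sum>\<^sub>\<infinity>m. w n m * x m)\<^sup>2"
      by (intro power_mono) auto
    also note cs
    finally show "(cmod (\<Sum>\<^sub>\<infinity>m. a (n - m) * Rep_l2 u m))\<^sup>2 \<le> A * (\<Sum>\<^sub>\<infinity>m. w n m * (x m)\<^sup>2)" .
  qed auto
qed

lemma Rep_l2_T_op:
  assumes a: "(\<lambda>m. cmod (a m) * real_of_int \<bar>m\<bar> powr r) summable_on UNIV" "r \<ge> 0" "a 0 = 0"
    and u: "u \<in> op_dom (T_op a \<eta>)"
  shows "Rep_l2 (op_app (T_op a \<eta>) u) n =
    (\<Sum>\<^sub>\<infinity>m. a (n - m) * Rep_l2 u m)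
      + of_int (sgn n) * complex_of_real (real_of_int \<bar>n\<bar> powr \<eta>) * Rep_l2 u n"
proof -
  have a1: "(\<lambda>m. cmod (a m)) summable_on UNIV"
  proof (rule summable_on_comparison_test[OF a(1)])
    fix m
    show "cmod (a m) \<le> cmod (a m) * real_of_int \<bar>m\<bar> powr r"
      using a(2,3) ge_one_powr_ge_zero[of "real_of_int \<bar>m\<bar>" r]
      by (cases "m = 0") (auto simp: mult_le_cancel_left1)
  qed auto
  have "(\<lambda>n. (cmod (complex_of_real (potential \<eta> n) * Rep_l2 u n))\<^sup>2) summable_on UNIV"
  proof (rule summable_on_comparison_test)
    show "(\<lambda>n. real_of_int \<bar>n\<bar> powr (2 * \<eta>) * (cmod (Rep_l2 u n))\<^sup>2) summable_on UNIV"
      using u by (simp add: T_op_def T_dom_def)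
    fix n
    have "(potential \<eta> n)\<^sup>2 \<le> real_of_int \<bar>n\<bar> powr (2 * \<eta>)"
      by (cases "n = 0") (auto simp: potential_def power2_eq_square powr_add[symmetric] sgn_if)
    then show "(cmod (complex_of_real (potential \<eta> n) * Rep_l2 u n))\<^sup>2
        \<le> real_of_int \<bar>n\<bar> powr (2 * \<eta>) * (cmod (Rep_l2 u n))\<^sup>2"
      by (simp add: norm_mult power_mult_distrib mult_right_mono)
  qed auto
  then have "(\<lambda>n. (cmod (T_seq a \<eta> u n))\<^sup>2) summable_on UNIV"
    unfolding T_seq_def by (intro square_summable_add square_summable_convolution a1)
  then show ?thesis
    by (simp add: T_op_def Rep_l2_Abs_l2 T_seq_def potential_def)
qed

end

theory Submission
  imports Defs
begin

text \<open>
  The operator is a bounded symmetric perturbation, of norm at most \<open>M\<close>, of the diagonal operator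
  with entries \<open>d n = potential \<eta> n\<close>. Bounded sets for its graph norm are relatively compact in
  \<open>l2\<close>, so a variational argument together with Zorn's lemma yields an orthonormal basis of
  eigenvectors. Comparing the perturbed and the unperturbed operator on combinations of eigenvectors
  shows that the number of eigenvalues of either one in a bounded interval is at most the number of
  eigenvalues of the other one in the interval enlarged by \<open>M\<close> on both sides. Hence the eigenvalue
  with index \<open>n\<close> lies, up to \<open>M\<close>, between \<open>d (n - L)\<close> and \<open>d (n + L)\<close> for a fixed \<open>L\<close>, and \<open>d\<close> grows
  by at most \<open>1\<close> per step.

  An eigenvector for the index \<open>m\<close> satisfies, up to bounded terms,
  \<open>\<bar>d n - d m\<bar> \<bar>u n\<bar> \<le> (\<bar>a\<bar> * \<bar>u\<bar>) n\<close>, and \<open>\<bar>d n - d m\<bar>\<close> dominates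
  \<open>\<langle>m - n\<rangle>\<^sup>\<eta> / \<langle>m\<rangle>\<^sup>1\<^sup>-\<^sup>\<eta>\<close>; iterating gains one power of this weight at a time until the decay of \<open>a\<close>
  is exhausted, which gives the exponent \<open>r + 1\<close>. Expanding the propagator in the eigenbasis bounds its
  entries, uniformly in time, by \<open>\<Sum>m. \<bar>\<phi> m k\<bar> \<bar>\<phi> m n\<bar>\<close>, and the decay of the eigenvectors bounds the
  \<open>q\<close>-th moment of this sum.
\<close>

section \<open>Square-summable sequences\<close>

text \<open>The operator is unbounded above and below, and this shapes two steps. Its quadratic form
  has no minimum, so eigenvectors are sought as minimisers of \<open>norm (\<H> u)\<close>, that is,
  as eigenvectors of the square, which is then factored. Nor is there a lowest eigenvalue from which
  min-max could count; indices are compared through bounded windows anchored at the smallest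
  nonnegative eigenvalue, and the shift \<open>L\<close> is the price.

  The condition on \<open>q\<close> has one source with two faces. With \<open>p = r + 1\<close>,
  the inequality \<open>q < p * (4 * \<eta> - 2) - 2\<close> makes the weighted sum over
  \<open>m\<close> in the Cauchy-Schwarz step converge, and it also makes the far part of the
  \<open>q\<close>-th moment of each eigenvector bounded uniformly in \<open>m\<close>.\<close>

lemma Rep_l2_diff [simp]: "Rep_l2 (u - v) n = Rep_l2 u n - Rep_l2 v n"
  unfolding minus_l2_def plus_l2.rep_eq uminus_l2.rep_eq by simp

lemmas Rep_l2_simps [simp] = zero_l2.rep_eq plus_l2.rep_eq uminus_l2.rep_eq scaleC.rep_eq

lemma Rep_l2_scaleR [simp]: "Rep_l2 (c *\<^sub>R u) n = complex_of_real c * Rep_l2 u n"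
  by (simp add: scaleR_l2_def)

lemma Rep_l2_sum [simp]: "Rep_l2 (sum f F) n = (\<Sum>i\<in>F. Rep_l2 (f i) n)"
  by (induction F rule: infinite_finite_induct) simp_all

lemma Rep_l2_delta: "Rep_l2 (delta k) n = (if n = k then 1 else 0)"
  by (simp add: delta.rep_eq)

lemma cinner_summable: "(\<lambda>n. Rep_l2 u n * cnj (Rep_l2 v n)) summable_on A"
proof (rule summable_on_subset_banach)
  show "(\<lambda>n. Rep_l2 u n * cnj (Rep_l2 v n)) summable_on UNIV"
    by (rule abs_summable_summable)
       (use square_summable_product[of "Rep_l2 u" "Rep_l2 v"] in \<open>simp add: norm_mult\<close>)
qed simp

lemma cinner_add_left: "cinner (u + v) w = cinner u w + cinner v w"
  by (simp add: cinner_def distrib_right infsum_add cinner_summable)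

lemma cinner_scaleC_left: "cinner (c *\<^sub>C u) v = c * cinner u v"
  by (simp add: cinner_def mult.assoc infsum_cmult_right')

lemma cinner_commute: "cinner v u = cnj (cinner u v)"
  by (simp add: cinner_def mult.commute flip: infsum_cnj)

lemma cinner_add_right: "cinner u (v + w) = cinner u v + cinner u w"
  by (simp add: cinner_def distrib_left infsum_add cinner_summable)

lemma cinner_scaleC_right: "cinner u (c *\<^sub>C v) = cnj c * cinner u v"
  by (simp add: cinner_def mult.left_commute infsum_cmult_right')

lemma cinner_zero_left [simp]: "cinner 0 v = 0" and cinner_zero_right [simp]: "cinner v 0 = 0"
  by (simp_all add: cinner_def)

lemma cinner_minus_left: "cinner (- u) v = - cinner u v"
  by (simp add: cinner_def infsum_uminus)

lemma cinner_diff_left: "cinner (u - v) w = cinner u w - cinner v w"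
  unfolding minus_l2_def cinner_add_left cinner_minus_left by simp

lemma cinner_minus_right: "cinner u (- v) = - cinner u v"
  by (simp add: cinner_def infsum_uminus)

lemma cinner_diff_right: "cinner u (v - w) = cinner u v - cinner u w"
  unfolding minus_l2_def cinner_add_right cinner_minus_right by simp

lemma cinner_sum_left: "cinner (sum f F) v = (\<Sum>i\<in>F. cinner (f i) v)"
  by (induction F rule: infinite_finite_induct) (simp_all add: cinner_add_left)

lemma cinner_sum_right: "cinner u (sum f F) = (\<Sum>i\<in>F. cinner u (f i))"
  by (induction F rule: infinite_finite_induct) (simp_all add: cinner_add_right)

lemma norm_l2_square: "(norm u)\<^sup>2 = (\<Sum>\<^sub>\<infinity>n. (cmod (Rep_l2 u n))\<^sup>2)"
  by (simp add: norm_l2_def infsum_nonneg)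

lemma cinner_self: "cinner u u = complex_of_real ((norm u)\<^sup>2)"
  unfolding norm_l2_square cinner_def complex_norm_square[symmetric] of_real_power[symmetric]
  by (intro infsumI has_sum_of_real has_sum_infsum l2_summable)

lemma norm_scaleC: "norm (c *\<^sub>C u) = cmod c * norm u"
proof -
  have "(norm (c *\<^sub>C u))\<^sup>2 = (cmod c * norm u)\<^sup>2"
    by (simp add: norm_l2_square norm_mult power_mult_distrib infsum_cmult_right')
  then show ?thesis by (simp add: power2_eq_iff_nonneg)
qed

text \<open>Multiplying \<open>u\<close> by the conjugate phase makes the product real and
  nonnegative, and the real Cauchy-Schwarz inequality for \<open>inner\<close> applies.\<close>

lemma cmod_cinner_le: "cmod (cinner u v) \<le> norm u * norm v"
proof (cases "cinner u v = 0")
  case False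
  define c where "c = cnj (cinner u v) / cmod (cinner u v)"
  have "cmod (cinner u v) = Re (cinner (c *\<^sub>C u) v)"
    using False by (simp add: c_def cinner_scaleC_left complex_norm_square[symmetric]
        mult.commute power2_eq_square)
  also have "\<dots> = inner (c *\<^sub>C u) v" by (simp add: inner_l2_def)
  also have "\<dots> \<le> norm (c *\<^sub>C u) * norm v" by (rule norm_cauchy_schwarz)
  also have "\<dots> = norm u * norm v" using False by (simp add: norm_scaleC c_def norm_divide)
  finally show ?thesis .
qed simp

lemma norm_delta [simp]: "norm (delta k) = 1"
proof -
  have "((\<lambda>n. (cmod (Rep_l2 (delta k) n))\<^sup>2) has_sum 1) UNIV"
    by (rule has_sum_finite_neutralI[of "{k}"]) (auto simp: Rep_l2_delta)
  then have "(norm (delta k))\<^sup>2 = 1\<^sup>2" by (simp add: norm_l2_square infsumI)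
  then show ?thesis by (simp only: power2_eq_iff_nonneg norm_ge_zero zero_le_one)
qed

lemma cinner_delta_right [simp]: "cinner u (delta k) = Rep_l2 u k"
proof -
  have "((\<lambda>n. Rep_l2 u n * cnj (Rep_l2 (delta k) n)) has_sum Rep_l2 u k) UNIV"
    by (rule has_sum_finite_neutralI[of "{k}"]) (auto simp: Rep_l2_delta)
  then show ?thesis by (simp add: cinner_def infsumI)
qed

lemma cinner_delta_left [simp]: "cinner (delta k) u = cnj (Rep_l2 u k)"
  using cinner_commute[of "delta k" u] by simp

lemma cmod_Rep_l2_le: "cmod (Rep_l2 u n) \<le> norm u"
  using cmod_cinner_le[of u "delta n"] by simp

lemma bounded_linear_cinner_left: "bounded_linear (\<lambda>u. cinner u v)"
  by (rule bounded_linear_intro[of _ "norm v"])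
     (auto simp: cinner_add_left scaleR_l2_def cinner_scaleC_left cmod_cinner_le scaleR_conv_of_real)

lemma bounded_linear_cinner_right: "bounded_linear (\<lambda>u. cinner v u)"
proof (rule bounded_linear_intro[of _ "norm v"])
  show "cmod (cinner v x) \<le> norm x * norm v" for x
    using cmod_cinner_le[of v x] by (simp add: mult.commute)
qed (auto simp: cinner_add_right scaleR_l2_def cinner_scaleC_right scaleR_conv_of_real)

lemma bounded_linear_Rep_l2: "bounded_linear (\<lambda>u. Rep_l2 u n)"
  using bounded_linear_cinner_left[of "delta n"] by simp

lemma bounded_linear_scaleC: "bounded_linear (\<lambda>u. c *\<^sub>C u)"
  by (rule bounded_linear_intro[of _ "cmod c"])
     (auto simp: l2.scale_right_distrib scaleR_l2_def norm_scaleC mult.commute)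

lemma sum_cmod_Rep_l2_le: "finite F \<Longrightarrow> (\<Sum>n\<in>F. (cmod (Rep_l2 u n))\<^sup>2) \<le> (norm u)\<^sup>2"
  unfolding norm_l2_square by (rule finite_sum_le_infsum) auto

lemma norm_l2_leI:
  assumes "\<And>F. finite F \<Longrightarrow> (\<Sum>n\<in>F. (cmod (Rep_l2 u n))\<^sup>2) \<le> B\<^sup>2" "0 \<le> B"
  shows "norm u \<le> B"
proof -
  have "(norm u)\<^sup>2 \<le> B\<^sup>2"
    unfolding norm_l2_square by (rule infsum_le_finite_sums) (use assms in auto)
  then show ?thesis using assms(2) by (rule power2_le_imp_le)
qed

section \<open>Convergence criteria in l2 and completeness\<close>

lemma nonneg_bounded_sums_summable_on:
  fixes f :: "'a \<Rightarrow> real"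
  assumes "\<And>x. 0 \<le> f x" "\<And>F. finite F \<Longrightarrow> F \<subseteq> A \<Longrightarrow> sum f F \<le> B"
  shows "f summable_on A"
  by (rule nonneg_bdd_above_summable_on) (use assms in \<open>auto simp: bdd_above_def\<close>)

text \<open>Coordinatewise convergence becomes norm convergence once the tails are uniformly small.
  Tails are tested on finite sets \<open>G\<close> avoiding \<open>S\<close>, so that no infinite
  sum has to be formed.\<close>

lemma tendsto_l2I:
  fixes f :: "'a \<Rightarrow> l2"
  assumes lim: "\<And>n. ((\<lambda>t. Rep_l2 (f t) n) \<longlongrightarrow> Rep_l2 u n) F"
    and tail: "\<And>e. e > 0 \<Longrightarrow> \<exists>S. finite S \<and> (\<forall>\<^sub>F t in F. \<forall>G. finite G \<longrightarrow> G \<inter> S = {} \<longrightarrow>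
      (\<Sum>n\<in>G. (cmod (Rep_l2 (f t) n - Rep_l2 u n))\<^sup>2) \<le> e)"
  shows "(f \<longlongrightarrow> u) F"
proof (rule tendstoI)
  fix e :: real assume e: "e > 0"
  define h where "h t n = (cmod (Rep_l2 (f t) n - Rep_l2 u n))\<^sup>2" for t n
  have "(e/2)\<^sup>2 / 2 > 0" using e by simp
  from tail[OF this] obtain S where S: "finite S"
    "\<forall>\<^sub>F t in F. \<forall>G. finite G \<longrightarrow> G \<inter> S = {} \<longrightarrow> (\<Sum>n\<in>G. h t n) \<le> (e/2)\<^sup>2/2"
    unfolding h_def by blast
  have "((\<lambda>t. \<Sum>n\<in>S. h t n) \<longlongrightarrow> (\<Sum>n\<in>S. (cmod (Rep_l2 u n - Rep_l2 u n))\<^sup>2)) F"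
    unfolding h_def by (intro tendsto_intros lim)
  then have "\<forall>\<^sub>F t in F. (\<Sum>n\<in>S. h t n) < (e/2)\<^sup>2/2"
    by (rule order_tendstoD) (use e in simp)
  with S(2) show "\<forall>\<^sub>F t in F. dist (f t) u < e"
  proof eventually_elim
    case (elim t)
    have "norm (f t - u) \<le> e/2"
    proof (rule norm_l2_leI)
      fix G :: "int set" assume G: "finite G"
      have "sum (h t) G = sum (h t) (G \<inter> S) + sum (h t) (G - S)"
        by (rule sum.Int_Diff[OF G])
      also have "sum (h t) (G \<inter> S) \<le> sum (h t) S"
        by (rule sum_mono2) (auto simp: S h_def)
      also have "sum (h t) (G - S) \<le> (e/2)\<^sup>2/2"
        by (rule elim(1)[rule_format]) (use G in auto)
      finally show "(\<Sum>n\<in>G. (cmod (Rep_l2 (f t - u) n))\<^sup>2) \<le> (e/2)\<^sup>2"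
        using elim(2) by (simp add: h_def)
    qed (use e in simp)
    then show ?case using e by (simp add: dist_norm)
  qed
qed

lemma summable_on_tail_bound:
  fixes g :: "'a \<Rightarrow> real"
  assumes "g summable_on A" "\<And>x. 0 \<le> g x" "e > 0"
  obtains S where "finite S" "S \<subseteq> A"
    "\<And>G. finite G \<Longrightarrow> G \<subseteq> A \<Longrightarrow> G \<inter> S = {} \<Longrightarrow> sum g G \<le> e"
proof -
  obtain S where S: "finite S" "S \<subseteq> A" "dist (sum g S) (infsum g A) \<le> e"
    using infsum_finite_approximation[OF assms(1,3)] by auto
  have "sum g G \<le> e" if "finite G" "G \<subseteq> A" "G \<inter> S = {}" for G
  proof -
    have "sum g S + sum g G = sum g (S \<union> G)"
      using that S by (subst sum.union_disjoint) auto
    also have "\<dots> \<le> infsum g A"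
      by (rule finite_sum_le_infsum) (use assms that S in auto)
    finally show ?thesis using S(3) by (simp add: dist_real_def)
  qed
  with S(1,2) show thesis by (rule that)
qed

text \<open>Dominated convergence for the counting measure on the integers. The square-summable
  majorant \<open>g\<close> supplies the uniform tails.\<close>

lemma tendsto_l2_dominated:
  fixes f :: "'a \<Rightarrow> l2"
  assumes lim: "\<And>n. ((\<lambda>t. Rep_l2 (f t) n) \<longlongrightarrow> Rep_l2 u n) F"
    and dom: "\<forall>\<^sub>F t in F. \<forall>n. cmod (Rep_l2 (f t) n - Rep_l2 u n) \<le> g n"
    and g: "(\<lambda>n. (g n)\<^sup>2) summable_on UNIV"
  shows "(f \<longlongrightarrow> u) F"
proof (rule tendsto_l2I[OF lim])
  fix e :: real assume "e > 0"
  obtain S where S: "finite S"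
    "\<And>G. finite G \<Longrightarrow> G \<inter> S = {} \<Longrightarrow> (\<Sum>n\<in>G. (g n)\<^sup>2) \<le> e"
    by (rule summable_on_tail_bound[OF g _ \<open>e > 0\<close>]) auto
  have "\<forall>\<^sub>F t in F. \<forall>G. finite G \<longrightarrow> G \<inter> S = {} \<longrightarrow>
      (\<Sum>n\<in>G. (cmod (Rep_l2 (f t) n - Rep_l2 u n))\<^sup>2) \<le> e"
    using dom
  proof eventually_elim
    case (elim t)
    have "(\<Sum>n\<in>G. (cmod (Rep_l2 (f t) n - Rep_l2 u n))\<^sup>2) \<le> (\<Sum>n\<in>G. (g n)\<^sup>2)" for G
      by (rule sum_mono, rule power_mono) (use elim in auto)
    then show ?case using S(2) by (blast intro: order_trans)
  qed
  with S(1) show "\<exists>S. finite S \<and> (\<forall>\<^sub>F t in F. \<forall>G. finite G \<longrightarrow> G \<inter> S = {} \<longrightarrow>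
      (\<Sum>n\<in>G. (cmod (Rep_l2 (f t) n - Rep_l2 u n))\<^sup>2) \<le> e)"
    by (intro exI[of _ S] conjI)
qed

instance l2 :: complete_space
proof
  fix X :: "nat \<Rightarrow> l2" assume X: "Cauchy X"
  have "Cauchy (\<lambda>k. Rep_l2 (X k) n)" for n
    by (rule bounded_linear.Cauchy[OF bounded_linear_Rep_l2 X])
  then have "\<exists>l. (\<lambda>k. Rep_l2 (X k) n) \<longlonglongrightarrow> l" for n
    by (simp add: convergent_eq_Cauchy)
  then obtain x where x: "\<And>n. (\<lambda>k. Rep_l2 (X k) n) \<longlonglongrightarrow> x n" by metis
  \<comment> \<open>\<open>x\<close> is not yet known to lie in l2, so closeness is phrased by
    finite sums, each of which passes to the limit in \<open>k\<close>.\<close>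
  have close: "\<exists>N. \<forall>m\<ge>N. \<forall>F. finite F \<longrightarrow> (\<Sum>n\<in>F. (cmod (Rep_l2 (X m) n - x n))\<^sup>2) \<le> e\<^sup>2"
    if e: "e > 0" for e
  proof -
    obtain N where N: "\<And>m k. m \<ge> N \<Longrightarrow> k \<ge> N \<Longrightarrow> norm (X m - X k) < e"
      using X e unfolding Cauchy_def dist_norm by metis
    have "(\<Sum>n\<in>F. (cmod (Rep_l2 (X m) n - x n))\<^sup>2) \<le> e\<^sup>2" if m: "m \<ge> N" and F: "finite F" for m F
    proof (rule tendsto_upperbound)
      show "(\<lambda>k. \<Sum>n\<in>F. (cmod (Rep_l2 (X m) n - Rep_l2 (X k) n))\<^sup>2)
          \<longlonglongrightarrow> (\<Sum>n\<in>F. (cmod (Rep_l2 (X m) n - x n))\<^sup>2)"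
        by (intro tendsto_intros x)
      have "(\<Sum>n\<in>F. (cmod (Rep_l2 (X m) n - Rep_l2 (X k) n))\<^sup>2) \<le> e\<^sup>2" if "k \<ge> N" for k
      proof -
        have "(\<Sum>n\<in>F. (cmod (Rep_l2 (X m - X k) n))\<^sup>2) \<le> (norm (X m - X k))\<^sup>2"
          by (rule sum_cmod_Rep_l2_le[OF F])
        also have "\<dots> \<le> e\<^sup>2" by (rule power_mono) (use N[OF m that] in auto)
        finally show ?thesis by simp
      qed
      then show "\<forall>\<^sub>F k in sequentially. (\<Sum>n\<in>F. (cmod (Rep_l2 (X m) n - Rep_l2 (X k) n))\<^sup>2) \<le> e\<^sup>2"
        by (auto simp: eventually_sequentially)
    qed simp
    then show ?thesis by blast
  qed
  obtain N where "\<And>F. finite F \<Longrightarrow> (\<Sum>n\<in>F. (cmod (Rep_l2 (X N) n - x n))\<^sup>2) \<le> 1\<^sup>2"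
    using close[of 1] by auto
  then have "(\<lambda>n. (cmod (Rep_l2 (X N) n - x n))\<^sup>2) summable_on UNIV"
    by (intro nonneg_bounded_sums_summable_on[where B = 1]) auto
  \<comment> \<open>The summand is \<open>x n\<close>, written as an l2 sequence minus a
    square-summable one.\<close>
  then have "(\<lambda>n. (cmod (Rep_l2 (X N) n + - 1 * (Rep_l2 (X N) n - x n)))\<^sup>2) summable_on UNIV"
    by (intro square_summable_add square_summable_mult[where C = 1]) auto
  then have "Rep_l2 (Abs_l2 x) = x" by (intro Rep_l2_Abs_l2) simp
  then have "X \<longlonglongrightarrow> Abs_l2 x"
  proof (intro metric_LIMSEQ_I)
    fix e :: real assume "e > 0"
    then obtain N where N: "\<forall>m\<ge>N. \<forall>F. finite F \<longrightarrow> (\<Sum>n\<in>F. (cmod (Rep_l2 (X m) n - x n))\<^sup>2) \<le> (e/2)\<^sup>2"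
      using close[of "e/2"] by auto
    have "norm (X m - Abs_l2 x) \<le> e/2" if "m \<ge> N" for m
      by (rule norm_l2_leI) (use N that \<open>e > 0\<close> \<open>Rep_l2 (Abs_l2 x) = x\<close> in auto)
    then show "\<exists>N. \<forall>m\<ge>N. dist (X m) (Abs_l2 x) < e"
      using \<open>e > 0\<close> by (intro exI[of _ N]) (force simp: dist_norm)
  qed
  then show "convergent X" by (rule convergentI)
qed

instance l2 :: banach ..

section \<open>Orthonormal families\<close>

text \<open>Orthogonal series converge unconditionally but in general not absolutely, so a bound on
  norms cannot give their summability; this is the Cauchy criterion on finite subsets.\<close>

lemma summable_on_CauchyI:
  fixes f :: "'a \<Rightarrow> 'b :: banach"
  assumes "\<And>e. e > 0 \<Longrightarrow> \<exists>S. finite S \<and> S \<subseteq> A \<and>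
    (\<forall>G. finite G \<longrightarrow> G \<subseteq> A \<longrightarrow> G \<inter> S = {} \<longrightarrow> norm (sum f G) \<le> e)"
  shows "f summable_on A"
proof -
  have "\<exists>P. eventually P (finite_subsets_at_top A) \<and>
      (\<forall>F F'. P F \<and> P F' \<longrightarrow> dist (sum f F) (sum f F') < e)" if e: "e > 0" for e
  proof -
    from assms[of "e/3"] e obtain S where S: "finite S" "S \<subseteq> A"
      "\<And>G. finite G \<Longrightarrow> G \<subseteq> A \<Longrightarrow> G \<inter> S = {} \<Longrightarrow> norm (sum f G) \<le> e/3" by auto
    have "dist (sum f F) (sum f F') < e"
      if F: "finite F" "S \<subseteq> F" "F \<subseteq> A" "finite F'" "S \<subseteq> F'" "F' \<subseteq> A" for F F'
    proof -
      have "sum f F - sum f F' = sum f (F - F') - sum f (F' - F)"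
        using F sum.Int_Diff[of F f F'] sum.Int_Diff[of F' f F] by (simp add: Int_commute)
      moreover have "norm (sum f (F - F')) \<le> e/3" "norm (sum f (F' - F)) \<le> e/3"
        using F by (intro S(3); auto)+
      ultimately have "norm (sum f F - sum f F') \<le> e/3 + e/3"
        using norm_triangle_ineq4[of "sum f (F - F')" "sum f (F' - F)"] by auto
      then show ?thesis using e by (simp add: dist_norm)
    qed
    then show ?thesis
      using S(1,2) by (intro exI[of _ "\<lambda>F. finite F \<and> S \<subseteq> F \<and> F \<subseteq> A"])
        (auto simp: eventually_finite_subsets_at_top)
  qed
  then have "cauchy_filter (filtermap (sum f) (finite_subsets_at_top A))"
    by (simp add: cauchy_filter_metric_filtermap)
  moreover have "complete (UNIV::'b set)"
    by (meson Cauchy_convergent UNIV_I complete_def convergent_def)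
  ultimately obtain L' where "(sum f \<longlongrightarrow> L') (finite_subsets_at_top A)"
    using complete_uniform[where S=UNIV] by (force simp add: filterlim_def)
  then show ?thesis
    using summable_on_def has_sum_def by blast
qed

text \<open>The index set is arbitrary because the eigenbasis first appears as a set of vectors
  indexed by itself through \<open>id\<close> and only later by the integers.\<close>

definition orthonormal_on :: "'i set \<Rightarrow> ('i \<Rightarrow> l2) \<Rightarrow> bool" where
  "orthonormal_on I \<phi> \<longleftrightarrow> (\<forall>i\<in>I. \<forall>j\<in>I. cinner (\<phi> i) (\<phi> j) = (if i = j then 1 else 0))"

text \<open>Completeness as triviality of the orthogonal complement: this is what maximality in
  Zorn's lemma yields, and coefficients then determine a vector.\<close>

definition total_on :: "'i set \<Rightarrow> ('i \<Rightarrow> l2) \<Rightarrow> bool" where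
  "total_on I \<phi> \<longleftrightarrow> (\<forall>u. (\<forall>i\<in>I. cinner u (\<phi> i) = 0) \<longrightarrow> u = 0)"

lemma orthonormal_on_subset: "orthonormal_on I \<phi> \<Longrightarrow> J \<subseteq> I \<Longrightarrow> orthonormal_on J \<phi>"
  unfolding orthonormal_on_def by blast

lemma total_onD: "total_on I \<phi> \<Longrightarrow> (\<And>i. i \<in> I \<Longrightarrow> cinner u (\<phi> i) = 0) \<Longrightarrow> u = 0"
  unfolding total_on_def by blast

lemma cinner_finite_sum_orthonormal:
  assumes "orthonormal_on I \<phi>" "finite F" "F \<subseteq> I" "j \<in> I"
  shows "cinner (\<Sum>i\<in>F. c i *\<^sub>C \<phi> i) (\<phi> j) = (if j \<in> F then c j else 0)"
proof -
  have "cinner (\<Sum>i\<in>F. c i *\<^sub>C \<phi> i) (\<phi> j) = (\<Sum>i\<in>F. if i = j then c i else 0)"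
    unfolding cinner_sum_left cinner_scaleC_left
    by (rule sum.cong) (use assms in \<open>auto simp: orthonormal_on_def subset_iff\<close>)
  also have "\<dots> = (if j \<in> F then c j else 0)" using assms(2) by (simp add: sum.delta')
  finally show ?thesis .
qed

lemma norm_finite_sum_orthonormal:
  assumes "orthonormal_on I \<phi>" "finite F" "F \<subseteq> I"
  shows "(norm (\<Sum>i\<in>F. c i *\<^sub>C \<phi> i))\<^sup>2 = (\<Sum>i\<in>F. (cmod (c i))\<^sup>2)"
proof -
  have "complex_of_real ((norm (\<Sum>i\<in>F. c i *\<^sub>C \<phi> i))\<^sup>2)
      = (\<Sum>i\<in>F. cnj (c i) * cinner (\<Sum>i\<in>F. c i *\<^sub>C \<phi> i) (\<phi> i))"
    unfolding cinner_self[symmetric]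
    by (subst cinner_sum_right) (simp only: cinner_scaleC_right)
  also have "\<dots> = (\<Sum>i\<in>F. complex_of_real ((cmod (c i))\<^sup>2))"
  proof (rule sum.cong[OF refl])
    fix i assume "i \<in> F"
    then show "cnj (c i) * cinner (\<Sum>i\<in>F. c i *\<^sub>C \<phi> i) (\<phi> i) = complex_of_real ((cmod (c i))\<^sup>2)"
      using cinner_finite_sum_orthonormal[OF assms, of i c] assms(3)
      by (auto simp: complex_norm_square mult.commute simp del: of_real_power)
  qed
  also have "\<dots> = complex_of_real (\<Sum>i\<in>F. (cmod (c i))\<^sup>2)" by simp
  finally show ?thesis by (simp only: of_real_eq_iff)
qed

lemma bessel_inequality:
  assumes "orthonormal_on I \<phi>" "finite F" "F \<subseteq> I"
  shows "(\<Sum>i\<in>F. (cmod (cinner u (\<phi> i)))\<^sup>2) \<le> (norm u)\<^sup>2"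
proof -
  define p where "p = (\<Sum>i\<in>F. cinner u (\<phi> i) *\<^sub>C \<phi> i)"
  have "cinner (u - p) (\<phi> i) = 0" if "i \<in> F" for i
    using cinner_finite_sum_orthonormal[OF assms, of i] that assms(3)
    by (auto simp: p_def cinner_diff_left)
  then have 0: "cinner (u - p) p = 0"
    by (subst p_def) (simp add: cinner_sum_right cinner_scaleC_right)
  then have 1: "inner (u - p) p = 0" by (simp add: inner_l2_def)
  have "(norm u)\<^sup>2 = (norm ((u - p) + p))\<^sup>2" by simp
  also have "\<dots> = (norm (u - p))\<^sup>2 + (norm p)\<^sup>2"
    unfolding power2_norm_eq_inner inner_add_left inner_add_right
    using 1 by (simp add: inner_commute)
  also have "\<dots> \<ge> (norm p)\<^sup>2" by simp
  finally show ?thesis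
    unfolding p_def norm_finite_sum_orthonormal[OF assms] .
qed

lemma summable_on_coefficients:
  assumes "orthonormal_on I \<phi>"
  shows "(\<lambda>i. (cmod (cinner u (\<phi> i)))\<^sup>2) summable_on I"
  by (rule nonneg_bounded_sums_summable_on[OF _ bessel_inequality[OF assms]]) auto

lemma summable_on_synthesis:
  assumes "orthonormal_on I \<phi>" "(\<lambda>i. (cmod (c i))\<^sup>2) summable_on I"
  shows "(\<lambda>i. c i *\<^sub>C \<phi> i) summable_on I"
proof (rule summable_on_CauchyI)
  fix e :: real assume e: "e > 0"
  obtain S where S: "finite S" "S \<subseteq> I"
    "\<And>G. finite G \<Longrightarrow> G \<subseteq> I \<Longrightarrow> G \<inter> S = {} \<Longrightarrow> (\<Sum>i\<in>G. (cmod (c i))\<^sup>2) \<le> e\<^sup>2"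
    by (rule summable_on_tail_bound[OF assms(2), of "e\<^sup>2"]) (use e in auto)
  have "norm (\<Sum>i\<in>G. c i *\<^sub>C \<phi> i) \<le> e" if "finite G" "G \<subseteq> I" "G \<inter> S = {}" for G
  proof (rule power2_le_imp_le)
    show "(norm (\<Sum>i\<in>G. c i *\<^sub>C \<phi> i))\<^sup>2 \<le> e\<^sup>2"
      unfolding norm_finite_sum_orthonormal[OF assms(1) that(1,2)] by (rule S(3)[OF that])
  qed (use e in simp)
  with S(1,2) show "\<exists>S. finite S \<and> S \<subseteq> I \<and> (\<forall>G. finite G \<longrightarrow> G \<subseteq> I \<longrightarrow> G \<inter> S = {} \<longrightarrow>
      norm (\<Sum>i\<in>G. c i *\<^sub>C \<phi> i) \<le> e)" by (intro exI[of _ S] conjI allI impI)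
qed

lemma has_sum_unique_coefficient:
  assumes "orthonormal_on I \<phi>" "((\<lambda>i. c i *\<^sub>C \<phi> i) has_sum u) I" "j \<in> I"
  shows "cinner u (\<phi> j) = c j"
proof -
  have "((\<lambda>i. cinner (c i *\<^sub>C \<phi> i) (\<phi> j)) has_sum cinner u (\<phi> j)) I"
    by (rule has_sum_bounded_linear[OF bounded_linear_cinner_left assms(2)])
  moreover have "((\<lambda>i. cinner (c i *\<^sub>C \<phi> i) (\<phi> j)) has_sum c j) I"
    by (rule has_sum_finite_neutralI[of "{j}"])
       (use assms in \<open>auto simp: orthonormal_on_def cinner_scaleC_left\<close>)
  ultimately show ?thesis by (rule has_sum_unique)
qed

lemma orthonormal_expansion:
  assumes "orthonormal_on I \<phi>" "total_on I \<phi>"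
  shows "((\<lambda>i. cinner u (\<phi> i) *\<^sub>C \<phi> i) has_sum u) I"
proof -
  obtain v where v: "((\<lambda>i. cinner u (\<phi> i) *\<^sub>C \<phi> i) has_sum v) I"
    using summable_on_synthesis[OF assms(1) summable_on_coefficients[OF assms(1)]]
    by (auto simp: summable_on_def)
  have "u - v = 0"
    by (rule total_onD[OF assms(2)])
       (use has_sum_unique_coefficient[OF assms(1) v] in \<open>simp add: cinner_diff_left\<close>)
  with v show ?thesis by simp
qed

lemma parseval_identity:
  assumes "orthonormal_on I \<phi>" "total_on I \<phi>"
  shows "((\<lambda>i. (cmod (cinner u (\<phi> i)))\<^sup>2) has_sum (norm u)\<^sup>2) I"
proof -
  have "((\<lambda>i. cinner (cinner u (\<phi> i) *\<^sub>C \<phi> i) u) has_sum cinner u u) I"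
    by (rule has_sum_bounded_linear[OF bounded_linear_cinner_left orthonormal_expansion[OF assms]])
  moreover have "cinner (cinner u (\<phi> i) *\<^sub>C \<phi> i) u = complex_of_real ((cmod (cinner u (\<phi> i)))\<^sup>2)" for i
    using cinner_commute[of "\<phi> i" u]
    by (simp add: cinner_scaleC_left complex_norm_square del: of_real_power)
  ultimately show ?thesis
    unfolding cinner_self by (simp only: has_sum_of_real_iff)
qed

lemma eq_if_coefficients_eq:
  assumes "total_on I \<phi>" "\<And>i. i \<in> I \<Longrightarrow> cinner u (\<phi> i) = cinner v (\<phi> i)"
  shows "u = v"
proof -
  have "u - v = 0"
    by (rule total_onD[OF assms(1)]) (use assms(2) in \<open>simp add: cinner_diff_left\<close>)
  then show ?thesis by simp
qed

section \<open>Dimension counting for orthonormal families\<close>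

lemma nontrivial_solution:
  fixes A :: "'a \<Rightarrow> 'b \<Rightarrow> complex"
  assumes "finite N" "finite J" "card N < card J"
  shows "\<exists>x. (\<exists>j\<in>J. x j \<noteq> 0) \<and> (\<forall>n\<in>N. (\<Sum>j\<in>J. x j * A j n) = 0)"
  using assms
proof (induction N arbitrary: J A rule: finite_induct)
  case empty
  then have "J \<noteq> {}" by auto
  then show ?case by (intro exI[of _ "\<lambda>_. 1"]) auto
next
  case (insert n N)
  show ?case
  proof (cases "\<forall>j\<in>J. A j n = 0")
    case True
    obtain x where "\<exists>j\<in>J. x j \<noteq> 0" "\<forall>n\<in>N. (\<Sum>j\<in>J. x j * A j n) = 0"
      using insert.IH[of J A] insert.prems insert.hyps by auto
    with True show ?thesis by (intro exI[of _ x]) auto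
  next
    case False
    then obtain k where k: "k \<in> J" "A k n \<noteq> 0" by auto
    \<comment> \<open>Gaussian elimination with pivot \<open>A k n\<close>: \<open>B\<close> is the
      system left after equation \<open>n\<close> has removed the unknown \<open>k\<close>, and
      \<open>y k\<close> is recovered from that equation.\<close>
    define J' where "J' = J - {k}"
    define B where "B j m = A j m - A j n / A k n * A k m" for j m
    have "card N < card J'" using insert.prems insert.hyps k by (simp add: J'_def)
    then obtain x where x: "\<exists>j\<in>J'. x j \<noteq> 0" "\<And>m. m \<in> N \<Longrightarrow> (\<Sum>j\<in>J'. x j * B j m) = 0"
      using insert.IH[of J' B] insert.prems by (auto simp: J'_def)
    define y where "y j = (if j = k then - (\<Sum>j\<in>J'. x j * A j n) / A k n else x j)" for j
    have J: "J = insert k J'" "k \<notin> J'" "finite J'" using k insert.prems by (auto simp: J'_def)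
    have sumy: "(\<Sum>j\<in>J. y j * A j m) = (\<Sum>j\<in>J'. x j * B j m)" for m
    proof -
      have "(\<Sum>j\<in>J. y j * A j m) = y k * A k m + (\<Sum>j\<in>J'. x j * A j m)"
        using J by (subst J(1), subst sum.insert) (auto simp: y_def intro!: sum.cong)
      also have "y k * A k m = - (\<Sum>j\<in>J'. x j * (A j n / A k n * A k m))"
        by (simp add: y_def sum_divide_distrib sum_distrib_right mult.assoc)
      also have "- (\<Sum>j\<in>J'. x j * (A j n / A k n * A k m)) + (\<Sum>j\<in>J'. x j * A j m)
          = (\<Sum>j\<in>J'. x j * B j m)"
        by (simp add: B_def right_diff_distrib sum_subtractf)
      finally show ?thesis .
    qed
    have "(\<Sum>j\<in>J. y j * A j m) = 0" if "m \<in> insert n N" for m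
      unfolding sumy using that x(2) k(2) by (auto simp: B_def)
    moreover have "\<exists>j\<in>J. y j \<noteq> 0" using x(1) J by (auto simp: y_def)
    ultimately show ?thesis by blast
  qed
qed

text \<open>Dimension counting: if the family were larger than the number of small weights, some
  combination of it would be orthogonal to all \<open>e i\<close> with a small weight.\<close>

lemma orthonormal_card_le:
  assumes \<psi>: "orthonormal_on J \<psi>" "finite J"
    and e: "orthonormal_on I e" "total_on I e"
    and fin: "finite {i \<in> I. w i \<le> C}" and w: "\<And>i. 0 \<le> w i" and C: "0 \<le> C"
    and bound: "\<And>x. (\<Sum>\<^sub>\<infinity>i\<in>I. (w i * cmod (cinner (\<Sum>j\<in>J. x j *\<^sub>C \<psi> j) (e i)))\<^sup>2)
        \<le> (C * norm (\<Sum>j\<in>J. x j *\<^sub>C \<psi> j))\<^sup>2"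
    and summ: "\<And>x. (\<lambda>i. (w i * cmod (cinner (\<Sum>j\<in>J. x j *\<^sub>C \<psi> j) (e i)))\<^sup>2) summable_on I"
  shows "card J \<le> card {i \<in> I. w i \<le> C}"
proof (rule ccontr)
  let ?N = "{i \<in> I. w i \<le> C}"
  assume "\<not> card J \<le> card ?N"
  then obtain x where x: "\<exists>j\<in>J. x j \<noteq> 0" "\<And>i. i \<in> ?N \<Longrightarrow> (\<Sum>j\<in>J. x j * cinner (\<psi> j) (e i)) = 0"
    using nontrivial_solution[OF fin \<psi>(2), of "\<lambda>j i. cinner (\<psi> j) (e i)"] by auto
  define u where "u = (\<Sum>j\<in>J. x j *\<^sub>C \<psi> j)"
  define c where "c i = cmod (cinner u (e i))" for i
  have c0: "c i = 0" if "i \<in> ?N" for i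
    using x(2)[OF that] by (simp add: c_def u_def cinner_sum_left cinner_scaleC_left)
  have 1: "((\<lambda>i. C\<^sup>2 * (c i)\<^sup>2) has_sum C\<^sup>2 * (norm u)\<^sup>2) I"
    unfolding c_def by (intro has_sum_cmult_right parseval_identity e)
  have 2: "((\<lambda>i. (w i * c i)\<^sup>2) has_sum (\<Sum>\<^sub>\<infinity>i\<in>I. (w i * c i)\<^sup>2)) I"
    using summ[of x] by (simp add: c_def u_def)
  have 3: "((\<lambda>i. (w i * c i)\<^sup>2 + - (C\<^sup>2 * (c i)\<^sup>2)) has_sum
      ((\<Sum>\<^sub>\<infinity>i\<in>I. (w i * c i)\<^sup>2) + - (C\<^sup>2 * (norm u)\<^sup>2))) I"
    by (intro has_sum_add 2 has_sum_uminusI 1)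
  have 4: "(\<Sum>\<^sub>\<infinity>i\<in>I. (w i * c i)\<^sup>2) + - (C\<^sup>2 * (norm u)\<^sup>2) \<le> 0"
    using bound[of x] by (simp add: c_def u_def power_mult_distrib)
  have 5: "0 \<le> (w i * c i)\<^sup>2 + - (C\<^sup>2 * (c i)\<^sup>2)" if "i \<in> I" for i
  proof (cases "i \<in> ?N")
    case False
    with that have "C\<^sup>2 \<le> (w i)\<^sup>2" using C by (intro power_mono) auto
    from mult_right_mono[OF this, of "(c i)\<^sup>2"] show ?thesis by (simp add: power_mult_distrib)
  qed (simp add: c0)
  \<comment> \<open>The terms in \<open>3\<close> are nonnegative with sum at most 0, so each
    vanishes; where \<open>w i\<close> exceeds \<open>C\<close> strictly, this forces
    \<open>c i = 0\<close>.\<close>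
  have "c i = 0" if "i \<in> I" for i
  proof (cases "i \<in> ?N")
    case False
    have "(w i * c i)\<^sup>2 + - (C\<^sup>2 * (c i)\<^sup>2) = 0"
      by (rule nonneg_has_sum_le_0D[OF 3 4 5]) (use that in auto)
    then have "((w i)\<^sup>2 - C\<^sup>2) * (c i)\<^sup>2 = 0" by (simp add: power_mult_distrib left_diff_distrib)
    moreover have "C\<^sup>2 < (w i)\<^sup>2" using False that C by (intro power_strict_mono) auto
    ultimately show ?thesis by simp
  qed (rule c0)
  then have "u = 0" using e(2) by (simp add: total_on_def c_def)
  then have "(\<Sum>j\<in>J. (cmod (x j))\<^sup>2) = 0"
    using norm_finite_sum_orthonormal[OF \<psi>(1,2) order_refl, of x] by (simp add: u_def)
  then show False using x(1) \<psi>(2) by (simp add: sum_nonneg_eq_0_iff)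
qed

section \<open>Bounded perturbations of a diagonal operator\<close>

definition dmul :: "(int \<Rightarrow> complex) \<Rightarrow> l2 \<Rightarrow> l2" where
  "dmul f u = Abs_l2 (\<lambda>n. f n * Rep_l2 u n)"

lemma Rep_l2_dmul:
  assumes "\<And>n. cmod (f n) \<le> C"
  shows "Rep_l2 (dmul f u) n = f n * Rep_l2 u n"
  unfolding dmul_def
  by (subst Rep_l2_Abs_l2[OF square_summable_mult[OF l2_summable assms]]) simp

lemma norm_dmul_le:
  assumes "\<And>n. cmod (f n) \<le> C"
  shows "norm (dmul f u) \<le> C * norm u"
proof (rule norm_l2_leI)
  have "0 \<le> C" using norm_ge_zero assms by (rule order_trans)
  then show "0 \<le> C * norm u" by simp
  fix F :: "int set" assume F: "finite F"
  have "(\<Sum>n\<in>F. (cmod (Rep_l2 (dmul f u) n))\<^sup>2) = (\<Sum>n\<in>F. (cmod (f n))\<^sup>2 * (cmod (Rep_l2 u n))\<^sup>2)"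
    by (simp add: Rep_l2_dmul[OF assms] norm_mult power_mult_distrib)
  also have "\<dots> \<le> (\<Sum>n\<in>F. C\<^sup>2 * (cmod (Rep_l2 u n))\<^sup>2)"
    by (intro sum_mono mult_right_mono power_mono assms) auto
  also have "\<dots> = C\<^sup>2 * (\<Sum>n\<in>F. (cmod (Rep_l2 u n))\<^sup>2)" by (simp add: sum_distrib_left)
  also have "\<dots> \<le> C\<^sup>2 * (norm u)\<^sup>2"
    by (intro mult_left_mono sum_cmod_Rep_l2_le F) auto
  finally show "(\<Sum>n\<in>F. (cmod (Rep_l2 (dmul f u) n))\<^sup>2) \<le> (C * norm u)\<^sup>2"
    by (simp add: power_mult_distrib)
qed

text \<open>\<open>K\<close> will be convolution by \<open>a\<close> plus multiplication by
  \<open>b\<close>. It is bounded, so the domain is that of the diagonal part alone.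
  \<open>d_finite\<close> is the source of compactness; \<open>d_pos\<close> and
  \<open>d_neg\<close> yield infinitely many eigenvalues of either sign, as an enumeration by the
  integers requires.\<close>

locale perturbed_diagonal =
  fixes H :: l2_operator and d :: "int \<Rightarrow> real" and K :: "l2 \<Rightarrow> l2" and M :: real
  assumes dom_eq: "op_dom H = {u. (\<lambda>n. (d n * cmod (Rep_l2 u n))\<^sup>2) summable_on UNIV}"
    and app: "\<And>u n. u \<in> op_dom H \<Longrightarrow>
      Rep_l2 (op_app H u) n = Rep_l2 (K u) n + complex_of_real (d n) * Rep_l2 u n"
    and K_add: "\<And>u v. K (u + v) = K u + K v"
    and K_scaleC: "\<And>c u. K (c *\<^sub>C u) = c *\<^sub>C K u"
    and K_bound: "\<And>u. norm (K u) \<le> M * norm u"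
    and K_sym: "\<And>u v. cinner (K u) v = cinner u (K v)"
    and M_pos: "M > 0"
    and d_finite: "\<And>x. finite {n. \<bar>d n\<bar> \<le> x}"
    and d_pos: "infinite {n. 0 \<le> d n}"
    and d_neg: "infinite {n. d n < 0}"
begin

abbreviation "\<D> \<equiv> op_dom H"
abbreviation "\<H> \<equiv> op_app H"

section \<open>Domain, symmetry and resolvents at imaginary points\<close>

lemma K_diff: "K (u - v) = K u - K v"
  using K_add[of "u - v" v] by simp

lemma bounded_linear_K: "bounded_linear K"
  by (rule bounded_linear_intro[of _ M])
     (simp_all add: K_add K_scaleC scaleR_l2_def K_bound mult.commute)

text \<open>The domain is maximal: if the formal image is some \<open>w\<close> in l2, then the
  diagonal part of \<open>u\<close> is \<open>w - K u\<close>, hence square-summable. Closure of the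
  domain under linear operations and the regularity of limits and solutions rest on this.\<close>

lemma domI:
  assumes "\<And>n. Rep_l2 w n = Rep_l2 (K u) n + complex_of_real (d n) * Rep_l2 u n"
  shows "u \<in> \<D>" "\<H> u = w"
proof -
  have "(d n * cmod (Rep_l2 u n))\<^sup>2 = (cmod (Rep_l2 (w - K u) n))\<^sup>2" for n
    by (simp add: assms norm_mult power_mult_distrib)
  then show *: "u \<in> \<D>" unfolding dom_eq by (simp only: mem_Collect_eq l2_summable)
  show "\<H> u = w" by (rule l2_eqI) (simp add: app[OF *] assms)
qed

lemma dom_add: "u \<in> \<D> \<Longrightarrow> v \<in> \<D> \<Longrightarrow> u + v \<in> \<D>"
  and app_add: "u \<in> \<D> \<Longrightarrow> v \<in> \<D> \<Longrightarrow> \<H> (u + v) = \<H> u + \<H> v"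
  by (rule domI[of "\<H> u + \<H> v"], simp add: app K_add algebra_simps)+

lemma dom_scaleC: "u \<in> \<D> \<Longrightarrow> c *\<^sub>C u \<in> \<D>"
  and app_scaleC: "u \<in> \<D> \<Longrightarrow> \<H> (c *\<^sub>C u) = c *\<^sub>C \<H> u"
  by (rule domI[of "c *\<^sub>C \<H> u"], simp add: app K_scaleC algebra_simps)+

lemma dom_diff: "u \<in> \<D> \<Longrightarrow> v \<in> \<D> \<Longrightarrow> u - v \<in> \<D>"
  and app_diff: "u \<in> \<D> \<Longrightarrow> v \<in> \<D> \<Longrightarrow> \<H> (u - v) = \<H> u - \<H> v"
  by (rule domI[of "\<H> u - \<H> v"], simp add: app K_diff algebra_simps)+

lemma dom_zero: "0 \<in> \<D>" and app_zero: "\<H> 0 = 0"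
  using K_diff[of 0 0] by (auto intro: domI[of 0])

lemma dom_scaleR: "u \<in> \<D> \<Longrightarrow> c *\<^sub>R u \<in> \<D>"
  and app_scaleR: "u \<in> \<D> \<Longrightarrow> \<H> (c *\<^sub>R u) = c *\<^sub>R \<H> u"
  by (simp_all add: scaleR_l2_def dom_scaleC app_scaleC)

lemma dom_sum: "(\<And>i. i \<in> F \<Longrightarrow> f i \<in> \<D>) \<Longrightarrow> sum f F \<in> \<D>"
  and app_sum: "(\<And>i. i \<in> F \<Longrightarrow> f i \<in> \<D>) \<Longrightarrow> \<H> (sum f F) = (\<Sum>i\<in>F. \<H> (f i))"
proof -
  have "sum f F \<in> \<D> \<and> \<H> (sum f F) = (\<Sum>i\<in>F. \<H> (f i))" if "\<And>i. i \<in> F \<Longrightarrow> f i \<in> \<D>" for F f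
    using that
    by (induction F rule: infinite_finite_induct)
       (simp_all add: dom_zero app_zero dom_add app_add)
  then show "(\<And>i. i \<in> F \<Longrightarrow> f i \<in> \<D>) \<Longrightarrow> sum f F \<in> \<D>"
    "(\<And>i. i \<in> F \<Longrightarrow> f i \<in> \<D>) \<Longrightarrow> \<H> (sum f F) = (\<Sum>i\<in>F. \<H> (f i))" by auto
qed

lemma app_sym:
  assumes "u \<in> \<D>" "v \<in> \<D>"
  shows "cinner (\<H> u) v = cinner u (\<H> v)"
proof -
  have "cinner (\<H> u - K u) v = cinner u (\<H> v - K v)"
    unfolding cinner_def by (simp add: app assms mult.assoc mult.left_commute)
  then show ?thesis by (simp add: cinner_diff_left cinner_diff_right K_sym)
qed

text \<open>The diagonal resolvent at the imaginary point has norm at most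
  \<open>1 / \<bar>t\<bar>\<close>, so solving for \<open>u\<close> in the diagonal part gives a
  fixed point equation for a contraction with factor \<open>M / \<bar>t\<bar>\<close>.\<close>

lemma resolvent_exists:
  assumes "M < \<bar>t\<bar>"
  obtains u where "u \<in> \<D>" "\<H> u - (\<i> * complex_of_real t) *\<^sub>C u = w"
proof -
  have t: "\<bar>t\<bar> > 0" using assms M_pos by simp
  define f where "f n = 1 / (complex_of_real (d n) - \<i> * complex_of_real t)" for n
  have nz: "complex_of_real (d n) - \<i> * complex_of_real t \<noteq> 0" for n
    using t by (auto simp: complex_eq_iff)
  have f: "cmod (f n) \<le> 1 / \<bar>t\<bar>" for n
    using abs_Im_le_cmod[of "complex_of_real (d n) - \<i> * complex_of_real t"] t
    by (simp add: f_def norm_divide frac_le)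
  define \<Phi> where "\<Phi> u = dmul f (w - K u)" for u
  have "\<exists>!u. \<Phi> u = u"
  proof (rule banach_fix_type)
    show "0 \<le> M / \<bar>t\<bar>" "M / \<bar>t\<bar> < 1" using t assms M_pos by auto
    have "dist (\<Phi> u) (\<Phi> v) \<le> M / \<bar>t\<bar> * dist u v" for u v
    proof -
      have "\<Phi> u - \<Phi> v = dmul f (K (v - u))"
        by (rule l2_eqI) (simp add: \<Phi>_def Rep_l2_dmul[of f, OF f] K_diff algebra_simps)
      then have "norm (\<Phi> u - \<Phi> v) \<le> 1 / \<bar>t\<bar> * norm (K (v - u))"
        by (simp only: norm_dmul_le[of f, OF f])
      also have "\<dots> \<le> 1 / \<bar>t\<bar> * (M * norm (v - u))"
        by (intro mult_left_mono K_bound) auto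
      finally show ?thesis by (simp add: dist_norm norm_minus_commute)
    qed
    then show "\<forall>u v. dist (\<Phi> u) (\<Phi> v) \<le> M / \<bar>t\<bar> * dist u v" by blast
  qed
  then obtain u where u: "\<Phi> u = u" by blast
  have "Rep_l2 (w + (\<i> * complex_of_real t) *\<^sub>C u) n
      = Rep_l2 (K u) n + complex_of_real (d n) * Rep_l2 u n" for n
  proof -
    have "Rep_l2 u n = f n * Rep_l2 (w - K u) n"
      using arg_cong[OF u, of "\<lambda>v. Rep_l2 v n"] by (simp add: \<Phi>_def Rep_l2_dmul[of f, OF f])
    then have "(complex_of_real (d n) - \<i> * complex_of_real t) * Rep_l2 u n = Rep_l2 (w - K u) n"
      using nz[of n] by (simp add: f_def)
    then show ?thesis by (simp add: algebra_simps)
  qed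
  from domI[OF this] have "u \<in> \<D>" "\<H> u - (\<i> * complex_of_real t) *\<^sub>C u = w" by simp_all
  then show thesis by (rule that)
qed

section \<open>Compactness and lower semicontinuity in the graph norm\<close>

lemma diagonal_part_bound:
  assumes "u \<in> \<D>" "finite F"
  shows "(\<Sum>n\<in>F. (d n * cmod (Rep_l2 u n))\<^sup>2) \<le> (norm (\<H> u) + M * norm u)\<^sup>2"
proof -
  have "(\<Sum>n\<in>F. (d n * cmod (Rep_l2 u n))\<^sup>2) = (\<Sum>n\<in>F. (cmod (Rep_l2 (\<H> u - K u) n))\<^sup>2)"
    by (simp add: app[OF assms(1)] norm_mult power_mult_distrib)
  also have "\<dots> \<le> (norm (\<H> u - K u))\<^sup>2" by (rule sum_cmod_Rep_l2_le[OF assms(2)])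
  also have "\<dots> \<le> (norm (\<H> u) + M * norm u)\<^sup>2"
    using norm_triangle_ineq4[of "\<H> u" "K u"] K_bound[of u] by (intro power_mono) auto
  finally show ?thesis .
qed

text \<open>Tychonoff gives a coordinatewise limit along a subsequence. The graph norm bounds the
  \<open>d\<close>-weighted sums, so the mass where \<open>\<bar>d n\<bar>\<close> exceeds
  \<open>R\<close> is of order \<open>1 / R\<^sup>2\<close> uniformly in \<open>k\<close>, and only
  finitely many coordinates remain.\<close>

lemma bounded_graph_norm_convergent_subsequence:
  assumes X: "\<And>k. X k \<in> \<D>" "\<And>k. norm (X k) \<le> B" "\<And>k. norm (\<H> (X k)) \<le> B"
  obtains u r where "strict_mono (r :: nat \<Rightarrow> nat)" "(\<lambda>k. X (r k)) \<longlonglongrightarrow> u"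
proof -
  have B: "0 \<le> B" using X(2)[of 0] norm_ge_zero order_trans by blast
  define C where "C = B + M * B"
  have C: "0 \<le> C" using B M_pos by (simp add: C_def)
  have "compact (PiE UNIV (\<lambda>_::int. cball (0::complex) B))"
    using compactin_PiE[of "\<lambda>_. euclidean" UNIV "\<lambda>_::int. cball (0::complex) B"]
    by (simp add: euclidean_product_topology)
  moreover have "Rep_l2 (X k) \<in> PiE UNIV (\<lambda>_. cball 0 B)" for k
    using cmod_Rep_l2_le X(2) order_trans by (auto simp: PiE_UNIV_domain) blast
  ultimately obtain l r where r: "strict_mono r" "((\<lambda>k. Rep_l2 (X k)) \<circ> r) \<longlonglongrightarrow> l"
    by (meson compact_imp_seq_compact seq_compactE)
  have lim: "(\<lambda>k. Rep_l2 (X (r k)) n) \<longlonglongrightarrow> l n" for n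
  proof -
    have "continuous_on UNIV (\<lambda>x::int \<Rightarrow> complex. x n)" by simp
    then have "isCont (\<lambda>x::int \<Rightarrow> complex. x n) l" using continuous_on_eq_continuous_at[OF open_UNIV] by blast
    from isCont_tendsto_compose[OF this r(2)] show ?thesis by (simp add: o_def)
  qed
  have "(\<Sum>n\<in>F. (cmod (l n))\<^sup>2) \<le> B\<^sup>2" if F: "finite F" for F
  proof (rule tendsto_upperbound)
    show "(\<lambda>k. \<Sum>n\<in>F. (cmod (Rep_l2 (X (r k)) n))\<^sup>2) \<longlonglongrightarrow> (\<Sum>n\<in>F. (cmod (l n))\<^sup>2)"
      by (intro tendsto_intros lim)
    have "(\<Sum>n\<in>F. (cmod (Rep_l2 (X (r k)) n))\<^sup>2) \<le> B\<^sup>2" for k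
      using sum_cmod_Rep_l2_le[OF F, of "X (r k)"] power_mono[OF X(2)[of "r k"], of 2] by simp
    then show "\<forall>\<^sub>F k in sequentially. (\<Sum>n\<in>F. (cmod (Rep_l2 (X (r k)) n))\<^sup>2) \<le> B\<^sup>2" by simp
  qed simp
  then have "(\<lambda>n. (cmod (l n))\<^sup>2) summable_on UNIV"
    by (intro nonneg_bounded_sums_summable_on[where B = "B\<^sup>2"]) auto
  then have l: "Rep_l2 (Abs_l2 l) = l" by (rule Rep_l2_Abs_l2)
  have tailX: "(\<Sum>n\<in>G. (cmod (Rep_l2 (X k) n))\<^sup>2) \<le> C\<^sup>2 / R\<^sup>2"
    if "finite G" "G \<inter> {n. \<bar>d n\<bar> \<le> R} = {}" "R > 0" for G R k
  proof -
    have "R\<^sup>2 * (\<Sum>n\<in>G. (cmod (Rep_l2 (X k) n))\<^sup>2) \<le> (\<Sum>n\<in>G. (d n * cmod (Rep_l2 (X k) n))\<^sup>2)"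
      unfolding sum_distrib_left power_mult_distrib
    proof (rule sum_mono, rule mult_right_mono)
      fix n assume "n \<in> G"
      then have "R \<le> \<bar>d n\<bar>" using that(2) by fastforce
      from power_mono[OF this, of 2] show "R\<^sup>2 \<le> (d n)\<^sup>2" using that(3) by simp
    qed simp
    also have "\<dots> \<le> (norm (\<H> (X k)) + M * norm (X k))\<^sup>2"
      by (rule diagonal_part_bound[OF X(1) that(1)])
    also have "\<dots> \<le> C\<^sup>2"
      unfolding C_def using X M_pos by (intro power_mono add_mono mult_left_mono) auto
    finally show ?thesis using that(3) by (simp add: pos_le_divide_eq mult.commute)
  qed
  have "(\<lambda>k. X (r k)) \<longlonglongrightarrow> Abs_l2 l"
  proof (rule tendsto_l2I)
    show "(\<lambda>k. Rep_l2 (X (r k)) n) \<longlonglongrightarrow> Rep_l2 (Abs_l2 l) n" for n using lim by (simp add: l)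
    fix e :: real assume e: "e > 0"
    \<comment> \<open>The factor 4 covers the tails of both the sequence and its limit, each with
      the 2 from \<open>(x + y)\<^sup>2 \<le> 2 * x\<^sup>2 + 2 * y\<^sup>2\<close>; adding 1 keeps
      \<open>R\<close> positive when \<open>C = 0\<close>.\<close>
    define R where "R = sqrt (4 * C\<^sup>2 / e) + 1"
    have R: "R > 0" using e by (simp add: R_def add_nonneg_pos)
    have "4 * C\<^sup>2 / e \<le> (sqrt (4 * C\<^sup>2 / e))\<^sup>2" using e by simp
    also have "\<dots> \<le> R\<^sup>2" unfolding R_def using e by (intro power_mono) auto
    finally have R2: "4 * (C\<^sup>2 / R\<^sup>2) \<le> e" using e R by (simp add: field_simps)
    let ?S = "{n. \<bar>d n\<bar> \<le> R}"
    have "(\<Sum>n\<in>G. (cmod (Rep_l2 (X (r k)) n - Rep_l2 (Abs_l2 l) n))\<^sup>2) \<le> e"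
      if G: "finite G" "G \<inter> ?S = {}" for G k
    proof -
      have tl: "(\<Sum>n\<in>G. (cmod (l n))\<^sup>2) \<le> C\<^sup>2 / R\<^sup>2"
      proof (rule tendsto_upperbound)
        show "(\<lambda>k. \<Sum>n\<in>G. (cmod (Rep_l2 (X (r k)) n))\<^sup>2) \<longlonglongrightarrow> (\<Sum>n\<in>G. (cmod (l n))\<^sup>2)"
          by (intro tendsto_intros lim)
      qed (use tailX[OF G R] in auto)
      have "(cmod (Rep_l2 (X (r k)) n - l n))\<^sup>2 \<le> 2 * (cmod (Rep_l2 (X (r k)) n))\<^sup>2 + 2 * (cmod (l n))\<^sup>2" for n
      proof -
        have "(cmod (Rep_l2 (X (r k)) n - l n))\<^sup>2 \<le> (cmod (Rep_l2 (X (r k)) n) + cmod (l n))\<^sup>2"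
          by (intro power_mono norm_triangle_ineq4) auto
        then show ?thesis
          using sum_squares_bound[of "cmod (Rep_l2 (X (r k)) n)" "cmod (l n)"] by (simp add: power2_sum)
      qed
      then have "(\<Sum>n\<in>G. (cmod (Rep_l2 (X (r k)) n - Rep_l2 (Abs_l2 l) n))\<^sup>2)
          \<le> (\<Sum>n\<in>G. 2 * (cmod (Rep_l2 (X (r k)) n))\<^sup>2 + 2 * (cmod (l n))\<^sup>2)"
        unfolding l by (rule sum_mono)
      also have "\<dots> = 2 * (\<Sum>n\<in>G. (cmod (Rep_l2 (X (r k)) n))\<^sup>2) + 2 * (\<Sum>n\<in>G. (cmod (l n))\<^sup>2)"
        by (simp add: sum.distrib sum_distrib_left)
      also have "\<dots> \<le> e" using tl tailX[OF G R, of "r k"] R2 by linarith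
      finally show ?thesis .
    qed
    then show "\<exists>S. finite S \<and> (\<forall>\<^sub>F k in sequentially. \<forall>G. finite G \<longrightarrow> G \<inter> S = {} \<longrightarrow>
        (\<Sum>n\<in>G. (cmod (Rep_l2 (X (r k)) n - Rep_l2 (Abs_l2 l) n))\<^sup>2) \<le> e)"
      using d_finite[of R] by (intro exI[of _ ?S]) simp
  qed
  with r(1) show thesis by (rule that)
qed

text \<open>A Fatou argument: \<open>K\<close> is continuous, so \<open>\<H> (X k)\<close> converges
  in every coordinate, and finite sums inherit the bound \<open>L\<close>. This puts the limit into
  the domain although \<open>\<H> (X k)\<close> itself need not converge in norm.\<close>

lemma graph_norm_lower_semicontinuous:
  assumes X: "\<And>k. X k \<in> \<D>" "X \<longlonglongrightarrow> u" and L: "(\<lambda>k. norm (\<H> (X k))) \<longlonglongrightarrow> L"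
  shows "u \<in> \<D>" "norm (\<H> u) \<le> L"
proof -
  define w where "w n = Rep_l2 (K u) n + complex_of_real (d n) * Rep_l2 u n" for n
  have L0: "0 \<le> L" by (rule tendsto_lowerbound[OF L]) auto
  have "(\<Sum>n\<in>F. (cmod (w n))\<^sup>2) \<le> L\<^sup>2" if F: "finite F" for F
  proof (rule tendsto_le)
    have "(\<lambda>k. Rep_l2 (\<H> (X k)) n) \<longlonglongrightarrow> w n" for n
      unfolding app[OF X(1)] w_def
      by (intro tendsto_intros bounded_linear.tendsto[OF bounded_linear_Rep_l2]
          bounded_linear.tendsto[OF bounded_linear_K] X(2))
    then show "(\<lambda>k. \<Sum>n\<in>F. (cmod (Rep_l2 (\<H> (X k)) n))\<^sup>2) \<longlonglongrightarrow> (\<Sum>n\<in>F. (cmod (w n))\<^sup>2)"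
      by (intro tendsto_intros)
    show "(\<lambda>k. (norm (\<H> (X k)))\<^sup>2) \<longlonglongrightarrow> L\<^sup>2" by (intro tendsto_intros L)
  qed (auto intro!: always_eventually sum_cmod_Rep_l2_le F)
  note * = this
  then have "(\<lambda>n. (cmod (w n))\<^sup>2) summable_on UNIV"
    by (intro nonneg_bounded_sums_summable_on[where B = "L\<^sup>2"]) auto
  then have w: "Rep_l2 (Abs_l2 w) = w" by (rule Rep_l2_Abs_l2)
  show "u \<in> \<D>" by (rule domI[of "Abs_l2 w"]) (simp add: w, simp add: w_def)
  have "\<H> u = Abs_l2 w" by (rule domI) (simp add: w, simp add: w_def)
  moreover have "norm (Abs_l2 w) \<le> L" by (rule norm_l2_leI) (simp_all add: w * L0)
  ultimately show "norm (\<H> u) \<le> L" by simp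
qed

end

section \<open>Existence of an orthonormal eigenbasis\<close>

context perturbed_diagonal
begin

text \<open>A minimiser \<open>u\<close> of \<open>norm (\<H> u)\<close> on the unit sphere of the complement \<open>W\<close> of \<open>S\<close> is a weak
  eigenvector of the square of \<open>\<H>\<close>. To see that \<open>\<H> u\<close> lies in the domain, solve
  \<open>\<H> (\<H> x) + t\<^sup>2 x = u\<close> in \<open>W\<close> with two resolvents and compare \<open>u\<close> with \<open>x\<close>.\<close>

lemma eigenvector_in_complement:
  assumes S: "\<And>\<psi>. \<psi> \<in> S \<Longrightarrow> \<psi> \<in> \<D> \<and> (\<exists>\<mu>::real. \<H> \<psi> = complex_of_real \<mu> *\<^sub>C \<psi>)"
    and w: "w \<noteq> 0" "\<And>\<psi>. \<psi> \<in> S \<Longrightarrow> cinner w \<psi> = 0"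
  obtains u \<mu> where "u \<in> \<D>" "u \<noteq> 0" "\<H> u = complex_of_real \<mu> *\<^sub>C u"
    "\<And>\<psi>. \<psi> \<in> S \<Longrightarrow> cinner u \<psi> = 0"
proof -
  define W where "W = {u. \<forall>\<psi>\<in>S. cinner u \<psi> = 0}"
  have W_add: "u + v \<in> W" if "u \<in> W" "v \<in> W" for u v
    using that by (simp add: W_def cinner_add_left)
  have W_diff: "u - v \<in> W" if "u \<in> W" "v \<in> W" for u v
    using that by (simp add: W_def cinner_diff_left)
  have W_scaleC: "c *\<^sub>C u \<in> W" if "u \<in> W" for c u
    using that by (simp add: W_def cinner_scaleC_left)
  have W_scaleR: "c *\<^sub>R u \<in> W" if "u \<in> W" for c u
    using W_scaleC[OF that] by (simp add: scaleR_l2_def)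
  have W_H: "\<H> u \<in> W" if "u \<in> W" "u \<in> \<D>" for u
    unfolding W_def
  proof (intro CollectI ballI)
    fix \<psi> assume \<psi>: "\<psi> \<in> S"
    then obtain \<mu> :: real where "\<H> \<psi> = complex_of_real \<mu> *\<^sub>C \<psi>" using S by blast
    then show "cinner (\<H> u) \<psi> = 0"
      using app_sym[OF that(2), of \<psi>] S[OF \<psi>] that(1) \<psi> by (simp add: cinner_scaleC_right W_def)
  qed
  \<comment> \<open>Pairing the equation with an eigenvector in \<open>S\<close> multiplies
    \<open>cinner x \<psi>\<close> by the nonzero number \<open>\<mu> - \<i> t\<close>; hence
    resolvents leave \<open>W\<close> invariant.\<close>
  have res: "\<exists>x. x \<in> \<D> \<and> x \<in> W \<and> \<H> x - (\<i> * complex_of_real t) *\<^sub>C x = y"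
    if ty: "M < \<bar>t\<bar>" "y \<in> W" for t y
  proof -
    obtain x where x: "x \<in> \<D>" "\<H> x - (\<i> * complex_of_real t) *\<^sub>C x = y"
      by (rule resolvent_exists[OF ty(1)])
    have "cinner x \<psi> = 0" if \<psi>: "\<psi> \<in> S" for \<psi>
    proof -
      obtain \<mu> :: real where \<mu>: "\<H> \<psi> = complex_of_real \<mu> *\<^sub>C \<psi>" using S \<psi> by blast
      have "0 = cinner (\<H> x - (\<i> * complex_of_real t) *\<^sub>C x) \<psi>"
        using \<open>y \<in> W\<close> \<psi> x by (simp add: W_def)
      also have "\<dots> = (complex_of_real \<mu> - \<i> * complex_of_real t) * cinner x \<psi>"
        using app_sym[OF x(1), of \<psi>] S[OF \<psi>]
        by (simp add: cinner_diff_left cinner_scaleC_left \<mu> cinner_scaleC_right algebra_simps)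
      finally have "(complex_of_real \<mu> - \<i> * complex_of_real t) * cinner x \<psi> = 0" by simp
      moreover have "complex_of_real \<mu> - \<i> * complex_of_real t \<noteq> 0"
        using \<open>M < \<bar>t\<bar>\<close> M_pos by (auto simp: complex_eq_iff)
      ultimately show ?thesis by (metis mult_eq_0_iff)
    qed
    with x show ?thesis by (auto simp: W_def)
  qed
  define t where "t = M + 1"
  have t: "M < \<bar>t\<bar>" "M < \<bar>- t\<bar>" "t > 0" using M_pos by (auto simp: t_def)
  have wW: "w \<in> W" using w by (simp add: W_def)
  define A where "A = {norm (\<H> u) | u. u \<in> \<D> \<and> u \<in> W \<and> norm u = 1}"
  define L where "L = Inf A"
  have bdd: "bdd_below A" unfolding A_def by (rule bdd_belowI[of _ 0]) auto
  \<comment> \<open>The resolvent maps \<open>w\<close> to a nonzero vector of the domain inside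
    \<open>W\<close>, which may be normalised.\<close>
  have "A \<noteq> {}"
  proof -
    obtain x where x: "x \<in> \<D>" "x \<in> W" "\<H> x - (\<i> * complex_of_real t) *\<^sub>C x = w"
      using res[OF t(1) wW] by blast
    then have "x \<noteq> 0" using w(1) app_zero by auto
    then show ?thesis
      using x dom_scaleR[of x "1 / norm x"] W_scaleR[of x "1 / norm x"] by (auto simp: A_def)
  qed
  have L0: "0 \<le> L" unfolding L_def by (rule cInf_greatest[OF \<open>A \<noteq> {}\<close>]) (auto simp: A_def)
  have L_le: "L \<le> norm (\<H> u)" if "u \<in> \<D>" "u \<in> W" "norm u = 1" for u
    unfolding L_def by (rule cInf_lower[OF _ bdd]) (use that in \<open>auto simp: A_def\<close>)
  have "\<exists>u. u \<in> \<D> \<and> u \<in> W \<and> norm u = 1 \<and> norm (\<H> u) < L + 1 / (real k + 1)" for k :: nat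
  proof -
    have "Inf A < L + 1 / (real k + 1)" by (simp add: L_def)
    then obtain a where "a \<in> A" "a < L + 1 / (real k + 1)"
      by (metis cInf_lessD \<open>A \<noteq> {}\<close>)
    then show ?thesis by (auto simp: A_def)
  qed
  then obtain X where X: "\<And>k. X k \<in> \<D>" "\<And>k. X k \<in> W" "\<And>k. norm (X k) = 1"
    "\<And>k. norm (\<H> (X k)) < L + 1 / (real k + 1)"
    by metis
  have lim: "(\<lambda>k. norm (\<H> (X k))) \<longlonglongrightarrow> L"
  proof (rule tendsto_sandwich)
    show "\<forall>\<^sub>F k in sequentially. L \<le> norm (\<H> (X k))" using L_le X by auto
    show "\<forall>\<^sub>F k in sequentially. norm (\<H> (X k)) \<le> L + 1 / (real k + 1)"
      by (intro always_eventually allI less_imp_le X(4))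
    have "(\<lambda>k. 1 / (real k + 1)) \<longlonglongrightarrow> 0"
      using LIMSEQ_inverse_real_of_nat by (simp add: inverse_eq_divide add.commute)
    from tendsto_add[OF tendsto_const[of L] this] show "(\<lambda>k. L + 1 / (real k + 1)) \<longlonglongrightarrow> L" by simp
  qed simp
  have "norm (X k) \<le> L + 1" "norm (\<H> (X k)) \<le> L + 1" for k
  proof -
    have "1 / (real k + 1) \<le> 1" by simp
    then show "norm (\<H> (X k)) \<le> L + 1" using X(4)[of k] by linarith
  qed (use X(3) L0 in simp)
  then obtain u and r :: "nat \<Rightarrow> nat" where r: "strict_mono r" "(\<lambda>k. X (r k)) \<longlonglongrightarrow> u"
    using bounded_graph_norm_convergent_subsequence[of X "L + 1"] X(1) by blast
  have limr: "(\<lambda>k. norm (\<H> (X (r k)))) \<longlonglongrightarrow> L"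
    using LIMSEQ_subseq_LIMSEQ[OF lim r(1)] by (simp add: o_def)
  have u: "u \<in> \<D>" "norm (\<H> u) \<le> L"
    using graph_norm_lower_semicontinuous[of "\<lambda>k. X (r k)" u L] X(1) r(2) limr by auto
  have nu: "norm u = 1"
    using tendsto_norm[OF r(2)] X(3) LIMSEQ_unique[OF _ tendsto_const[of 1]] by simp
  have uW: "u \<in> W"
    unfolding W_def
  proof (intro CollectI ballI)
    fix \<psi> assume "\<psi> \<in> S"
    then have "cinner (X (r k)) \<psi> = 0" for k using X(2) by (auto simp: W_def)
    then show "cinner u \<psi> = 0"
      using bounded_linear.tendsto[OF bounded_linear_cinner_left r(2), of \<psi>]
        LIMSEQ_unique[OF _ tendsto_const[of 0]] by simp
  qed
  have nHu: "norm (\<H> u) = L" using u(2) L_le[OF u(1) uW nu] by simp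
  have min: "L\<^sup>2 * (norm v)\<^sup>2 \<le> (norm (\<H> v))\<^sup>2" if v: "v \<in> \<D>" "v \<in> W" for v
  proof (cases "v = 0")
    case False
    then have "L \<le> norm (\<H> ((1 / norm v) *\<^sub>R v))"
      by (intro L_le dom_scaleR W_scaleR v) simp
    then have "L * norm v \<le> norm (\<H> v)"
      using False by (simp add: app_scaleR[OF v(1)] pos_le_divide_eq)
    from power_mono[OF this, of 2] show ?thesis using L0 by (simp add: power_mult_distrib)
  qed simp
  have expand: "(norm (x + s *\<^sub>R y))\<^sup>2 = (norm x)\<^sup>2 + 2 * s * inner x y + s\<^sup>2 * (norm y)\<^sup>2"
    for x y :: l2 and s
    unfolding power2_norm_eq_inner inner_add_left inner_add_right inner_scaleR_left inner_scaleR_right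
    by (simp add: inner_commute[of y x] power2_eq_square algebra_simps)
  have variation: "inner (\<H> u) (\<H> v) = L\<^sup>2 * inner u v" if v: "v \<in> \<D>" "v \<in> W" for v
  proof (rule ccontr)
    define B where "B = inner (\<H> u) (\<H> v) - L\<^sup>2 * inner u v"
    define g where "g = (norm (\<H> v))\<^sup>2 - L\<^sup>2 * (norm v)\<^sup>2"
    assume "inner (\<H> u) (\<H> v) \<noteq> L\<^sup>2 * inner u v"
    then have B: "B \<noteq> 0" by (simp add: B_def)
    have g: "0 \<le> g" using min[OF v] by (simp add: g_def)
    have q: "0 \<le> 2 * s * B + s\<^sup>2 * g" for s
    proof -
      have "L\<^sup>2 * (norm (u + s *\<^sub>R v))\<^sup>2 \<le> (norm (\<H> (u + s *\<^sub>R v)))\<^sup>2"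
        by (intro min dom_add dom_scaleR W_add W_scaleR u v uW)
      also have "\<H> (u + s *\<^sub>R v) = \<H> u + s *\<^sub>R \<H> v"
        by (simp add: app_add app_scaleR dom_scaleR u v)
      finally have "L\<^sup>2 * ((norm u)\<^sup>2 + 2 * s * inner u v + s\<^sup>2 * (norm v)\<^sup>2)
          \<le> (norm (\<H> u))\<^sup>2 + 2 * s * inner (\<H> u) (\<H> v) + s\<^sup>2 * (norm (\<H> v))\<^sup>2"
        unfolding expand .
      then show ?thesis by (simp add: nu nHu B_def g_def algebra_simps)
    qed
    \<comment> \<open>The quadratic in \<open>s\<close> would be minimised at
      \<open>- B / g\<close>; \<open>G = g + 1\<close> gives a test value that also serves when
      \<open>g = 0\<close>.\<close>
    define G where "G = g + 1"
    have G: "G > 0" "g = G - 1" using g by (simp_all add: G_def)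
    have "0 \<le> 2 * (- B / G) * B + (- B / G)\<^sup>2 * (G - 1)" using q[of "- B / G"] G(2) by simp
    also have "\<dots> = - (B\<^sup>2 * (G + 1)) / G\<^sup>2"
      using G(1) by (simp add: field_simps power2_eq_square)
    also have "\<dots> < 0" using B G(1) by (simp add: divide_neg_pos)
    finally show False by simp
  qed
  \<comment> \<open>With \<open>(\<H> + \<i> t) x1 = u\<close> and
    \<open>(\<H> - \<i> t) x = x1\<close>, the vector \<open>x\<close> solves the equation with the
    square of \<open>\<H>\<close> and lies in the domain of that square by construction.\<close>
  obtain x1 where x1: "x1 \<in> \<D>" "x1 \<in> W" "\<H> x1 - (\<i> * complex_of_real (- t)) *\<^sub>C x1 = u"
    using res[OF t(2) uW] by blast
  obtain x where x: "x \<in> \<D>" "x \<in> W" "\<H> x - (\<i> * complex_of_real t) *\<^sub>C x = x1"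
    using res[OF t(1) x1(2)] by blast
  have weak: "inner (\<H> x) (\<H> v) + t\<^sup>2 * inner x v = inner u v" if v: "v \<in> \<D>" "v \<in> W" for v
  proof -
    have 1: "cinner (\<H> x) v = cinner x (\<H> v)" by (rule app_sym[OF x(1) v(1)])
    have 2: "cinner (\<H> x1) v = cinner x1 (\<H> v)" by (rule app_sym[OF x1(1) v(1)])
    have "cinner u v = cinner x1 (\<H> v) + \<i> * complex_of_real t * cinner x1 v"
      unfolding x1(3)[symmetric] by (simp add: cinner_diff_left cinner_add_left cinner_scaleC_left 2)
    also have "\<dots> = cinner (\<H> x) (\<H> v) + (complex_of_real t)\<^sup>2 * cinner x v"
      unfolding x(3)[symmetric]
      by (simp add: cinner_diff_left cinner_scaleC_left 1 algebra_simps power2_eq_square)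
    finally have "Re (cinner u v) = Re (cinner (\<H> x) (\<H> v) + complex_of_real (t\<^sup>2) * cinner x v)"
      by simp
    then show ?thesis by (simp add: inner_l2_def del: of_real_power)
  qed
  \<comment> \<open>\<open>variation\<close> says that \<open>u\<close> satisfies the weak equation
    of \<open>x\<close> with right-hand side \<open>c u\<close>. Testing the difference against
    itself, where \<open>t\<^sup>2\<close> gives coercivity, shows \<open>u = c x\<close>.\<close>
  define c where "c = L\<^sup>2 + t\<^sup>2"
  have "u - c *\<^sub>R x = 0"
  proof -
    let ?y = "u - c *\<^sub>R x"
    have y: "?y \<in> \<D>" "?y \<in> W" by (intro dom_diff dom_scaleR W_diff W_scaleR u x uW)+
    have "inner (\<H> ?y) (\<H> ?y) + t\<^sup>2 * inner ?y ?y
        = inner (\<H> u) (\<H> ?y) + t\<^sup>2 * inner u ?y - c * (inner (\<H> x) (\<H> ?y) + t\<^sup>2 * inner x ?y)"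
      by (simp only: app_diff[OF u(1) dom_scaleR[OF x(1)]] app_scaleR[OF x(1)]
          inner_diff_left inner_scaleR_left) (simp add: algebra_simps)
    also have "\<dots> = 0" unfolding weak[OF y] variation[OF y] by (simp add: c_def algebra_simps)
    finally have "t\<^sup>2 * inner ?y ?y \<le> 0" using inner_ge_zero[of "\<H> ?y"] by linarith
    then have "inner ?y ?y \<le> 0" using t(3) by (simp add: mult_le_0_iff)
    then have "inner ?y ?y = 0" using inner_ge_zero[of ?y] by linarith
    then show ?thesis by (simp only: inner_eq_zero_iff)
  qed
  then have ux: "u = c *\<^sub>R x" by simp
  have Hx: "\<H> x = x1 + (\<i> * complex_of_real t) *\<^sub>C x" using x(3) by (simp add: algebra_simps)
  have Hx1: "\<H> x1 = u - (\<i> * complex_of_real t) *\<^sub>C x1" using x1(3) by (simp add: algebra_simps)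
  have HxD: "\<H> x \<in> \<D>" unfolding Hx by (intro dom_add dom_scaleC x x1)
  have HHx: "\<H> (\<H> x) = u - t\<^sup>2 *\<^sub>R x"
  proof -
    have "\<H> (\<H> x) = \<H> (x1 + (\<i> * complex_of_real t) *\<^sub>C x)" by (simp only: Hx)
    also have "\<dots> = \<H> x1 + (\<i> * complex_of_real t) *\<^sub>C \<H> x"
      by (simp add: app_add app_scaleC dom_scaleC x(1) x1(1))
    also have "\<dots> = u - t\<^sup>2 *\<^sub>R x"
      unfolding Hx1 Hx
      by (rule l2_eqI) (simp add: algebra_simps power2_eq_square)
    finally show ?thesis .
  qed
  have HuD: "\<H> u \<in> \<D>" unfolding ux app_scaleR[OF x(1)] by (rule dom_scaleR[OF HxD])
  have HHu: "\<H> (\<H> u) = L\<^sup>2 *\<^sub>R u"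
  proof -
    have "\<H> (\<H> u) = c *\<^sub>R \<H> (\<H> x)"
      by (subst ux) (simp add: app_scaleR x HxD)
    also have "\<dots> = c *\<^sub>R u - t\<^sup>2 *\<^sub>R (c *\<^sub>R x)" by (simp add: HHx algebra_simps)
    also have "\<dots> = L\<^sup>2 *\<^sub>R u" unfolding ux[symmetric] by (simp add: c_def algebra_simps)
    finally show ?thesis .
  qed
  \<comment> \<open>Since \<open>(\<H> + L) (\<H> - L) u = 0\<close>, either \<open>u\<close> has
    eigenvalue \<open>L\<close> or \<open>v\<close> is a nonzero vector with eigenvalue
    \<open>- L\<close>.\<close>
  define v where "v = \<H> u - L *\<^sub>R u"
  show thesis
  proof (cases "v = 0")
    case True
    then have Hu: "\<H> u = complex_of_real L *\<^sub>C u" by (simp add: v_def scaleR_l2_def)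
    have "u \<noteq> 0" using nu by auto
    from u(1) this Hu show thesis by (rule that) (use uW in \<open>auto simp: W_def\<close>)
  next
    case False
    have vD: "v \<in> \<D>" unfolding v_def by (intro dom_diff dom_scaleR HuD u)
    have vW: "v \<in> W" unfolding v_def by (intro W_diff W_scaleR W_H u uW)
    have "\<H> v = L\<^sup>2 *\<^sub>R u - L *\<^sub>R \<H> u"
      unfolding v_def by (simp add: app_diff HuD app_scaleR dom_scaleR u HHu)
    also have "\<dots> = (- L) *\<^sub>R v" by (simp add: v_def algebra_simps power2_eq_square)
    finally have Hv: "\<H> v = complex_of_real (- L) *\<^sub>C v" by (simp only: scaleR_l2_def)
    from vD False Hv show thesis by (rule that) (use vW in \<open>auto simp: W_def\<close>)
  qed
qed

theorem orthonormal_eigenbasis: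
  obtains S \<mu> where "orthonormal_on S id" "total_on S id" "S \<subseteq> \<D>"
    "\<And>\<psi>. \<psi> \<in> S \<Longrightarrow> \<H> \<psi> = complex_of_real (\<mu> \<psi>) *\<^sub>C \<psi>"
proof -
  define F where "F = {S. orthonormal_on S id \<and>
    (\<forall>\<psi>\<in>S. \<psi> \<in> \<D> \<and> (\<exists>\<mu>::real. \<H> \<psi> = complex_of_real \<mu> *\<^sub>C \<psi>))}"
  have "\<exists>S\<in>F. \<forall>X\<in>F. S \<subseteq> X \<longrightarrow> X = S"
  proof (rule subset_Zorn')
    fix C assume C: "subset.chain F C"
    then have CF: "C \<subseteq> F" by (auto simp: subset.chain_def)
    \<comment> \<open>Orthonormality involves two vectors at a time, and two elements of the union
      lie in a common member of the chain.\<close>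
    have "cinner \<psi> \<psi>' = (if \<psi> = \<psi>' then 1 else 0)" if "\<psi> \<in> \<Union>C" "\<psi>' \<in> \<Union>C" for \<psi> \<psi>'
    proof -
      obtain X Y where XY: "X \<in> C" "\<psi> \<in> X" "Y \<in> C" "\<psi>' \<in> Y" using \<open>\<psi> \<in> \<Union>C\<close> \<open>\<psi>' \<in> \<Union>C\<close> by auto
      with C have "X \<subseteq> Y \<or> Y \<subseteq> X" by (auto simp: subset.chain_def)
      then obtain Z where "Z \<in> C" "\<psi> \<in> Z" "\<psi>' \<in> Z" using XY by blast
      then show ?thesis using CF by (force simp: F_def orthonormal_on_def)
    qed
    then have "orthonormal_on (\<Union>C) id" unfolding orthonormal_on_def id_apply by blast
    then show "\<Union>C \<in> F" using CF unfolding F_def by blast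
  qed
  then obtain S where S: "S \<in> F" "\<And>X. X \<in> F \<Longrightarrow> S \<subseteq> X \<Longrightarrow> X = S" by blast
  have tot: "total_on S id"
  proof (rule ccontr)
    assume "\<not> total_on S id"
    then obtain w where w: "w \<noteq> 0" "\<And>\<psi>. \<psi> \<in> S \<Longrightarrow> cinner w \<psi> = 0" by (auto simp: total_on_def)
    have "\<And>\<psi>. \<psi> \<in> S \<Longrightarrow> \<psi> \<in> \<D> \<and> (\<exists>\<mu>::real. \<H> \<psi> = complex_of_real \<mu> *\<^sub>C \<psi>)"
      using S(1) by (auto simp: F_def)
    from eigenvector_in_complement[OF this w] obtain u \<mu> where
      u: "u \<in> \<D>" "u \<noteq> 0" "\<H> u = complex_of_real \<mu> *\<^sub>C u" "\<And>\<psi>. \<psi> \<in> S \<Longrightarrow> cinner u \<psi> = 0"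
      by metis
    define v where "v = (1 / norm u) *\<^sub>R u"
    have "norm v = 1" using u by (simp add: v_def)
    then have v: "cinner v v = 1" by (simp add: cinner_self)
    have v0: "cinner v \<psi> = 0" "cinner \<psi> v = 0" if "\<psi> \<in> S" for \<psi>
    proof -
      show "cinner v \<psi> = 0" using u(4)[OF that] by (simp add: v_def scaleR_l2_def cinner_scaleC_left)
      then show "cinner \<psi> v = 0" using cinner_commute[of \<psi> v] by simp
    qed
    have "v \<notin> S" using v v0 by force
    have "v \<in> \<D>" unfolding v_def by (rule dom_scaleR[OF u(1)])
    moreover have "\<H> v = complex_of_real \<mu> *\<^sub>C v"
      using u by (simp add: v_def scaleR_l2_def app_scaleC mult.commute)
    moreover have "orthonormal_on (insert v S) id"
      unfolding orthonormal_on_def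
    proof (intro ballI)
      fix \<psi> \<psi>' assume "\<psi> \<in> insert v S" "\<psi>' \<in> insert v S"
      then show "cinner (id \<psi>) (id \<psi>') = (if \<psi> = \<psi>' then 1 else 0)"
        using v v0 \<open>v \<notin> S\<close> S(1)
        by (cases "\<psi> = v"; cases "\<psi>' = v") (auto simp: F_def orthonormal_on_def)
    qed
    ultimately have "insert v S \<in> F" using S(1) unfolding F_def by blast
    from S(2)[OF this] \<open>v \<notin> S\<close> show False by auto
  qed
  have "\<forall>\<psi>\<in>S. \<exists>\<mu>::real. \<H> \<psi> = complex_of_real \<mu> *\<^sub>C \<psi>" using S(1) unfolding F_def by blast
  from bchoice[OF this] obtain \<mu> where "\<And>\<psi>. \<psi> \<in> S \<Longrightarrow> \<H> \<psi> = complex_of_real (\<mu> \<psi>) *\<^sub>C \<psi>"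
    by blast
  with tot S(1) show thesis by (intro that[of S \<mu>]) (auto simp: F_def)
qed

end

section \<open>Counting eigenvalues in windows\<close>

text \<open>Each element is sent to the number of its predecessors. Finiteness of the sublevel sets
  makes this rank a natural number, and its image is infinite and closed downwards, hence
  everything; the inverse is the enumeration.\<close>

lemma nat_enumeration_mono:
  fixes f :: "'a \<Rightarrow> real"
  assumes inf: "infinite S" and fin: "\<And>x. finite {i \<in> S. f i \<le> x}"
  obtains e :: "nat \<Rightarrow> 'a" where "bij_betw e UNIV S" "mono (\<lambda>n. f (e n))"
proof -
  have "S = (\<Union>k::nat. {i \<in> S. f i \<le> real k})"
    using real_arch_simple by auto
  moreover have "countable (\<Union>k::nat. {i \<in> S. f i \<le> real k})"
    by (rule countable_UN[OF countableI_type]) (rule countable_finite[OF fin])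
  ultimately have "countable S" by simp
  then obtain g :: "'a \<Rightarrow> nat" where g: "inj_on g S" by (auto simp: countable_def)
  \<comment> \<open>Equal values of \<open>f\<close> are separated by the arbitrary injection
    \<open>g\<close>, so that \<open>less\<close> is total on \<open>S\<close>.\<close>
  define less where "less j i \<longleftrightarrow> f j < f i \<or> f j = f i \<and> g j < g i" for j i
  define L where "L i = {j \<in> S. less j i}" for i
  define rank where "rank i = card (L i)" for i
  have finL: "finite (L i)" for i
    by (rule finite_subset[OF _ fin[of "f i"]]) (auto simp: L_def less_def)
  have rank_less: "rank j < rank i" if "j \<in> S" "less j i" for i j
    unfolding rank_def
  proof (rule psubset_card_mono[OF finL])
    show "L j \<subset> L i" using that by (auto simp: L_def less_def)
  qed
  have total: "less i j \<or> less j i" if "i \<in> S" "j \<in> S" "i \<noteq> j" for i j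
    using that g unfolding less_def inj_on_def by (metis linorder_neqE_nat linorder_neqE)
  have inj: "inj_on rank S"
    by (rule inj_onI) (metis rank_less total less_irrefl)
  have down: "{..<rank i} \<subseteq> rank ` S" if "i \<in> S" for i
  proof -
    have "rank ` L i \<subseteq> {..<rank i}" using rank_less by (auto simp: L_def)
    moreover have "card (rank ` L i) = card {..<rank i}"
      using card_image[OF inj_on_subset[OF inj, of "L i"]] by (simp add: rank_def L_def)
    ultimately have "rank ` L i = {..<rank i}" by (intro card_subset_eq) auto
    then show ?thesis by (auto simp: L_def)
  qed
  have "infinite (rank ` S)" using inf inj by (simp add: finite_image_iff)
  have surj: "rank ` S = UNIV"
  proof -
    have "m \<in> rank ` S" for m
    proof -
      obtain k where "k \<in> rank ` S" "m < k"
        using \<open>infinite (rank ` S)\<close> unfolding infinite_nat_iff_unbounded by blast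
      then show ?thesis using down by blast
    qed
    then show ?thesis by auto
  qed
  define e where "e = inv_into S rank"
  have bij: "bij_betw e UNIV S"
    unfolding e_def by (rule bij_betw_inv_into) (use inj surj in \<open>simp add: bij_betw_def\<close>)
  have eS: "e n \<in> S" "rank (e n) = n" for n
    using surj by (auto simp: e_def inv_into_into f_inv_into_f)
  have "mono (\<lambda>n. f (e n))"
  proof (rule monoI, rule ccontr)
    fix m n :: nat assume mn: "m \<le> n" "\<not> f (e m) \<le> f (e n)"
    then have "less (e n) (e m)" by (simp add: less_def)
    from rank_less[OF eS(1) this] show False using mn eS(2) by simp
  qed
  with bij show thesis by (rule that)
qed

text \<open>Splitting at zero puts the smallest nonnegative value at index 0, the normalisation
  demanded by \<open>eigenvalue_enumeration\<close>.\<close>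

lemma int_enumeration_mono:
  fixes f :: "'a \<Rightarrow> real"
  assumes fin: "\<And>x. finite {i \<in> S. \<bar>f i\<bar> \<le> x}"
    and inf: "infinite {i \<in> S. 0 \<le> f i}" "infinite {i \<in> S. f i < 0}"
  obtains e :: "int \<Rightarrow> 'a" where "bij_betw e UNIV S" "mono (\<lambda>n. f (e n))"
    "\<And>n. 0 \<le> n \<Longrightarrow> 0 \<le> f (e n)" "\<And>n. n < 0 \<Longrightarrow> f (e n) < 0"
proof -
  have "finite {i \<in> {i \<in> S. 0 \<le> f i}. f i \<le> x}" for x
    by (rule finite_subset[OF _ fin[of x]]) auto
  from nat_enumeration_mono[OF inf(1) this] obtain p :: "nat \<Rightarrow> 'a"
    where p: "bij_betw p UNIV {i \<in> S. 0 \<le> f i}" "mono (\<lambda>n. f (p n))" by blast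
  have "finite {i \<in> {i \<in> S. f i < 0}. - f i \<le> x}" for x
    by (rule finite_subset[OF _ fin[of x]]) auto
  from nat_enumeration_mono[OF inf(2) this] obtain q :: "nat \<Rightarrow> 'a"
    where q: "bij_betw q UNIV {i \<in> S. f i < 0}" "mono (\<lambda>n. - f (q n))" by blast
  have pS: "p n \<in> S" "0 \<le> f (p n)" and qS: "q n \<in> S" "f (q n) < 0" for n
    using bij_betwE[OF p(1)] bij_betwE[OF q(1)] by auto
  \<comment> \<open>\<open>nat (- n - 1)\<close> sends \<open>-1\<close> to 0, where
    \<open>q\<close> takes the largest negative value; each step to the left keeps the value or
    lowers it.\<close>
  define e where "e n = (if 0 \<le> n then p (nat n) else q (nat (- n - 1)))" for n :: int
  have "bij_betw e ({0..} \<union> {..<0}) ({i \<in> S. 0 \<le> f i} \<union> {i \<in> S. f i < 0})"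
  proof (rule bij_betw_combine)
    have "bij_betw (p \<circ> nat) {0..} {i \<in> S. 0 \<le> f i}"
      by (rule bij_betw_trans[OF _ p(1)]) (rule bij_betwI[of _ _ _ int]; auto)
    then show "bij_betw e {0..} {i \<in> S. 0 \<le> f i}"
      by (rule bij_betw_cong[THEN iffD1, rotated]) (auto simp: e_def)
    have "bij_betw (q \<circ> (\<lambda>n. nat (- n - 1))) {..<0} {i \<in> S. f i < 0}"
      by (rule bij_betw_trans[OF _ q(1)]) (rule bij_betwI[of _ _ _ "\<lambda>k. - int k - 1"]; auto)
    then show "bij_betw e {..<0} {i \<in> S. f i < 0}"
      by (rule bij_betw_cong[THEN iffD1, rotated]) (auto simp: e_def)
  qed auto
  moreover have "{0..} \<union> {..<0} = (UNIV :: int set)"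
    "{i \<in> S. 0 \<le> f i} \<union> {i \<in> S. f i < 0} = S" by auto
  ultimately have "bij_betw e UNIV S" by simp
  moreover have "mono (\<lambda>n. f (e n))"
  proof (rule monoI)
    fix m n :: int assume "m \<le> n"
    then consider "0 \<le> m" "0 \<le> n" | "m < 0" "0 \<le> n" | "m < 0" "n < 0" by linarith
    then show "f (e m) \<le> f (e n)"
    proof cases
      case 1
      then show ?thesis using monoD[OF p(2), of "nat m" "nat n"] \<open>m \<le> n\<close> by (simp add: e_def)
    next
      case 2
      then show ?thesis using pS(2)[of "nat n"] qS(2)[of "nat (- m - 1)"] by (simp add: e_def)
    next
      case 3
      then show ?thesis
        using monoD[OF q(2), of "nat (- n - 1)" "nat (- m - 1)"] \<open>m \<le> n\<close> by (simp add: e_def)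
    qed
  qed
  ultimately show thesis using pS qS by (intro that[of e]) (auto simp: e_def)
qed

lemma orthonormal_on_delta: "orthonormal_on A delta"
  by (auto simp: orthonormal_on_def Rep_l2_delta)

lemma total_on_delta: "total_on UNIV delta"
  by (auto simp: total_on_def intro!: l2_eqI)

section \<open>Comparison of windows of eigenvalues with windows of diagonal entries\<close>

context perturbed_diagonal
begin

definition eigenbasis :: "'i set \<Rightarrow> ('i \<Rightarrow> l2) \<Rightarrow> ('i \<Rightarrow> real) \<Rightarrow> bool" where
  "eigenbasis I \<phi> \<mu> \<longleftrightarrow> orthonormal_on I \<phi> \<and> total_on I \<phi> \<and>
     (\<forall>i\<in>I. \<phi> i \<in> \<D> \<and> \<H> (\<phi> i) = complex_of_real (\<mu> i) *\<^sub>C \<phi> i)"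

lemma eigenbasisD:
  assumes "eigenbasis I \<phi> \<mu>"
  shows "orthonormal_on I \<phi>" "total_on I \<phi>" "i \<in> I \<Longrightarrow> \<phi> i \<in> \<D>"
    "i \<in> I \<Longrightarrow> \<H> (\<phi> i) = complex_of_real (\<mu> i) *\<^sub>C \<phi> i"
  using assms by (auto simp: eigenbasis_def)

lemma delta_in_dom: "delta k \<in> \<D>"
  by (rule domI[of "K (delta k) + complex_of_real (d k) *\<^sub>C delta k"]) (simp add: Rep_l2_delta)

lemma coefficient_app:
  assumes "eigenbasis I \<phi> \<mu>" "i \<in> I" "u \<in> \<D>"
  shows "cinner (\<H> u) (\<phi> i) = complex_of_real (\<mu> i) * cinner u (\<phi> i)"
  using app_sym[OF assms(3) eigenbasisD(3)[OF assms(1,2)]] eigenbasisD(4)[OF assms(1,2)]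
  by (simp add: cinner_scaleC_right)

lemma finite_diagonal_window: "finite {n. \<bar>d n - c\<bar> \<le> h}"
  by (rule finite_subset[OF _ d_finite[of "\<bar>c\<bar> + h"]]) auto

lemma norm_multiplier_combination_le:
  assumes "orthonormal_on J \<psi>" "finite J" "\<And>j. j \<in> J \<Longrightarrow> \<bar>\<alpha> j\<bar> \<le> h" "0 \<le> h"
  shows "norm (\<Sum>j\<in>J. (complex_of_real (\<alpha> j) * x j) *\<^sub>C \<psi> j) \<le> h * norm (\<Sum>j\<in>J. x j *\<^sub>C \<psi> j)"
proof (rule power2_le_imp_le)
  have "(\<alpha> j)\<^sup>2 \<le> h\<^sup>2" if "j \<in> J" for j
    using power_mono[OF assms(3)[OF that], of 2] by simp
  then have "(\<Sum>j\<in>J. (\<alpha> j)\<^sup>2 * (cmod (x j))\<^sup>2) \<le> (\<Sum>j\<in>J. h\<^sup>2 * (cmod (x j))\<^sup>2)"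
    by (intro sum_mono mult_right_mono) auto
  then show "(norm (\<Sum>j\<in>J. (complex_of_real (\<alpha> j) * x j) *\<^sub>C \<psi> j))\<^sup>2
      \<le> (h * norm (\<Sum>j\<in>J. x j *\<^sub>C \<psi> j))\<^sup>2"
    by (simp add: power_mult_distrib norm_finite_sum_orthonormal[OF assms(1,2) order_refl]
        norm_mult sum_distrib_left)
qed (use assms(4) in simp)

text \<open>On the span of these eigenvectors \<open>\<H> - c\<close> has norm at most
  \<open>h\<close>, so the diagonal part minus \<open>c\<close> has norm at most
  \<open>h + M\<close> there. In the basis \<open>delta\<close> it acts by the weights
  \<open>\<bar>d n - c\<bar>\<close>, and \<open>orthonormal_card_le\<close> bounds the dimension of
  the span.\<close>

lemma eigenvalue_count_le:
  assumes on: "orthonormal_on J \<phi>" and J: "finite J"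
    and ev: "\<And>j. j \<in> J \<Longrightarrow> \<phi> j \<in> \<D>" "\<And>j. j \<in> J \<Longrightarrow> \<H> (\<phi> j) = complex_of_real (\<mu> j) *\<^sub>C \<phi> j"
    and win: "\<And>j. j \<in> J \<Longrightarrow> \<bar>\<mu> j - c\<bar> \<le> h" and h: "0 \<le> h"
  shows "card J \<le> card {n. \<bar>d n - c\<bar> \<le> h + M}"
proof -
  have "card J \<le> card {n \<in> UNIV. \<bar>d n - c\<bar> \<le> h + M}"
  proof (rule orthonormal_card_le[OF on J orthonormal_on_delta total_on_delta])
    fix x
    define u where "u = (\<Sum>j\<in>J. x j *\<^sub>C \<phi> j)"
    have uD: "u \<in> \<D>" unfolding u_def by (intro dom_sum dom_scaleC ev)
    have "\<H> u - complex_of_real c *\<^sub>C u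
        = (\<Sum>j\<in>J. (complex_of_real (\<mu> j - c) * x j) *\<^sub>C \<phi> j)"
    proof -
      have "\<H> u = (\<Sum>j\<in>J. \<H> (x j *\<^sub>C \<phi> j))"
        unfolding u_def by (rule app_sum) (intro dom_scaleC ev)
      also have "\<dots> = (\<Sum>j\<in>J. x j *\<^sub>C complex_of_real (\<mu> j) *\<^sub>C \<phi> j)"
        by (rule sum.cong) (simp_all add: app_scaleC ev)
      finally show ?thesis
        by (intro l2_eqI) (simp add: u_def sum_distrib_left sum_subtractf[symmetric] algebra_simps)
    qed
    then have 1: "norm (\<H> u - complex_of_real c *\<^sub>C u) \<le> h * norm u"
      unfolding u_def using norm_multiplier_combination_le[OF on J, of "\<lambda>j. \<mu> j - c" h x] win h
      by simp
    have eq: "(\<lambda>n. (\<bar>d n - c\<bar> * cmod (cinner u (delta n)))\<^sup>2)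
        = (\<lambda>n. (cmod (Rep_l2 (\<H> u - complex_of_real c *\<^sub>C u - K u) n))\<^sup>2)"
    proof
      fix n
      have "Rep_l2 (\<H> u - complex_of_real c *\<^sub>C u - K u) n = complex_of_real (d n - c) * Rep_l2 u n"
        by (simp add: app[OF uD] algebra_simps)
      then show "(\<bar>d n - c\<bar> * cmod (cinner u (delta n)))\<^sup>2
          = (cmod (Rep_l2 (\<H> u - complex_of_real c *\<^sub>C u - K u) n))\<^sup>2"
        by (simp only: norm_mult norm_of_real cinner_delta_right)
    qed
    show "(\<lambda>n. (\<bar>d n - c\<bar> * cmod (cinner (\<Sum>j\<in>J. x j *\<^sub>C \<phi> j) (delta n)))\<^sup>2) summable_on UNIV"
      unfolding u_def[symmetric] eq by (rule l2_summable)
    have "norm (\<H> u - complex_of_real c *\<^sub>C u - K u) \<le> (h + M) * norm u"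
      using norm_triangle_ineq4[of "\<H> u - complex_of_real c *\<^sub>C u" "K u"] 1 K_bound[of u]
      by (simp add: algebra_simps)
    from power_mono[OF this norm_ge_zero, of 2]
    show "(\<Sum>\<^sub>\<infinity>n. (\<bar>d n - c\<bar> * cmod (cinner (\<Sum>j\<in>J. x j *\<^sub>C \<phi> j) (delta n)))\<^sup>2)
        \<le> ((h + M) * norm (\<Sum>j\<in>J. x j *\<^sub>C \<phi> j))\<^sup>2"
      unfolding u_def[symmetric] eq norm_l2_square .
  qed (use finite_diagonal_window h M_pos in auto)
  then show ?thesis by simp
qed

lemma eigenbasis_window:
  assumes "eigenbasis I \<phi> \<mu>" "0 \<le> h"
  shows "finite {i \<in> I. \<bar>\<mu> i - c\<bar> \<le> h}"
    and "card {i \<in> I. \<bar>\<mu> i - c\<bar> \<le> h} \<le> card {n. \<bar>d n - c\<bar> \<le> h + M}"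
proof -
  have le: "card J \<le> card {n. \<bar>d n - c\<bar> \<le> h + M}" if "finite J" "J \<subseteq> {i \<in> I. \<bar>\<mu> i - c\<bar> \<le> h}" for J
  proof (rule eigenvalue_count_le[OF orthonormal_on_subset that(1) _ _ _ assms(2)])
    show "orthonormal_on I \<phi>" "J \<subseteq> I" using eigenbasisD[OF assms(1)] that by auto
  qed (use eigenbasisD[OF assms(1)] that in auto)
  then show fin: "finite {i \<in> I. \<bar>\<mu> i - c\<bar> \<le> h}"
    by (intro finite_if_finite_subsets_card_bdd[THEN conjunct1]) auto
  from le[OF this order_refl] show "card {i \<in> I. \<bar>\<mu> i - c\<bar> \<le> h} \<le> card {n. \<bar>d n - c\<bar> \<le> h + M}" .
qed

text \<open>The comparison of \<open>eigenvalue_count_le\<close> with the bases exchanged: on the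
  span of the chosen \<open>delta n\<close> the norm of \<open>\<H> - c\<close> is at most
  \<open>h + M\<close>, and Parseval in the eigenbasis expresses it by the weights
  \<open>\<bar>\<mu> i - c\<bar>\<close>.\<close>

lemma diagonal_count_le:
  assumes eb: "eigenbasis I \<phi> \<mu>" and N: "finite N" "\<And>n. n \<in> N \<Longrightarrow> \<bar>d n - c\<bar> \<le> h" and h: "0 \<le> h"
  shows "card N \<le> card {i \<in> I. \<bar>\<mu> i - c\<bar> \<le> h + M}"
proof (rule orthonormal_card_le[OF orthonormal_on_delta N(1) eigenbasisD(1,2)[OF eb]])
  show hM: "0 \<le> h + M" using h M_pos by simp
  show "finite {i \<in> I. \<bar>\<mu> i - c\<bar> \<le> h + M}" by (rule eigenbasis_window(1)[OF eb hM])
  fix x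
  define u where "u = (\<Sum>n\<in>N. x n *\<^sub>C delta n)"
  have uD: "u \<in> \<D>" unfolding u_def by (intro dom_sum dom_scaleC delta_in_dom)
  have "\<H> u - complex_of_real c *\<^sub>C u - K u = (\<Sum>n\<in>N. (complex_of_real (d n - c) * x n) *\<^sub>C delta n)"
  proof (rule l2_eqI)
    fix k
    have "Rep_l2 (\<H> u - complex_of_real c *\<^sub>C u - K u) k = complex_of_real (d k - c) * Rep_l2 u k"
      by (simp add: app[OF uD] algebra_simps)
    also have "\<dots> = Rep_l2 (\<Sum>n\<in>N. (complex_of_real (d n - c) * x n) *\<^sub>C delta n) k"
      unfolding u_def Rep_l2_sum sum_distrib_left
      by (rule sum.cong) (auto simp: Rep_l2_delta)
    finally show "Rep_l2 (\<H> u - complex_of_real c *\<^sub>C u - K u) k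
        = Rep_l2 (\<Sum>n\<in>N. (complex_of_real (d n - c) * x n) *\<^sub>C delta n) k" .
  qed
  then have 1: "norm (\<H> u - complex_of_real c *\<^sub>C u - K u) \<le> h * norm u"
    unfolding u_def
    using norm_multiplier_combination_le[OF orthonormal_on_delta N(1), of "\<lambda>n. d n - c" h x] N(2) h
    by simp
  have "norm (\<H> u - complex_of_real c *\<^sub>C u) \<le> (h + M) * norm u"
    using norm_triangle_ineq[of "\<H> u - complex_of_real c *\<^sub>C u - K u" "K u"] 1 K_bound[of u]
    by (simp add: algebra_simps)
  from power_mono[OF this norm_ge_zero, of 2]
  have 2: "(norm (\<H> u - complex_of_real c *\<^sub>C u))\<^sup>2 \<le> ((h + M) * norm u)\<^sup>2" .
  have "((\<lambda>i. (cmod (cinner (\<H> u - complex_of_real c *\<^sub>C u) (\<phi> i)))\<^sup>2) has_sum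
      (norm (\<H> u - complex_of_real c *\<^sub>C u))\<^sup>2) I"
    by (rule parseval_identity[OF eigenbasisD(1,2)[OF eb]])
  moreover have "(cmod (cinner (\<H> u - complex_of_real c *\<^sub>C u) (\<phi> i)))\<^sup>2
      = (\<bar>\<mu> i - c\<bar> * cmod (cinner u (\<phi> i)))\<^sup>2" if "i \<in> I" for i
  proof -
    have "cinner (\<H> u - complex_of_real c *\<^sub>C u) (\<phi> i) = complex_of_real (\<mu> i - c) * cinner u (\<phi> i)"
      by (simp add: cinner_diff_left cinner_scaleC_left coefficient_app[OF eb that uD] algebra_simps)
    then show ?thesis by (simp only: norm_mult norm_of_real)
  qed
  ultimately have 3: "((\<lambda>i. (\<bar>\<mu> i - c\<bar> * cmod (cinner u (\<phi> i)))\<^sup>2) has_sum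
      (norm (\<H> u - complex_of_real c *\<^sub>C u))\<^sup>2) I"
    by (simp cong: has_sum_cong)
  then show "(\<lambda>i. (\<bar>\<mu> i - c\<bar> * cmod (cinner (\<Sum>n\<in>N. x n *\<^sub>C delta n) (\<phi> i)))\<^sup>2) summable_on I"
    unfolding u_def by (rule has_sum_imp_summable)
  show "(\<Sum>\<^sub>\<infinity>i\<in>I. (\<bar>\<mu> i - c\<bar> * cmod (cinner (\<Sum>n\<in>N. x n *\<^sub>C delta n) (\<phi> i)))\<^sup>2)
      \<le> ((h + M) * norm (\<Sum>n\<in>N. x n *\<^sub>C delta n))\<^sup>2"
    using infsumI[OF 3] 2 by (simp add: u_def)
qed simp

lemma infinite_diagonal_pos: "infinite {n. x \<le> d n}"
proof
  assume "finite {n. x \<le> d n}"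
  then have "finite ({n. x \<le> d n} \<union> {n. \<bar>d n\<bar> \<le> x})" using d_finite by simp
  moreover have "{n. 0 \<le> d n} \<subseteq> {n. x \<le> d n} \<union> {n. \<bar>d n\<bar> \<le> x}" by auto
  ultimately show False using d_pos finite_subset by blast
qed

lemma infinite_diagonal_neg: "infinite {n. d n \<le> x}"
proof
  assume "finite {n. d n \<le> x}"
  then have "finite ({n. d n \<le> x} \<union> {n. \<bar>d n\<bar> \<le> - x})" using d_finite by simp
  moreover have "{n. d n < 0} \<subseteq> {n. d n \<le> x} \<union> {n. \<bar>d n\<bar> \<le> - x}" by auto
  ultimately show False using d_neg finite_subset by blast
qed

lemma infinite_eigenvalues:
  assumes eb: "eigenbasis I \<phi> \<mu>"
  shows "infinite {i \<in> I. 0 \<le> \<mu> i}" "infinite {i \<in> I. \<mu> i < 0}"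
proof -
  \<comment> \<open>Finite subsets of \<open>N\<close> are arbitrarily large. If each fits into a
    window of diagonal entries whose enlargement by \<open>M\<close> catches only eigenvalue indices
    from \<open>A\<close>, then \<open>A\<close> cannot be finite.\<close>
  have key: "infinite A"
    if N: "infinite N" and sub: "\<And>F. finite F \<Longrightarrow> F \<subseteq> N \<Longrightarrow> F \<noteq> {} \<Longrightarrow>
      \<exists>c h. 0 \<le> h \<and> (\<forall>n\<in>F. \<bar>d n - c\<bar> \<le> h) \<and> {i \<in> I. \<bar>\<mu> i - c\<bar> \<le> h + M} \<subseteq> A"
    for N :: "int set" and A
  proof
    assume fin: "finite A"
    obtain F where F: "finite F" "F \<subseteq> N" "card F = card A + 1"
      using infinite_arbitrarily_large[OF N] by blast
    then have "F \<noteq> {}" by auto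
    then obtain c h where ch: "0 \<le> h" "\<forall>n\<in>F. \<bar>d n - c\<bar> \<le> h" "{i \<in> I. \<bar>\<mu> i - c\<bar> \<le> h + M} \<subseteq> A"
      using sub[OF F(1,2)] by blast
    have "card F \<le> card {i \<in> I. \<bar>\<mu> i - c\<bar> \<le> h + M}"
      using diagonal_count_le[OF eb F(1) _ ch(1)] ch(2) by blast
    also have "\<dots> \<le> card A" by (rule card_mono[OF fin ch(3)])
    finally show False using F(3) by simp
  qed
  \<comment> \<open>The entries lie in the window from \<open>M\<close> to \<open>X\<close>;
    enlarging it by \<open>M\<close> reaches down exactly to 0.\<close>
  show "infinite {i \<in> I. 0 \<le> \<mu> i}"
  proof (rule key[OF infinite_diagonal_pos[of M]])
    fix F assume F: "finite F" "F \<subseteq> {n. M \<le> d n}" "F \<noteq> {}"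
    define X where "X = Max (d ` F)"
    have X: "d n \<le> X" if "n \<in> F" for n using that F by (simp add: X_def)
    then have "M \<le> X" using F by fastforce
    show "\<exists>c h. 0 \<le> h \<and> (\<forall>n\<in>F. \<bar>d n - c\<bar> \<le> h) \<and>
        {i \<in> I. \<bar>\<mu> i - c\<bar> \<le> h + M} \<subseteq> {i \<in> I. 0 \<le> \<mu> i}"
      using X subsetD[OF F(2)] \<open>M \<le> X\<close>
      by (rule_tac exI[of _ "(M + X) / 2"], rule_tac exI[of _ "(X - M) / 2"])
        (fastforce simp: abs_le_iff field_simps)
  qed
  \<comment> \<open>The extra \<open>- 1\<close> keeps the window enlarged by \<open>M\<close> at or
    below \<open>- 1\<close>, hence strictly negative.\<close>
  show "infinite {i \<in> I. \<mu> i < 0}"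
  proof (rule key[OF infinite_diagonal_neg[of "- M - 1"]])
    fix F assume F: "finite F" "F \<subseteq> {n. d n \<le> - M - 1}" "F \<noteq> {}"
    define X where "X = Min (d ` F)"
    have X: "X \<le> d n" if "n \<in> F" for n using that F by (simp add: X_def)
    then have "X \<le> - M - 1" using F by fastforce
    show "\<exists>c h. 0 \<le> h \<and> (\<forall>n\<in>F. \<bar>d n - c\<bar> \<le> h) \<and>
        {i \<in> I. \<bar>\<mu> i - c\<bar> \<le> h + M} \<subseteq> {i \<in> I. \<mu> i < 0}"
      using X subsetD[OF F(2)] \<open>X \<le> - M - 1\<close>
      by (rule_tac exI[of _ "(X - M - 1) / 2"], rule_tac exI[of _ "(- M - 1 - X) / 2"])
        (fastforce simp: abs_le_iff field_simps)
  qed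
qed

theorem ordered_eigenbasis:
  obtains \<phi> :: "int \<Rightarrow> l2" and ev where "eigenbasis UNIV \<phi> ev" "mono ev"
    "\<And>n. 0 \<le> n \<Longrightarrow> 0 \<le> ev n" "\<And>n. n < 0 \<Longrightarrow> ev n < 0"
proof -
  obtain S \<mu> where S: "orthonormal_on S id" "total_on S id" "S \<subseteq> \<D>"
    "\<And>\<psi>. \<psi> \<in> S \<Longrightarrow> \<H> \<psi> = complex_of_real (\<mu> \<psi>) *\<^sub>C \<psi>"
    using orthonormal_eigenbasis by metis
  then have eb: "eigenbasis S id \<mu>" by (auto simp: eigenbasis_def)
  have "finite {i \<in> S. \<bar>\<mu> i\<bar> \<le> x}" for x
  proof (cases "0 \<le> x")
    case True
    then show ?thesis using eigenbasis_window(1)[OF eb True, of 0] by simp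
  next
    case False
    then have "{i \<in> S. \<bar>\<mu> i\<bar> \<le> x} = {}" by auto
    then show ?thesis by (simp only: finite.emptyI)
  qed
  from int_enumeration_mono[OF this infinite_eigenvalues[OF eb]] obtain e :: "int \<Rightarrow> l2" where
    e: "bij_betw e UNIV S" "mono (\<lambda>n. \<mu> (e n))"
    "\<And>n. 0 \<le> n \<Longrightarrow> 0 \<le> \<mu> (e n)" "\<And>n. n < 0 \<Longrightarrow> \<mu> (e n) < 0" by blast
  have eS: "e n \<in> S" for n using bij_betwE[OF e(1)] by auto
  have einj: "e m = e n \<longleftrightarrow> m = n" for m n
    using e(1) by (auto simp: bij_betw_def inj_on_def)
  have "orthonormal_on UNIV e"
    using S(1) eS by (auto simp: orthonormal_on_def einj)
  moreover have "total_on UNIV e"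
    unfolding total_on_def
  proof (intro allI impI)
    fix u assume *: "\<forall>i\<in>UNIV. cinner u (e i) = 0"
    show "u = 0"
    proof (rule total_onD[OF S(2)])
      fix \<psi> assume "\<psi> \<in> S"
      then obtain n where "\<psi> = e n" using e(1) by (auto simp: bij_betw_def)
      then show "cinner u (id \<psi>) = 0" using * by simp
    qed
  qed
  ultimately have "eigenbasis UNIV e (\<lambda>n. \<mu> (e n))"
    using S(3,4) eS by (auto simp: eigenbasis_def)
  then show thesis by (rule that[OF _ e(2-4)])
qed

end

section \<open>Spectrum and functional calculus\<close>

locale diagonalized = perturbed_diagonal +
  fixes \<phi> :: "int \<Rightarrow> l2" and ev :: "int \<Rightarrow> real"
  assumes eb: "eigenbasis UNIV \<phi> ev"
begin

abbreviation coeff :: "l2 \<Rightarrow> int \<Rightarrow> complex" where "coeff u n \<equiv> cinner u (\<phi> n)"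

lemmas on = eigenbasisD(1)[OF eb] and tot = eigenbasisD(2)[OF eb]

lemma \<phi>_dom: "\<phi> n \<in> \<D>" and app_\<phi>: "\<H> (\<phi> n) = complex_of_real (ev n) *\<^sub>C \<phi> n"
  using eigenbasisD(3,4)[OF eb] by auto

lemma coeff_\<phi>: "coeff (\<phi> m) n = (if m = n then 1 else 0)"
  using on by (simp add: orthonormal_on_def)

lemma coeff_app: "u \<in> \<D> \<Longrightarrow> coeff (\<H> u) n = complex_of_real (ev n) * coeff u n"
  by (rule coefficient_app[OF eb]) auto

lemma coeff_eqI: "(\<And>n. coeff u n = coeff v n) \<Longrightarrow> u = v"
  by (rule eq_if_coefficients_eq[OF tot])

lemma expansion: "((\<lambda>n. coeff u n *\<^sub>C \<phi> n) has_sum u) UNIV"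
  by (rule orthonormal_expansion[OF on tot])

lemma parseval: "((\<lambda>n. (cmod (coeff u n))\<^sup>2) has_sum (norm u)\<^sup>2) UNIV"
  by (rule parseval_identity[OF on tot])

text \<open>Each coordinate of the formal image \<open>K u + d u\<close> is a bounded functional of
  \<open>u\<close>, so it can be expanded termwise in the eigenbasis even before \<open>u\<close> is
  known to lie in the domain.\<close>

lemma dom_by_coeff:
  assumes "\<And>n. coeff v n = complex_of_real (ev n) * coeff u n"
  shows "u \<in> \<D>" "\<H> u = v"
proof -
  have "Rep_l2 v k = Rep_l2 (K u) k + complex_of_real (d k) * Rep_l2 u k" for k
  proof -
    let ?l = "\<lambda>u. Rep_l2 (K u) k + complex_of_real (d k) * Rep_l2 u k"
    have "bounded_linear ?l"
      by (intro bounded_linear_add bounded_linear_const_mult bounded_linear_Rep_l2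
          bounded_linear_compose[OF bounded_linear_Rep_l2 bounded_linear_K])
    from has_sum_bounded_linear[OF this expansion[of u]]
    have "((\<lambda>n. ?l (coeff u n *\<^sub>C \<phi> n)) has_sum ?l u) UNIV" .
    moreover have "?l (coeff u n *\<^sub>C \<phi> n) = Rep_l2 (coeff v n *\<^sub>C \<phi> n) k" for n
    proof -
      have "?l (coeff u n *\<^sub>C \<phi> n) = coeff u n * Rep_l2 (\<H> (\<phi> n)) k"
        by (simp add: app[OF \<phi>_dom] K_scaleC algebra_simps)
      then show ?thesis by (simp add: app_\<phi> assms)
    qed
    ultimately have "((\<lambda>n. Rep_l2 (coeff v n *\<^sub>C \<phi> n) k) has_sum ?l u) UNIV" by simp
    with has_sum_bounded_linear[OF bounded_linear_Rep_l2 expansion[of v], of k]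
    show ?thesis by (metis has_sum_unique)
  qed
  from domI[OF this] show "u \<in> \<D>" "\<H> u = v" .
qed

text \<open>\<open>f n\<close> stands for the value of a bounded function at \<open>ev n\<close>;
  the resolvent and the propagator are the two instances.\<close>

definition fcalc :: "(int \<Rightarrow> complex) \<Rightarrow> l2 \<Rightarrow> l2" where
  "fcalc f u = (\<Sum>\<^sub>\<infinity>n. (f n * coeff u n) *\<^sub>C \<phi> n)"

lemma coeff_fcalc:
  assumes "\<And>n. cmod (f n) \<le> C"
  shows "coeff (fcalc f u) n = f n * coeff u n"
proof -
  have "(\<lambda>n. (cmod (f n * coeff u n))\<^sup>2) summable_on UNIV"
    by (intro square_summable_mult[OF _ assms] has_sum_imp_summable[OF parseval])
  then have "((\<lambda>n. (f n * coeff u n) *\<^sub>C \<phi> n) has_sum fcalc f u) UNIV"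
    unfolding fcalc_def by (intro has_sum_infsum summable_on_synthesis[OF on])
  from has_sum_unique_coefficient[OF on this] show ?thesis by simp
qed

lemma norm_le_if_coeff_le:
  assumes "\<And>n. cmod (coeff u n) \<le> C * cmod (coeff v n)" "0 \<le> C"
  shows "norm u \<le> C * norm v"
proof (rule power2_le_imp_le)
  have "(norm u)\<^sup>2 \<le> C\<^sup>2 * (norm v)\<^sup>2"
  proof (rule has_sum_mono[OF parseval has_sum_cmult_right[OF parseval]])
    fix n show "(cmod (coeff u n))\<^sup>2 \<le> C\<^sup>2 * (cmod (coeff v n))\<^sup>2"
      using power_mono[OF assms(1)[of n], of 2] by (simp add: power_mult_distrib)
  qed
  then show "(norm u)\<^sup>2 \<le> (C * norm v)\<^sup>2" by (simp add: power_mult_distrib)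
qed (use assms(2) in simp)

lemma finite_window: "finite {n. \<bar>ev n - c\<bar> \<le> h}"
proof (cases "0 \<le> h")
  case True
  then show ?thesis using eigenbasis_window(1)[OF eb, of h c] by simp
next
  case False
  then have "{n. \<bar>ev n - c\<bar> \<le> h} = {}" by auto
  then show ?thesis by (simp only: finite.emptyI)
qed

text \<open>Only finitely many eigenvalues lie near \<open>z\<close>, since windows are finite. For
  \<open>z\<close> off the eigenvalues the gap bounds the resolvent; for an eigenvalue
  \<open>z\<close> it isolates \<open>z\<close>.\<close>

lemma spectral_gap:
  obtains \<delta> where "\<delta> > 0" "\<And>n. complex_of_real (ev n) \<noteq> z \<Longrightarrow> \<delta> \<le> cmod (complex_of_real (ev n) - z)"
proof -
  define N where "N = {n. \<bar>ev n - Re z\<bar> \<le> 1 \<and> complex_of_real (ev n) \<noteq> z}"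
  have N: "finite N" by (rule finite_subset[OF _ finite_window[of "Re z" 1]]) (auto simp: N_def)
  define B where "B = insert 1 ((\<lambda>n. cmod (complex_of_real (ev n) - z)) ` N)"
  have B: "finite B" "B \<noteq> {}" using N by (auto simp: B_def)
  have "0 < Min B" using B by (auto simp: B_def N_def Min_gr_iff)
  moreover have "Min B \<le> cmod (complex_of_real (ev n) - z)" if "complex_of_real (ev n) \<noteq> z" for n
  proof (cases "\<bar>ev n - Re z\<bar> \<le> 1")
    case True
    then show ?thesis using that B by (intro Min_le) (auto simp: B_def N_def)
  next
    case False
    have "Min B \<le> 1" using B by (intro Min_le) (auto simp: B_def)
    also have "1 \<le> \<bar>Re (complex_of_real (ev n) - z)\<bar>" using False by simp
    also have "\<dots> \<le> cmod (complex_of_real (ev n) - z)" by (rule abs_Re_le_cmod)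
    finally show ?thesis .
  qed
  ultimately show thesis by (rule that)
qed

lemma resolvent_setI:
  assumes "\<And>n. complex_of_real (ev n) \<noteq> z"
  shows "z \<in> resolvent_set H"
proof -
  obtain \<delta> where \<delta>: "\<delta> > 0" "\<And>n. \<delta> \<le> cmod (complex_of_real (ev n) - z)"
    using spectral_gap[of z] assms by metis
  have co: "coeff (\<H> u - z *\<^sub>C u) n = (complex_of_real (ev n) - z) * coeff u n" if "u \<in> \<D>" for u n
    by (simp add: cinner_diff_left cinner_scaleC_left coeff_app[OF that] algebra_simps)
  have "bij_betw (\<lambda>u. \<H> u - z *\<^sub>C u) \<D> UNIV"
    unfolding bij_betw_def
  proof
    show "inj_on (\<lambda>u. \<H> u - z *\<^sub>C u) \<D>"
    proof (rule inj_onI)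
      fix u v assume uv: "u \<in> \<D>" "v \<in> \<D>" "\<H> u - z *\<^sub>C u = \<H> v - z *\<^sub>C v"
      show "u = v"
      proof (rule coeff_eqI)
        fix n
        have "(complex_of_real (ev n) - z) * coeff u n = (complex_of_real (ev n) - z) * coeff v n"
          unfolding co[OF uv(1), symmetric] co[OF uv(2), symmetric] uv(3) ..
        then show "coeff u n = coeff v n" using assms[of n] by simp
      qed
    qed
    have "w \<in> (\<lambda>u. \<H> u - z *\<^sub>C u) ` \<D>" for w
    proof -
      define f where "f n = 1 / (complex_of_real (ev n) - z)" for n
      have f: "cmod (f n) \<le> 1 / \<delta>" for n
        using \<delta>(1) \<delta>(2)[of n] by (simp add: f_def norm_divide frac_le)
      define u where "u = fcalc f w"
      have u: "coeff u n = f n * coeff w n" for n unfolding u_def by (rule coeff_fcalc[of f, OF f])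
      have *: "coeff (w + z *\<^sub>C u) n = complex_of_real (ev n) * coeff u n" for n
      proof -
        have "(complex_of_real (ev n) - z) * coeff u n = coeff w n"
          using assms[of n] by (simp add: u f_def)
        then show ?thesis by (simp add: cinner_add_left cinner_scaleC_left algebra_simps)
      qed
      have "u \<in> \<D>" "\<H> u - z *\<^sub>C u = w" using dom_by_coeff[OF *] by auto
      then show ?thesis by force
    qed
    then show "(\<lambda>u. \<H> u - z *\<^sub>C u) ` \<D> = UNIV" by blast
  qed
  moreover have "norm u \<le> 1 / \<delta> * norm (\<H> u - z *\<^sub>C u)" if u: "u \<in> \<D>" for u
  proof (rule norm_le_if_coeff_le)
    fix n
    have "cmod (coeff u n) * \<delta> \<le> cmod (coeff u n) * cmod (complex_of_real (ev n) - z)"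
      by (intro mult_left_mono \<delta>) auto
    then show "cmod (coeff u n) \<le> 1 / \<delta> * cmod (coeff (\<H> u - z *\<^sub>C u) n)"
      using \<delta>(1) by (simp add: co[OF u] norm_mult pos_le_divide_eq mult.commute)
  qed (use \<delta> in simp)
  ultimately show ?thesis unfolding resolvent_set_def by blast
qed

lemma spectrum_subset: "z \<in> spectrum H \<Longrightarrow> \<exists>n. z = complex_of_real (ev n)"
  using resolvent_setI[of z] by (auto simp: spectrum_def)

lemma \<phi>_eigenspace: "\<phi> n \<in> eigenspace H (complex_of_real (ev n))"
  by (simp add: eigenspace_def \<phi>_dom app_\<phi>)

lemma \<phi>_nonzero: "\<phi> n \<noteq> 0"
  using coeff_\<phi>[of n n] by auto

section \<open>Eigenspaces, multiplicities and discreteness\<close>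

lemma finite_level: "finite {n. complex_of_real (ev n) = z}"
  by (rule finite_subset[OF _ finite_window[of "Re z" 0]]) auto

lemma eigenspace_subset_span:
  "eigenspace H z \<subseteq> l2.span (\<phi> ` {n. complex_of_real (ev n) = z})"
proof
  let ?N = "{n. complex_of_real (ev n) = z}"
  fix u assume "u \<in> eigenspace H z"
  then have u: "u \<in> \<D>" "\<H> u = z *\<^sub>C u" by (auto simp: eigenspace_def)
  have "u = (\<Sum>n\<in>?N. coeff u n *\<^sub>C \<phi> n)"
  proof (rule coeff_eqI)
    fix n
    have "(complex_of_real (ev n) - z) * coeff u n = 0"
      using coeff_app[OF u(1), of n] unfolding u(2) cinner_scaleC_left
      by (metis left_diff_distrib right_minus_eq)
    then show "coeff u n = coeff (\<Sum>n\<in>?N. coeff u n *\<^sub>C \<phi> n) n"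
      using cinner_finite_sum_orthonormal[OF on finite_level[of z] subset_UNIV UNIV_I, where j = n and c = "coeff u"]
      by (cases "complex_of_real (ev n) = z") auto
  qed
  also have "\<dots> \<in> l2.span (\<phi> ` ?N)"
    by (intro l2.span_sum l2.span_scale l2.span_base) auto
  finally show "u \<in> l2.span (\<phi> ` ?N)" .
qed

lemma finite_multiplicity: "finite_multiplicity H z"
  unfolding finite_multiplicity_def
  by (rule exI[of _ "\<phi> ` {n. complex_of_real (ev n) = z}"])
     (use eigenspace_subset_span finite_level in auto)

lemma inj_\<phi>: "inj \<phi>"
  by (rule injI) (metis coeff_\<phi> zero_neq_one)

lemma multiplicity_eq: "multiplicity H z = card {n. complex_of_real (ev n) = z}"
  unfolding multiplicity_def
proof (rule l2.dim_unique)
  let ?N = "{n. complex_of_real (ev n) = z}"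
  show "\<phi> ` ?N \<subseteq> eigenspace H z" using \<phi>_eigenspace by auto
  show "eigenspace H z \<subseteq> l2.span (\<phi> ` ?N)" by (rule eigenspace_subset_span)
  show "card (\<phi> ` ?N) = card ?N" by (rule card_image[OF inj_on_subset[OF inj_\<phi>]]) simp
  show "l2.independent (\<phi> ` ?N)"
  proof (rule l2.independent_if_scalars_zero)
    show "finite (\<phi> ` ?N)" using finite_level by simp
    fix f x assume f: "(\<Sum>x\<in>\<phi> ` ?N. f x *\<^sub>C x) = 0" and "x \<in> \<phi> ` ?N"
    then obtain n where n: "x = \<phi> n" "n \<in> ?N" by auto
    have "(\<Sum>n\<in>?N. f (\<phi> n) *\<^sub>C \<phi> n) = 0"
      using f by (subst (asm) sum.reindex[OF inj_on_subset[OF inj_\<phi>]]) (auto simp: o_def)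
    then show "f x = 0"
      using cinner_finite_sum_orthonormal[OF on finite_level[of z] subset_UNIV UNIV_I, where j = n and c = "\<lambda>n. f (\<phi> n)"] n
      by simp
  qed
qed

lemma purely_discrete: "purely_discrete_spectrum H"
  unfolding purely_discrete_spectrum_def
proof (intro ballI conjI)
  fix z assume z: "z \<in> spectrum H"
  then obtain n where n: "z = complex_of_real (ev n)" using spectrum_subset by blast
  obtain \<delta> where \<delta>: "\<delta> > 0" "\<And>n. complex_of_real (ev n) \<noteq> z \<Longrightarrow> \<delta> \<le> cmod (complex_of_real (ev n) - z)"
    using spectral_gap[of z] by metis
  have "y = z" if y: "y \<in> spectrum H" "dist z y < \<delta>" for y
  proof (rule ccontr)
    assume "y \<noteq> z"
    obtain m where "y = complex_of_real (ev m)" using spectrum_subset y(1) by blast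
    with \<delta>(2)[of m] \<open>y \<noteq> z\<close> y(2) show False by (simp add: dist_norm norm_minus_commute)
  qed
  then show "z isolated_in spectrum H"
    unfolding isolated_in_dist_Ex_iff using z \<delta>(1) by blast
  show "is_eigenvalue H z"
    unfolding is_eigenvalue_def n using \<phi>_eigenspace \<phi>_nonzero by blast
  show "finite_multiplicity H z" by (rule finite_multiplicity)
qed

section \<open>Transfer of counts to arbitrary admissible enumerations\<close>

lemma eigenvalue_enumeration_ev:
  assumes "mono ev" "\<And>n. 0 \<le> n \<Longrightarrow> 0 \<le> ev n" "\<And>n. n < 0 \<Longrightarrow> ev n < 0"
  shows "eigenvalue_enumeration H ev"
  unfolding eigenvalue_enumeration_def
proof (intro conjI allI impI)
  fix n assume "0 \<le> ev n"
  then have "0 \<le> n" using assms(3)[of n] by force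
  with assms(1) show "ev 0 \<le> ev n" by (rule monoD)
qed (use assms finite_level finite_multiplicity multiplicity_eq in auto)

text \<open>An admissible enumeration may differ from \<open>ev\<close>, but both repeat each
  eigenvalue according to its multiplicity. A window is a finite disjoint union of level sets, hence
  has equally many indices for both.\<close>

lemma enumeration_window:
  assumes "eigenvalue_enumeration H ev'"
  shows "finite {n. \<bar>ev' n - c\<bar> \<le> h}" "card {n. \<bar>ev' n - c\<bar> \<le> h} = card {n. \<bar>ev n - c\<bar> \<le> h}"
proof -
  have "finite {n. complex_of_real (ev' n) = z} \<and>
      card {n. complex_of_real (ev' n) = z} = card {n. complex_of_real (ev n) = z}" for z
    using assms multiplicity_eq[of z] unfolding eigenvalue_enumeration_def by simp
  from this[of "complex_of_real _"]
  have lev': "finite {n. ev' n = x}" and card': "card {n. ev' n = x} = card {n. ev n = x}" for x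
    by simp_all
  have lev: "finite {n. ev n = x}" for x
    using finite_level[of "complex_of_real x"] by simp
  define X where "X = ev ` {n. \<bar>ev n - c\<bar> \<le> h}"
  have X: "finite X" using finite_window by (simp add: X_def)
  have 1: "{n. \<bar>ev n - c\<bar> \<le> h} = (\<Union>x\<in>X. {n. ev n = x})" by (auto simp: X_def)
  have 2: "{n. \<bar>ev' n - c\<bar> \<le> h} = (\<Union>x\<in>X. {n. ev' n = x})"
  proof -
    have "ev' n \<in> X" if "\<bar>ev' n - c\<bar> \<le> h" for n
    proof -
      have "card {k. ev' k = ev' n} \<noteq> 0" using lev'[of "ev' n"] by auto
      then have "{k. ev k = ev' n} \<noteq> {}" unfolding card' by (metis card.empty)
      then obtain k where "ev k = ev' n" by blast
      then show ?thesis using that by (auto simp: X_def intro!: image_eqI[of _ _ k])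
    qed
    then show ?thesis by (auto simp: X_def)
  qed
  show "finite {n. \<bar>ev' n - c\<bar> \<le> h}" unfolding 2 using X lev' by simp
  have "card {n. \<bar>ev' n - c\<bar> \<le> h} = (\<Sum>x\<in>X. card {n. ev' n = x})"
    unfolding 2 by (rule card_UN_disjoint) (use X lev' in auto)
  also have "\<dots> = card {n. \<bar>ev n - c\<bar> \<le> h}"
    unfolding 1 card' by (rule card_UN_disjoint[symmetric]) (use X lev in auto)
  finally show "card {n. \<bar>ev' n - c\<bar> \<le> h} = card {n. \<bar>ev n - c\<bar> \<le> h}" .
qed

lemma enumeration_interval:
  assumes "eigenvalue_enumeration H ev'" "\<alpha> \<le> \<beta>"
  shows "finite {n. \<alpha> \<le> ev' n \<and> ev' n \<le> \<beta>}"
    and "card {n. \<alpha> \<le> ev' n \<and> ev' n \<le> \<beta>} \<le> card {n. \<alpha> - M \<le> d n \<and> d n \<le> \<beta> + M}"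
    and "card {n. \<alpha> \<le> d n \<and> d n \<le> \<beta>} \<le> card {n. \<alpha> - M \<le> ev' n \<and> ev' n \<le> \<beta> + M}"
proof -
  define c h where "c = (\<alpha> + \<beta>) / 2" and "h = (\<beta> - \<alpha>) / 2"
  have h: "0 \<le> h" using assms(2) by (simp add: h_def)
  have win: "{n. \<alpha> \<le> f n \<and> f n \<le> \<beta>} = {n. \<bar>f n - c\<bar> \<le> h}"
    "{n. \<alpha> - M \<le> f n \<and> f n \<le> \<beta> + M} = {n. \<bar>f n - c\<bar> \<le> h + M}" for f :: "int \<Rightarrow> real"
    unfolding c_def h_def abs_le_iff by (rule Collect_cong, argo)+
  note w = enumeration_window[OF assms(1)]
  show "finite {n. \<alpha> \<le> ev' n \<and> ev' n \<le> \<beta>}" unfolding win by (rule w)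
  show "card {n. \<alpha> \<le> ev' n \<and> ev' n \<le> \<beta>} \<le> card {n. \<alpha> - M \<le> d n \<and> d n \<le> \<beta> + M}"
    unfolding win w using eigenbasis_window(2)[OF eb h, of c] by simp
  show "card {n. \<alpha> \<le> d n \<and> d n \<le> \<beta>} \<le> card {n. \<alpha> - M \<le> ev' n \<and> ev' n \<le> \<beta> + M}"
    unfolding win w using diagonal_count_le[OF eb finite_diagonal_window[of c h] _ h, of c] by simp
qed

end

section \<open>The unitary group\<close>

lemma cmod_cis_minus_one_le: "cmod (exp (\<i> * complex_of_real x) - 1) \<le> \<bar>x\<bar>"
  using abs_sin_x_le_abs_x[of "x / 2"] by (simp add: dist_exp_i_1)

lemma exp_has_vector_derivative:
  "((\<lambda>t. exp (- (\<i> * complex_of_real (t * x)))) has_vector_derivative - \<i> * complex_of_real x * exp (- (\<i> * complex_of_real (t * x)))) (at t within A)"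
proof -
  have "((\<lambda>z. exp (- (\<i> * (z * complex_of_real x)))) has_field_derivative
      - \<i> * complex_of_real x * exp (- (\<i> * (complex_of_real t * complex_of_real x)))) (at (complex_of_real t))"
    by (auto intro!: derivative_eq_intros)
  from has_vector_derivative_real_field[OF this] show ?thesis
    by (simp add: has_vector_derivative_at_within)
qed

lemma has_vector_derivative_at_0_iff:
  fixes f :: "real \<Rightarrow> 'b::real_normed_vector"
  shows "(f has_vector_derivative w) (at 0) \<longleftrightarrow> ((\<lambda>t. (1 / t) *\<^sub>R (f t - f 0)) \<longlongrightarrow> w) (at 0)"
proof -
  have eq: "norm (f t - f 0 - t *\<^sub>R w) / norm t = norm ((1 / t) *\<^sub>R (f t - f 0) - w)" if "t \<noteq> 0" for t
  proof -
    have "(1 / t) *\<^sub>R (f t - f 0) - w = (1 / t) *\<^sub>R (f t - f 0 - t *\<^sub>R w)"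
      using that by (simp add: scaleR_diff_right)
    then show ?thesis by simp
  qed
  have "(f has_vector_derivative w) (at 0) \<longleftrightarrow>
      ((\<lambda>t. norm (f t - f 0 - t *\<^sub>R w) / norm t) \<longlongrightarrow> 0) (at 0)"
    by (simp add: has_vector_derivative_def has_derivative_iff_norm bounded_linear_scaleR_left)
  also have "\<dots> \<longleftrightarrow> ((\<lambda>t. norm ((1 / t) *\<^sub>R (f t - f 0) - w)) \<longlongrightarrow> 0) (at 0)"
    by (rule filterlim_cong[OF refl refl]) (use eq in \<open>auto simp: eventually_at_filter intro!: always_eventually\<close>)
  also have "\<dots> \<longleftrightarrow> ((\<lambda>t. (1 / t) *\<^sub>R (f t - f 0)) \<longlongrightarrow> w) (at 0)"
    by (simp add: tendsto_norm_zero_iff LIM_zero_iff)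
  finally show ?thesis .
qed

context diagonalized
begin

text \<open>Dominated convergence in the eigenbasis: the coefficient map \<open>V\<close> is an
  isometry into l2 by Parseval and carries \<open>tendsto_l2_dominated\<close> over.\<close>

lemma tendsto_coeffI:
  fixes f :: "'a \<Rightarrow> l2"
  assumes lim: "\<And>n. ((\<lambda>t. coeff (f t) n) \<longlongrightarrow> coeff u n) F"
    and dom: "\<forall>\<^sub>F t in F. \<forall>n. cmod (coeff (f t) n - coeff u n) \<le> g n"
    and g: "(\<lambda>n. (g n)\<^sup>2) summable_on UNIV"
  shows "(f \<longlongrightarrow> u) F"
proof -
  define V where "V u = Abs_l2 (coeff u)" for u
  have V: "Rep_l2 (V u) n = coeff u n" for u n
    unfolding V_def by (subst Rep_l2_Abs_l2) (auto intro: has_sum_imp_summable[OF parseval])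
  have "norm (V u - V v) = norm (u - v)" for u v
  proof -
    have "(norm (V u - V v))\<^sup>2 = (norm (u - v))\<^sup>2"
      unfolding norm_l2_square[of "V u - V v"] Rep_l2_diff V cinner_diff_left[symmetric]
      by (rule infsumI[OF parseval])
    then show ?thesis by (simp add: power2_eq_iff_nonneg)
  qed
  then have dist: "dist (V u) (V v) = dist u v" for u v by (simp add: dist_norm)
  have "((\<lambda>t. V (f t)) \<longlongrightarrow> V u) F"
    by (rule tendsto_l2_dominated[where g = g]) (use assms in \<open>simp_all add: V\<close>)
  then show ?thesis by (simp add: tendsto_iff dist)
qed

definition U :: "real \<Rightarrow> l2 \<Rightarrow> l2" where
  "U t = fcalc (\<lambda>n. exp (- (\<i> * complex_of_real (t * ev n))))"

lemma coeff_U: "coeff (U t u) n = exp (- (\<i> * complex_of_real (t * ev n))) * coeff u n"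
  unfolding U_def by (rule coeff_fcalc[where C = 1]) simp

lemma cinner_by_coeff: "((\<lambda>n. coeff u n * cnj (coeff v n)) has_sum cinner u v) UNIV"
  using has_sum_bounded_linear[OF bounded_linear_cinner_left expansion[of u], of v]
  by (simp add: cinner_scaleC_left cinner_commute[of "\<phi> _" v])

lemma cinner_U: "cinner (U t u) (U t v) = cinner u v"
proof -
  have "coeff (U t u) n * cnj (coeff (U t v) n) = coeff u n * cnj (coeff v n)" for n
  proof -
    let ?E = "exp (- (\<i> * complex_of_real (t * ev n)))"
    have "coeff (U t u) n * cnj (coeff (U t v) n) = (?E * cnj ?E) * (coeff u n * cnj (coeff v n))"
      unfolding coeff_U by (simp only: complex_cnj_mult mult_ac)
    also have "?E * cnj ?E = 1"
      unfolding complex_norm_square[symmetric] by (simp add: norm_exp_eq_Re)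
    finally show ?thesis by simp
  qed
  then show ?thesis using cinner_by_coeff[of "U t u" "U t v"] cinner_by_coeff[of u v]
    by (simp add: has_sum_unique)
qed

lemma U_zero: "U 0 u = u"
  by (rule coeff_eqI) (simp add: coeff_U)

lemma U_add: "U (s + t) u = U s (U t u)"
  by (rule coeff_eqI) (simp add: coeff_U exp_add[symmetric] algebra_simps)

lemma continuous_U: "continuous_on UNIV (\<lambda>t. U t u)"
  unfolding continuous_on_def
proof
  fix t :: real
  show "((\<lambda>t. U t u) \<longlongrightarrow> U t u) (at t within UNIV)"
  proof (rule tendsto_coeffI[where g = "\<lambda>n. cmod (2 * coeff u n)"])
    show "((\<lambda>s. coeff (U s u) n) \<longlongrightarrow> coeff (U t u) n) (at t within UNIV)" for n
      unfolding coeff_U by (intro tendsto_intros)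
    have "cmod (coeff (U s u) n - coeff (U t u) n) \<le> cmod (2 * coeff u n)" for s n
      using norm_triangle_ineq4[of "coeff (U s u) n" "coeff (U t u) n"]
      by (simp add: coeff_U norm_mult)
    then show "\<forall>\<^sub>F s in at t within UNIV. \<forall>n. cmod (coeff (U s u) n - coeff (U t u) n) \<le> cmod (2 * coeff u n)"
      by (intro always_eventually) auto
    show "(\<lambda>n. (cmod (2 * coeff u n))\<^sup>2) summable_on UNIV"
      by (intro square_summable_mult has_sum_imp_summable[OF parseval]) auto
  qed
qed

text \<open>A derivative prescribes the coefficients of \<open>\<H> u\<close>, and
  \<open>dom_by_coeff\<close> then places \<open>u\<close> in the domain. Conversely the difference
  quotients have coefficients dominated by those of \<open>\<H> u\<close>, because
  \<open>exp (- \<i> t x) - 1\<close> has modulus at most \<open>\<bar>t x\<bar>\<close>.\<close>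

lemma U_derivative_iff:
  "((\<lambda>t. U t u) has_vector_derivative w) (at 0) \<longleftrightarrow> u \<in> \<D> \<and> w = (- \<i>) *\<^sub>C \<H> u"
proof
  assume der: "((\<lambda>t. U t u) has_vector_derivative w) (at 0)"
  have "coeff w n = - \<i> * complex_of_real (ev n) * coeff u n" for n
  proof -
    have "((\<lambda>t. coeff (U t u) n) has_vector_derivative coeff w n) (at 0)"
      by (rule bounded_linear.has_vector_derivative[OF bounded_linear_cinner_left der])
    moreover have "((\<lambda>t. coeff (U t u) n) has_vector_derivative
        - \<i> * complex_of_real (ev n) * coeff u n) (at 0)"
      unfolding coeff_U
      using has_vector_derivative_mult_left[OF exp_has_vector_derivative[of "ev n" 0 UNIV], of "coeff u n"]
      by simp
    ultimately show ?thesis by (rule vector_derivative_unique_at)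
  qed
  then have *: "coeff (\<i> *\<^sub>C w) n = complex_of_real (ev n) * coeff u n" for n
    by (simp add: cinner_scaleC_left algebra_simps)
  have "u \<in> \<D>" "\<H> u = \<i> *\<^sub>C w" using dom_by_coeff[OF *] by auto
  moreover have "w = (- \<i>) *\<^sub>C \<i> *\<^sub>C w" by (rule l2_eqI) simp
  ultimately show "u \<in> \<D> \<and> w = (- \<i>) *\<^sub>C \<H> u" by simp
next
  assume u: "u \<in> \<D> \<and> w = (- \<i>) *\<^sub>C \<H> u"
  define E where "E t n = (exp (- (\<i> * complex_of_real (t * ev n))) - 1) / complex_of_real t" for t n
  have cw: "coeff w n = - \<i> * complex_of_real (ev n) * coeff u n" for n
    using u by (simp add: cinner_minus_left cinner_scaleC_left coeff_app)
  have cq: "coeff ((1 / t) *\<^sub>R (U t u - U 0 u)) n = E t n * coeff u n" for t n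
    by (simp add: scaleR_l2_def cinner_scaleC_left cinner_diff_left coeff_U E_def algebra_simps diff_divide_distrib)
  have "((\<lambda>t. (1 / t) *\<^sub>R (U t u - U 0 u)) \<longlongrightarrow> w) (at 0)"
  proof (rule tendsto_coeffI[where g = "\<lambda>n. cmod (2 * coeff (\<H> u) n)"])
    fix n
    have "((\<lambda>t. exp (- (\<i> * complex_of_real (t * ev n)))) has_vector_derivative
        - \<i> * complex_of_real (ev n)) (at 0)"
      using exp_has_vector_derivative[of "ev n" 0 UNIV] by simp
    then have "((\<lambda>t. E t n) \<longlongrightarrow> - \<i> * complex_of_real (ev n)) (at 0)"
      unfolding has_vector_derivative_at_0_iff by (simp add: E_def scaleR_conv_of_real)
    then show "((\<lambda>t. coeff ((1 / t) *\<^sub>R (U t u - U 0 u)) n) \<longlongrightarrow> coeff w n) (at 0)"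
      unfolding cq cw by (intro tendsto_intros)
  next
    have "cmod (E t n) \<le> \<bar>ev n\<bar>" if "t \<noteq> 0" for t n
      using cmod_cis_minus_one_le[of "- (t * ev n)"] that
      by (simp add: E_def norm_divide abs_mult pos_divide_le_eq mult.commute)
    then have dom1: "cmod (E t n * coeff u n) \<le> cmod (coeff (\<H> u) n)" if "t \<noteq> 0" for t n
      using u that by (simp add: coeff_app norm_mult mult_right_mono)
    have dom2: "cmod (coeff w n) = cmod (coeff (\<H> u) n)" for n
      using u by (simp add: cinner_minus_left cinner_scaleC_left norm_mult)
    have "cmod (E t n * coeff u n - coeff w n) \<le> cmod (2 * coeff (\<H> u) n)" if "t \<noteq> 0" for t n
    proof -
      have "cmod (E t n * coeff u n - coeff w n) \<le> cmod (E t n * coeff u n) + cmod (coeff w n)"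
        by (rule norm_triangle_ineq4)
      also have "\<dots> \<le> cmod (coeff (\<H> u) n) + cmod (coeff (\<H> u) n)"
        by (intro add_mono dom1 that eq_refl dom2)
      finally show ?thesis by (simp add: norm_mult)
    qed
    then show "\<forall>\<^sub>F t in at 0. \<forall>n. cmod (coeff ((1 / t) *\<^sub>R (U t u - U 0 u)) n - coeff w n)
        \<le> cmod (2 * coeff (\<H> u) n)"
      unfolding cq by (auto simp: eventually_at_filter)
    show "(\<lambda>n. (cmod (2 * coeff (\<H> u) n))\<^sup>2) summable_on UNIV"
      by (intro square_summable_mult has_sum_imp_summable[OF parseval]) auto
  qed
  then show "((\<lambda>t. U t u) has_vector_derivative w) (at 0)"
    unfolding has_vector_derivative_at_0_iff .
qed

lemma is_unitary_group_U: "is_unitary_group_of H U"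
  unfolding is_unitary_group_of_def
proof (intro conjI allI)
  fix t
  show "Vector_Spaces.linear (*\<^sub>C) (*\<^sub>C) (U t)"
    unfolding Vector_Spaces.linear_iff
    by (intro conjI allI l2.vector_space_axioms coeff_eqI)
       (simp_all add: coeff_U cinner_add_left cinner_scaleC_left algebra_simps)
  have "U t (U (- t) u) = u" for u
    using U_add[of t "- t" u] by (simp add: U_zero)
  then show "surj (U t)" by (metis surjI)
  show "cinner (U t u) (U t v) = cinner u v" for u v by (rule cinner_U)
  show "U (s + t) = U s \<circ> U t" for s by (rule ext) (simp add: U_add)
qed (auto simp: fun_eq_iff U_zero continuous_U U_derivative_iff)

text \<open>The orbit of an eigenvector solves a scalar ODE, hence is determined; unitarity then
  determines the coefficients of every other orbit.\<close>

lemma unitary_group_unique: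
  assumes G: "is_unitary_group_of H G"
  shows "G = U"
proof -
  have lin: "Vector_Spaces.linear (*\<^sub>C) (*\<^sub>C) (G t)"
    and iso: "cinner (G t u) (G t v) = cinner u v"
    and add: "G (s + t) u = G s (G t u)" and zero: "G 0 u = u"
    and der: "((\<lambda>t. G t u) has_vector_derivative w) (at 0) \<longleftrightarrow> u \<in> \<D> \<and> w = (- \<i>) *\<^sub>C \<H> u"
    for s t u v w
    using G by (auto simp: is_unitary_group_of_def)
  have G_add: "G t (u + v) = G t u + G t v" and G_scaleC: "G t (c *\<^sub>C u) = c *\<^sub>C G t u" for t u v c
    using lin[of t] by (auto simp: Vector_Spaces.linear_iff)
  have "norm (G t u) = norm u" for t u
    using iso[of t u u] by (simp add: cinner_self power2_eq_iff_nonneg flip: of_real_power)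
  then have bl: "bounded_linear (G t)" for t
    by (intro bounded_linear_intro[of _ 1]) (simp_all add: G_add G_scaleC scaleR_l2_def)
  have G\<phi>: "exp (\<i> * complex_of_real (t * ev n)) *\<^sub>C G t (\<phi> n) = \<phi> n" for t n
  proof (rule l2_eqI)
    fix k
    let ?g = "\<lambda>t. Rep_l2 (G t (\<phi> n)) k"
    \<comment> \<open>The sign of \<open>ev n\<close> is reversed, so \<open>?e\<close> is the
      integrating factor of the scalar equation \<open>g\<close> and the product has derivative
      0.\<close>
    let ?e = "\<lambda>t. exp (- (\<i> * complex_of_real (t * - ev n)))"
    have g: "(?g has_vector_derivative - \<i> * complex_of_real (ev n) * ?g s) (at s)" for s
    proof -
      have "((\<lambda>h. G h (\<phi> n)) has_vector_derivative (- \<i>) *\<^sub>C \<H> (\<phi> n)) (at 0)"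
        using der \<phi>_dom by blast
      from bounded_linear.has_vector_derivative[OF bl this, of s]
      have "((\<lambda>h. G (s + h) (\<phi> n)) has_vector_derivative G s ((- \<i>) *\<^sub>C \<H> (\<phi> n))) (at (s - s))"
        by (simp add: add)
      from vector_diff_chain_at[of "\<lambda>x. x - s" 1 s, OF _ this]
      have "((\<lambda>x. G x (\<phi> n)) has_vector_derivative G s ((- \<i>) *\<^sub>C \<H> (\<phi> n))) (at s)"
        by (simp add: o_def has_vector_derivative_diff_const has_vector_derivative_id)
      from bounded_linear.has_vector_derivative[OF bounded_linear_Rep_l2 this, of k]
      show ?thesis by (simp only: app_\<phi> G_scaleC scaleC.rep_eq mult.assoc)
    qed
    have "((\<lambda>s. ?e s * ?g s) has_vector_derivative 0) (at s within UNIV)" for s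
      using has_vector_derivative_mult[OF exp_has_vector_derivative[of "- ev n" s UNIV] g[of s]]
      by (simp add: algebra_simps)
    from has_vector_derivative_zero_constant[OF convex_UNIV this]
    obtain c where "\<And>s. ?e s * ?g s = c" by auto
    from this[of t] this[of 0] have "?e t * ?g t = ?g 0" by simp
    then show "Rep_l2 (exp (\<i> * complex_of_real (t * ev n)) *\<^sub>C G t (\<phi> n)) k = Rep_l2 (\<phi> n) k"
      by (simp add: zero)
  qed
  have "G t u = U t u" for t u
  proof (rule coeff_eqI)
    fix n
    have "coeff (G t u) n = cnj (exp (\<i> * complex_of_real (t * ev n))) * cinner (G t u) (G t (\<phi> n))"
      by (subst (1) G\<phi>[of t n, symmetric]) (simp add: cinner_scaleC_right)
    also have "\<dots> = coeff (U t u) n" by (simp add: iso coeff_U exp_cnj)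
    finally show "coeff (G t u) n = coeff (U t u) n" .
  qed
  then show ?thesis by (intro ext)
qed

lemma exp_group_eq: "exp_group H = U"
  unfolding exp_group_def
  by (rule the_equality[where P = "is_unitary_group_of H", OF is_unitary_group_U unitary_group_unique])

lemma has_sum_exp_group_entry:
  "((\<lambda>m. exp (- (\<i> * complex_of_real (t * ev m))) * cnj (Rep_l2 (\<phi> m) k) * Rep_l2 (\<phi> m) n)
    has_sum cinner (exp_group H t (delta k)) (delta n)) UNIV"
  using has_sum_bounded_linear[OF bounded_linear_Rep_l2 expansion[of "U t (delta k)"], of n]
  by (simp add: coeff_U exp_group_eq)

lemma summable_on_eigenvector_products:
  "(\<lambda>m. cmod (Rep_l2 (\<phi> m) k) * cmod (Rep_l2 (\<phi> m) n)) summable_on UNIV"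
  by (rule square_summable_product)
    (use has_sum_imp_summable[OF parseval[of "delta k"]] has_sum_imp_summable[OF parseval[of "delta n"]]
      in simp_all)

lemma cmod_exp_group_entry_le:
  "cmod (cinner (exp_group H t (delta k)) (delta n))
    \<le> (\<Sum>\<^sub>\<infinity>m. cmod (Rep_l2 (\<phi> m) k) * cmod (Rep_l2 (\<phi> m) n))"
  using norm_infsum_bound[of "\<lambda>m. exp (- (\<i> * complex_of_real (t * ev m))) * cnj (Rep_l2 (\<phi> m) k) * Rep_l2 (\<phi> m) n" UNIV]
    summable_on_eigenvector_products[of k n] infsumI[OF has_sum_exp_group_entry[of t k n]]
  by (simp add: norm_mult)

end

section \<open>Enumerations and power potentials\<close>

text \<open>The block \<open>{p..q}\<close> has \<open>q - p + 1\<close> indices, the open interval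
  only \<open>y - x - 1\<close>. The strict inequality is what contradicts the choice of the shift
  \<open>L\<close> in each case of \<open>enumeration_close\<close>.\<close>

lemma card_atLeastAtMost_int_le_greaterLess:
  fixes p q x y :: int
  assumes "finite A" "{p..q} \<subseteq> A" "finite B" "card A \<le> card B" "B \<subseteq> {x<..<y}" "p \<le> q"
  shows "q - p + 1 < y - x"
proof -
  have "nat (q - p + 1) = card {p..q}" by simp
  also have "\<dots> \<le> card A" by (rule card_mono[OF assms(1,2)])
  also have "\<dots> \<le> card B" by (rule assms(4))
  also have "\<dots> \<le> card {x<..<y}" by (rule card_mono[OF _ assms(5)]) simp
  also have "\<dots> = nat (y - (x + 1))" by simp
  finally show ?thesis using assms(6) by linarith
qed

text \<open>The index of an eigenvalue is only controlled through counts over bounded windows, since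
  there are infinitely many eigenvalues on either side. Each estimate compares a window with one end
  at the eigenvalue in question and the other end near \<open>0\<close>.\<close>

lemma enumeration_close:
  fixes f d :: "int \<Rightarrow> real"
  assumes f: "mono f" "0 \<le> f 0" "\<And>n. 0 \<le> f n \<Longrightarrow> f 0 \<le> f n" and d: "strict_mono d"
    and fin: "\<And>\<alpha> \<beta>. \<alpha> \<le> \<beta> \<Longrightarrow> finite {n. \<alpha> \<le> f n \<and> f n \<le> \<beta>}"
      "\<And>\<alpha> \<beta>. finite {n. \<alpha> \<le> d n \<and> d n \<le> \<beta>}"
    and count: "\<And>\<alpha> \<beta>. \<alpha> \<le> \<beta> \<Longrightarrow>
        card {n. \<alpha> \<le> f n \<and> f n \<le> \<beta>} \<le> card {n. \<alpha> - M \<le> d n \<and> d n \<le> \<beta> + M}"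
      "\<And>\<alpha> \<beta>. \<alpha> \<le> \<beta> \<Longrightarrow>
        card {n. \<alpha> \<le> d n \<and> d n \<le> \<beta>} \<le> card {n. \<alpha> - M \<le> f n \<and> f n \<le> \<beta> + M}"
    and pq: "M \<le> d q" "d q + 2 * M < d p" "d p' < - M" and L: "p \<le> L" "- p' \<le> L" and M: "0 \<le> M"
  shows "f n \<le> d (n + L) + M" "d (n - L) - M \<le> f n"
proof -
  have f_less: "i < j" if "f i < f j" for i j
    using monoD[OF f(1), of j i] that by (meson not_le)
  have d_less: "i < j" if "d i < d j" for i j
    using d that by (simp add: strict_mono_less)
  have d_le: "d i \<le> d j" if "i \<le> j" for i j
    using d that by (simp add: strict_mono_less_eq)
  \<comment> \<open>The single entry \<open>d q\<close> forces an eigenvalue within \<open>M\<close>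
    of it; as \<open>M \<le> d q\<close>, that eigenvalue is nonnegative, so the smallest
    nonnegative one does not exceed it.\<close>
  have f0: "f 0 \<le> d q + M"
  proof -
    have "{n. d q \<le> d n \<and> d n \<le> d q} \<noteq> {}" by auto
    then have "card {n. d q \<le> d n \<and> d n \<le> d q} > 0" using fin(2)[of "d q" "d q"] by (simp add: card_gt_0_iff)
    then have "card {n. d q - M \<le> f n \<and> f n \<le> d q + M} > 0"
      using count(2)[of "d q" "d q"] by linarith
    then have "{n. d q - M \<le> f n \<and> f n \<le> d q + M} \<noteq> {}" by (metis card.empty less_irrefl)
    then obtain i where "d q - M \<le> f i" "f i \<le> d q + M" by blast
    then show ?thesis using f(3)[of i] pq(1) by linarith
  qed
  show "f n \<le> d (n + L) + M"
  proof (rule ccontr)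
    assume n: "\<not> f n \<le> d (n + L) + M"
    show False
    proof (cases "p \<le> n + L")
      case True
      \<comment> \<open>The entries from \<open>d p\<close> to \<open>d (n + L)\<close> force at
        least \<open>n + L - p + 1\<close> eigenvalues, all above \<open>f 0\<close> because
        \<open>d p - M > d q + M\<close>, and all below \<open>f n\<close>: too many for the indices
        strictly between 0 and \<open>n\<close>.\<close>
      have "n + L - p + 1 < n - 0"
      proof (rule card_atLeastAtMost_int_le_greaterLess[OF fin(2) _ fin(1) count(2)])
        show "{p..n + L} \<subseteq> {j. d p \<le> d j \<and> d j \<le> d (n + L)}" using d_le by auto
        show "{i. d p - M \<le> f i \<and> f i \<le> d (n + L) + M} \<subseteq> {0<..<n}"
        proof
          fix i assume "i \<in> {i. d p - M \<le> f i \<and> f i \<le> d (n + L) + M}"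
          then have "f 0 < f i" "f i < f n" using n f0 pq M by auto
          then show "i \<in> {0<..<n}" using f_less by auto
        qed
        show "d p \<le> d (n + L)" by (rule d_le[OF True])
        then show "d p - M \<le> d (n + L) + M" using M by linarith
      qed (rule True)
      then show False using L by simp
    next
      case False
      then have "n \<le> 0" using L by linarith
      \<comment> \<open>Here the roles are exchanged: the eigenvalues with indices from
        \<open>n\<close> to 0 need entries strictly between \<open>d (n + L)\<close> and
        \<open>d p\<close>. The margin \<open>2 * M\<close> in \<open>pq\<close> is one
        \<open>M\<close> for \<open>f0\<close> and one for the enlarged window.\<close>
      have "0 - n + 1 < p - (n + L)"
      proof (rule card_atLeastAtMost_int_le_greaterLess[OF fin(1) _ fin(2) count(1)])
        show "{n..0} \<subseteq> {i. f n \<le> f i \<and> f i \<le> f 0}" using monoD[OF f(1)] by auto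
        show "{j. f n - M \<le> d j \<and> d j \<le> f 0 + M} \<subseteq> {n + L<..<p}"
        proof
          fix j assume "j \<in> {j. f n - M \<le> d j \<and> d j \<le> f 0 + M}"
          then have "d (n + L) < d j" "d j < d p" using n f0 pq M by auto
          then show "j \<in> {n + L<..<p}" using d_less by auto
        qed
        show "f n \<le> f 0" "f n \<le> f 0" by (rule monoD[OF f(1) \<open>n \<le> 0\<close>])+
      qed (rule \<open>n \<le> 0\<close>)
      then show False using L by simp
    qed
  qed
  show "d (n - L) - M \<le> f n"
  proof (rule ccontr)
    assume n: "\<not> d (n - L) - M \<le> f n"
    show False
    proof (cases "n - L \<le> p'")
      case True
      \<comment> \<open>On the left \<open>0 \<le> f 0\<close> takes the place of the estimate
        \<open>f0\<close>, so a margin of one \<open>M\<close> below 0 suffices for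
        \<open>d p'\<close>.\<close>
      have "p' - (n - L) + 1 < 0 - n"
      proof (rule card_atLeastAtMost_int_le_greaterLess[OF fin(2) _ fin(1) count(2)])
        show "{n - L..p'} \<subseteq> {j. d (n - L) \<le> d j \<and> d j \<le> d p'}" using d_le by auto
        show "{i. d (n - L) - M \<le> f i \<and> f i \<le> d p' + M} \<subseteq> {n<..<0}"
        proof
          fix i assume "i \<in> {i. d (n - L) - M \<le> f i \<and> f i \<le> d p' + M}"
          then have "f n < f i" "f i < f 0" using n f(2) pq M by auto
          then show "i \<in> {n<..<0}" using f_less by auto
        qed
        show "d (n - L) \<le> d p'" by (rule d_le[OF True])
        then show "d (n - L) - M \<le> d p' + M" using M by linarith
      qed (rule True)
      then show False using L by simp
    next
      case False
      then have "0 \<le> n" using L by linarith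
      have "n - 0 + 1 < (n - L) - p'"
      proof (rule card_atLeastAtMost_int_le_greaterLess[OF fin(1) _ fin(2) count(1)])
        show "{0..n} \<subseteq> {i. f 0 \<le> f i \<and> f i \<le> f n}" using monoD[OF f(1)] by auto
        show "{j. f 0 - M \<le> d j \<and> d j \<le> f n + M} \<subseteq> {p'<..<n - L}"
        proof
          fix j assume "j \<in> {j. f 0 - M \<le> d j \<and> d j \<le> f n + M}"
          then have "d p' < d j" "d j < d (n - L)" using n f(2) pq M by auto
          then show "j \<in> {p'<..<n - L}" using d_less by auto
        qed
        show "f 0 \<le> f n" "f 0 \<le> f n" by (rule monoD[OF f(1) \<open>0 \<le> n\<close>])+
      qed (rule \<open>0 \<le> n\<close>)
      then show False using L by simp
    qed
  qed
qed

section \<open>Brackets, gaps of the power potential and the weight\<close>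

lemma bracket_ge_1: "1 \<le> bracket n"
  by (simp add: bracket_def)

lemma bracket_pos: "0 < bracket n"
  using bracket_ge_1[of n] by linarith

lemma bracket_minus: "bracket (- n) = bracket n"
  by (simp add: bracket_def)

lemma bracket_minus_commute: "bracket (m - n) = bracket (n - m)"
  by (simp add: bracket_def abs_minus_commute)

lemma bracket_add_le: "bracket (m + n) \<le> bracket m * bracket n"
proof -
  have "real_of_int \<bar>m + n\<bar> \<le> real_of_int \<bar>m\<bar> + real_of_int \<bar>n\<bar>"
    by (metis abs_triangle_ineq of_int_add of_int_le_iff)
  moreover have "bracket m * bracket n = real_of_int \<bar>m\<bar> + real_of_int \<bar>n\<bar> + 1
      + real_of_int \<bar>m\<bar> * real_of_int \<bar>n\<bar>"
    by (simp add: bracket_def algebra_simps)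
  moreover have "0 \<le> real_of_int \<bar>m\<bar> * real_of_int \<bar>n\<bar>" by simp
  ultimately show ?thesis unfolding bracket_def[of "m + n"] by linarith
qed

text \<open>Concavity of the power: its graph lies below the tangent at \<open>t\<close>. Young's
  inequality for \<open>s / t\<close> and 1 is this statement after division by
  \<open>t powr \<eta>\<close>.\<close>

lemma powr_tangent_le:
  fixes s t \<eta> :: real
  assumes "0 \<le> s" "s \<le> t" "0 < t" "0 < \<eta>" "\<eta> < 1"
  shows "\<eta> * (t - s) * t powr (\<eta> - 1) \<le> t powr \<eta> - s powr \<eta>"
proof -
  have t: "t * t powr (\<eta> - 1) = t powr \<eta>"
    using assms(3) powr_add[of t 1 "\<eta> - 1"] by simp
  have "s powr \<eta> \<le> \<eta> * s * t powr (\<eta> - 1) + (1 - \<eta>) * t powr \<eta>"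
  proof (cases "s = 0")
    case False
    then have "s > 0" using assms by simp
    then have "(s / t) powr \<eta> * 1 powr (1 - \<eta>) \<le> \<eta> * (s / t) + (1 - \<eta>) * 1"
      using assms by (intro Youngs_inequality_0) auto
    then have "s powr \<eta> / t powr \<eta> \<le> \<eta> * (s / t) + (1 - \<eta>)"
      using assms by (simp add: powr_divide)
    from mult_right_mono[OF this, of "t powr \<eta>"]
    have "s powr \<eta> \<le> \<eta> * s * (t powr \<eta> / t) + (1 - \<eta>) * t powr \<eta>"
      using assms by (simp add: algebra_simps)
    also have "t powr \<eta> / t = t powr (\<eta> - 1)" using t assms(3) by (simp add: field_simps)
    finally show ?thesis .
  qed (use assms in simp)
  also have "\<dots> = t powr \<eta> - \<eta> * (t - s) * t powr (\<eta> - 1)"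
    unfolding t[symmetric] by (simp add: algebra_simps)
  finally show ?thesis by simp
qed

locale power_potential =
  fixes \<eta> :: real
  assumes \<eta>: "0 < \<eta>" "\<eta> < 1"
begin

lemma abs_potential: "\<bar>potential \<eta> n\<bar> = real_of_int \<bar>n\<bar> powr \<eta>"
  by (auto simp: potential_def abs_mult sgn_if)

lemma potential_nonneg: "0 \<le> n \<Longrightarrow> potential \<eta> n = real_of_int n powr \<eta>"
  by (cases "n = 0") (auto simp: potential_def)

lemma potential_minus: "potential \<eta> (- n) = - potential \<eta> n"
  by (simp add: potential_def sgn_if)

text \<open>The slope of the power decreases, so on one side of 0 it is smallest at the end of
  larger modulus, whence the maximum. Across 0 the two powers add, and each
  \<open>x powr \<eta>\<close> is at least \<open>x\<close> times the same factor.\<close>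

lemma potential_gap_max:
  assumes "m \<noteq> n"
  shows "\<eta> * real_of_int \<bar>n - m\<bar> * real_of_int (max \<bar>m\<bar> \<bar>n\<bar>) powr (\<eta> - 1)
    \<le> \<bar>potential \<eta> n - potential \<eta> m\<bar>"
proof -
  have nonneg: "\<eta> * real_of_int (t - s) * real_of_int t powr (\<eta> - 1) \<le> potential \<eta> t - potential \<eta> s"
    if "0 \<le> s" "s < t" for s t :: int
    using powr_tangent_le[of "real_of_int s" "real_of_int t" \<eta>] that \<eta>
    by (simp add: potential_nonneg)
  have mixed: "\<eta> * real_of_int (s + t) * real_of_int (max s t) powr (\<eta> - 1)
      \<le> potential \<eta> t + potential \<eta> s" if "0 \<le> s" "0 \<le> t" "0 < s + t" for s t :: int
  proof -
    let ?A = "real_of_int (max s t)"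
    have "?A > 0" using that by auto
    have ge: "real_of_int x * ?A powr (\<eta> - 1) \<le> real_of_int x powr \<eta>" if "0 \<le> x" "x \<le> max s t" for x
    proof (cases "x = 0")
      case False
      then have "?A powr (\<eta> - 1) \<le> real_of_int x powr (\<eta> - 1)"
        using that \<eta> by (intro powr_mono2') auto
      then have "real_of_int x * ?A powr (\<eta> - 1) \<le> real_of_int x * real_of_int x powr (\<eta> - 1)"
        using that by (intro mult_left_mono) auto
      also have "\<dots> = real_of_int x powr \<eta>"
        using False that powr_add[of "real_of_int x" 1 "\<eta> - 1"] by simp
      finally show ?thesis .
    qed simp
    have "\<eta> * (real_of_int (s + t) * ?A powr (\<eta> - 1)) \<le> 1 * (real_of_int (s + t) * ?A powr (\<eta> - 1))"
      using \<eta> that by (intro mult_right_mono) auto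
    also have "\<dots> \<le> real_of_int s powr \<eta> + real_of_int t powr \<eta>"
      using ge[of s] ge[of t] that by (simp add: algebra_simps)
    finally show ?thesis using that by (simp add: potential_nonneg mult.assoc)
  qed
  have wlog: "\<eta> * real_of_int (n - m) * real_of_int (max \<bar>m\<bar> \<bar>n\<bar>) powr (\<eta> - 1)
      \<le> potential \<eta> n - potential \<eta> m" if "m < n" for m n
  proof -
    consider "0 \<le> m" | "n \<le> 0" | "m \<le> 0" "0 \<le> n" by linarith
    then show ?thesis
    proof cases
      case 1
      then show ?thesis using nonneg[of m n] that by (simp add: max_def)
    next
      case 2
      then show ?thesis using nonneg[of "- n" "- m"] that by (simp add: max_def potential_minus)
    next
      case 3
      then show ?thesis using mixed[of "- m" n] that by (simp add: potential_minus)
    qed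
  qed
  from assms consider "m < n" | "n < m" by linarith
  then show ?thesis
  proof cases
    case 1
    then show ?thesis using wlog[OF 1] by (simp add: abs_of_pos)
  next
    case 2
    then show ?thesis using wlog[OF 2] by (simp add: abs_minus_commute max.commute abs_if)
  qed
qed

text \<open>Up to constants a lower bound for the gap of the potential in which \<open>m\<close> and
  \<open>m - n\<close> are separated; its power \<open>- (r + 1)\<close> is the decay asserted for
  eigenvectors.\<close>

definition weight :: "int \<Rightarrow> int \<Rightarrow> real" where
  "weight m n = bracket (m - n) powr \<eta> / bracket m powr (1 - \<eta>)"

lemma weight_pos: "0 < weight m n"
  using bracket_pos[of m] bracket_pos[of "m - n"] by (simp add: weight_def)

text \<open>The larger modulus is at most the product of the brackets of \<open>m\<close> and
  \<open>m - n\<close>, and the power \<open>\<eta> - 1\<close> is decreasing. The 2 comes from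
  \<open>bracket j \<le> 2 * \<bar>j\<bar>\<close> for nonzero \<open>j\<close>, the 1 from the
  diagonal, where the gap vanishes.\<close>

lemma weight_le_potential_gap: "weight m n \<le> 2 / \<eta> * \<bar>potential \<eta> n - potential \<eta> m\<bar> + 1"
proof (cases "m = n")
  case True
  have "1 powr (1 - \<eta>) \<le> bracket n powr (1 - \<eta>)"
    using \<eta> bracket_ge_1 by (intro powr_mono2) auto
  then show ?thesis using True bracket_pos[of n] by (simp add: weight_def bracket_def)
next
  case False
  let ?A = "real_of_int (max \<bar>m\<bar> \<bar>n\<bar>)"
  let ?b = "bracket (m - n)"
  have "?A > 0" using False by auto
  have "?A \<le> bracket m * ?b"
  proof -
    have "real_of_int \<bar>n\<bar> + 1 \<le> bracket m * ?b"
      using bracket_add_le[of m "n - m"] by (simp add: bracket_def abs_minus_commute)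
    moreover have "bracket m * 1 \<le> bracket m * ?b"
      using bracket_ge_1 bracket_pos[of m] by (intro mult_left_mono) auto
    ultimately show ?thesis by (auto simp: bracket_def max_def)
  qed
  then have A: "(bracket m * ?b) powr (\<eta> - 1) \<le> ?A powr (\<eta> - 1)"
    using \<open>?A > 0\<close> \<eta> by (intro powr_mono2') auto
  have half: "?b / 2 \<le> real_of_int \<bar>n - m\<bar>" using False by (simp add: bracket_def abs_if)
  have "weight m n = ?b * (bracket m * ?b) powr (\<eta> - 1)"
  proof -
    have "?b * ?b powr (\<eta> - 1) = ?b powr \<eta>" using bracket_pos[of "m - n"] powr_add[of ?b 1 "\<eta> - 1"] by simp
    moreover have "bracket m powr (\<eta> - 1) = 1 / bracket m powr (1 - \<eta>)"
      using powr_minus_divide[of "bracket m" "1 - \<eta>"] by simp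
    ultimately show ?thesis
      using bracket_pos[of m] bracket_pos[of "m - n"]
      by (simp add: weight_def powr_mult mult.left_commute)
  qed
  also have "\<dots> = 2 / \<eta> * (\<eta> * (?b / 2) * (bracket m * ?b) powr (\<eta> - 1))" using \<eta> by simp
  also have "\<dots> \<le> 2 / \<eta> * (\<eta> * real_of_int \<bar>n - m\<bar> * ?A powr (\<eta> - 1))"
    using \<eta> half A by (intro mult_left_mono mult_mono) auto
  also have "\<dots> \<le> 2 / \<eta> * \<bar>potential \<eta> n - potential \<eta> m\<bar>"
    using \<eta> potential_gap_max[OF False] by (intro mult_left_mono) auto
  finally show ?thesis by simp
qed

lemma strict_mono_potential: "strict_mono (potential \<eta>)"
proof (rule strict_monoI)
  fix m n :: int assume "m < n"
  consider "0 \<le> m" | "n \<le> 0" | "m < 0" "0 < n" using \<open>m < n\<close> by linarith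
  then show "potential \<eta> m < potential \<eta> n"
  proof cases
    case 1
    then show ?thesis using \<open>m < n\<close> \<eta> by (simp add: potential_nonneg powr_less_mono2)
  next
    case 2
    then have "potential \<eta> (- n) < potential \<eta> (- m)"
      using \<open>m < n\<close> \<eta> potential_nonneg[of "- n"] potential_nonneg[of "- m"] by (simp add: powr_less_mono2)
    then show ?thesis by (simp add: potential_minus)
  next
    case 3
    then have "0 < potential \<eta> (- m)" "0 < potential \<eta> n"
      using potential_nonneg[of "- m"] by (simp_all add: potential_nonneg)
    then show ?thesis by (simp add: potential_minus)
  qed
qed

lemma potential_Suc_le: "potential \<eta> (n + 1) \<le> potential \<eta> n + 1"
proof -
  have nn: "potential \<eta> (n + 1) \<le> potential \<eta> n + 1" if "0 \<le> n" for n
  proof (cases "n = 0")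
    case False
    let ?t = "real_of_int n"
    have t: "1 \<le> ?t" using that False by simp
    have "(?t + 1) powr \<eta> = ?t powr \<eta> * (1 + 1 / ?t) powr \<eta>"
      using t by (simp add: powr_mult[symmetric] algebra_simps)
    also have "\<dots> \<le> ?t powr \<eta> * (1 + 1 / ?t) powr 1"
      using t \<eta> by (intro mult_left_mono powr_mono) auto
    also have "\<dots> = ?t powr \<eta> + ?t powr \<eta> / ?t" using t by (simp add: algebra_simps)
    also have "\<dots> \<le> ?t powr \<eta> + 1"
      using t \<eta> powr_mono[of \<eta> 1 ?t] by simp
    finally show ?thesis using that by (simp add: potential_nonneg)
  qed (simp add: potential_def)
  show ?thesis
  proof (cases "0 \<le> n")
    case False
    then show ?thesis using nn[of "- n - 1"] potential_minus[of "n + 1"] potential_minus[of n] by simp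
  qed (rule nn)
qed

lemma potential_add_le: "0 \<le> L \<Longrightarrow> potential \<eta> (n + L) \<le> potential \<eta> n + real_of_int L"
proof (induction L rule: int_ge_induct)
  case (step L)
  then show ?case using potential_Suc_le[of "n + L"] by (simp add: add.assoc)
qed simp

lemma potential_unbounded: "\<exists>n>0. x < potential \<eta> n"
proof -
  define y where "y = max x 1"
  obtain n :: int where n: "y powr (1 / \<eta>) < real_of_int n" using ex_less_of_int by blast
  have "0 < y powr (1 / \<eta>)" by (simp add: y_def max_def)
  then have "0 < n" using n by linarith
  have "y = (y powr (1 / \<eta>)) powr \<eta>" using \<eta> by (simp add: powr_powr y_def)
  also have "\<dots> < real_of_int n powr \<eta>" using n \<eta> by (intro powr_less_mono2) auto
  finally have "x < potential \<eta> n" using \<open>0 < n\<close> by (simp add: potential_nonneg y_def)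
  with \<open>0 < n\<close> show ?thesis by blast
qed

lemma finite_potential: "finite {n. \<bar>potential \<eta> n\<bar> \<le> x}"
proof -
  obtain N where N: "0 < N" "x < potential \<eta> N" using potential_unbounded by blast
  have "{n. \<bar>potential \<eta> n\<bar> \<le> x} \<subseteq> {- N..N}"
  proof
    fix n assume "n \<in> {n. \<bar>potential \<eta> n\<bar> \<le> x}"
    then have "potential \<eta> n < potential \<eta> N" "potential \<eta> (- n) < potential \<eta> N"
      using N by (auto simp: potential_minus)
    then show "n \<in> {- N..N}" using strict_mono_less[OF strict_mono_potential] by force
  qed
  then show ?thesis by (rule finite_subset) simp
qed

lemma infinite_potential: "infinite {n. 0 \<le> potential \<eta> n}" "infinite {n. potential \<eta> n < 0}"
proof -
  have "{0..} \<subseteq> {n. 0 \<le> potential \<eta> n}" by (auto simp: potential_nonneg)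
  then show "infinite {n. 0 \<le> potential \<eta> n}" using infinite_Ici finite_subset by blast
  have "potential \<eta> n < 0" if "n < 0" for n
    using strict_monoD[OF strict_mono_potential that] by (simp add: potential_def)
  then have "{..<0} \<subseteq> {n. potential \<eta> n < 0}" by auto
  then show "infinite {n. potential \<eta> n < 0}" using infinite_Iio finite_subset by blast
qed

end

section \<open>Decay of eigenvectors and moments\<close>

lemma infsum_Cauchy_Schwarz:
  fixes f g :: "int \<Rightarrow> real"
  assumes "(\<lambda>n. (f n)\<^sup>2) summable_on UNIV" "(\<lambda>n. (g n)\<^sup>2) summable_on UNIV"
  shows "(\<lambda>n. f n * g n) summable_on UNIV"
    and "(\<Sum>\<^sub>\<infinity>n. f n * g n)\<^sup>2 \<le> (\<Sum>\<^sub>\<infinity>n. (f n)\<^sup>2) * (\<Sum>\<^sub>\<infinity>n. (g n)\<^sup>2)"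
proof -
  have F: "Rep_l2 (Abs_l2 (\<lambda>n. complex_of_real (f n))) = (\<lambda>n. complex_of_real (f n))"
    and G: "Rep_l2 (Abs_l2 (\<lambda>n. complex_of_real (g n))) = (\<lambda>n. complex_of_real (g n))"
    using assms by (auto intro!: Rep_l2_Abs_l2)
  let ?F = "Abs_l2 (\<lambda>n. complex_of_real (f n))" and ?G = "Abs_l2 (\<lambda>n. complex_of_real (g n))"
  have "(\<lambda>n. complex_of_real (f n * g n)) summable_on UNIV"
    using cinner_summable[of ?F ?G UNIV] by (simp add: F G)
  from summable_on_Re[OF this] show s: "(\<lambda>n. f n * g n) summable_on UNIV" by simp
  have "cinner ?F ?G = complex_of_real (\<Sum>\<^sub>\<infinity>n. f n * g n)"
    unfolding cinner_def F G complex_cnj_complex_of_real of_real_mult[symmetric]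
    by (intro infsumI has_sum_of_real has_sum_infsum s)
  then have "(\<Sum>\<^sub>\<infinity>n. f n * g n)\<^sup>2 = (cmod (cinner ?F ?G))\<^sup>2" by simp
  also have "\<dots> \<le> (norm ?F * norm ?G)\<^sup>2" by (intro power_mono cmod_cinner_le) simp
  also have "\<dots> = (\<Sum>\<^sub>\<infinity>n. (f n)\<^sup>2) * (\<Sum>\<^sub>\<infinity>n. (g n)\<^sup>2)"
    by (simp add: power_mult_distrib norm_l2_square F G)
  finally show "(\<Sum>\<^sub>\<infinity>n. f n * g n)\<^sup>2 \<le> (\<Sum>\<^sub>\<infinity>n. (f n)\<^sup>2) * (\<Sum>\<^sub>\<infinity>n. (g n)\<^sup>2)" .
qed

lemma summable_on_int_if_even:
  fixes f :: "int \<Rightarrow> real"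
  assumes f: "(\<lambda>k::nat. f (int k)) summable_on UNIV" and even: "\<And>n. f (- n) = f n"
  shows "f summable_on UNIV"
proof -
  have 1: "f summable_on range int"
    using f summable_on_reindex[of int UNIV f] by (simp add: o_def)
  have 2: "f summable_on range (\<lambda>k. - int k)"
    using f summable_on_reindex[of "\<lambda>k. - int k" UNIV f] by (simp add: o_def even inj_def)
  have "UNIV = range int \<union> range (\<lambda>k. - int k)"
    by (auto simp: image_iff) (metis int_cases2)
  then show ?thesis using summable_on_union[OF 1 2] by simp
qed

lemma bracket_powr_summable:
  assumes "1 < s"
  shows "(\<lambda>n. bracket n powr (- s)) summable_on UNIV"
proof (rule summable_on_int_if_even)
  have "summable (\<lambda>k. real (Suc k) powr (- s))"
    using assms by (subst summable_Suc_iff) (simp add: summable_real_powr_iff)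
  then have "(\<lambda>k. real (Suc k) powr (- s)) summable_on UNIV"
    by (simp add: summable_on_UNIV_nonneg_real_iff)
  then show "(\<lambda>k. bracket (int k) powr (- s)) summable_on UNIV"
    by (simp add: bracket_def add.commute)
qed (simp add: bracket_minus)

context power_potential
begin

text \<open>Moving the weight from \<open>n\<close> to \<open>k\<close> costs a bracket of
  \<open>n - k\<close>, which the moment of \<open>a\<close> can pay. Truncation at 1 makes powers
  of the weight monotone in the exponent, as the iteration in \<open>eigenvector_decay\<close>
  requires.\<close>

lemma weight_submult: "max 1 (weight m n) \<le> bracket (n - k) powr \<eta> * max 1 (weight m k)"
proof -
  have 1: "1 \<le> bracket (n - k) powr \<eta>" using bracket_ge_1 \<eta> by (intro ge_one_powr_ge_zero) auto
  have "bracket (m - n) powr \<eta> \<le> (bracket (n - k) * bracket (m - k)) powr \<eta>"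
    using bracket_add_le[of "k - n" "m - k"] bracket_pos[of "m - n"] \<eta>
    by (intro powr_mono2) (auto simp: bracket_minus_commute[of n k])
  also have "\<dots> = bracket (n - k) powr \<eta> * bracket (m - k) powr \<eta>"
    by (rule powr_mult)
  finally have "weight m n \<le> bracket (n - k) powr \<eta> * weight m k"
    using bracket_pos[of m] by (simp add: weight_def divide_right_mono)
  also have "\<dots> \<le> bracket (n - k) powr \<eta> * max 1 (weight m k)"
    using 1 by (intro mult_left_mono) auto
  finally have "weight m n \<le> bracket (n - k) powr \<eta> * max 1 (weight m k)" .
  moreover have "1 * 1 \<le> bracket (n - k) powr \<eta> * max 1 (weight m k)"
    using 1 by (intro mult_mono) auto
  ultimately show ?thesis by simp
qed

text \<open>Bootstrap: a decay rate \<open>s \<le> r\<close> of \<open>u\<close> passes to the convolution of \<open>u\<close> with \<open>a\<close>, and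
  dividing by the distance of \<open>potential \<eta> n\<close> to the eigenvalue gains one power of the weight.\<close>

lemma eigenvector_decay:
  fixes a u :: "int \<Rightarrow> complex" and b :: "int \<Rightarrow> real"
  assumes a: "(\<lambda>j. cmod (a j) * bracket j powr r) summable_on UNIV" and r: "0 \<le> r"
    and A: "(\<Sum>\<^sub>\<infinity>j. cmod (a j) * bracket j powr r) = A"
    and u: "\<And>n. cmod (u n) \<le> 1"
    and eq: "\<And>n. \<bar>l - potential \<eta> n - b n\<bar> * cmod (u n) \<le> (\<Sum>\<^sub>\<infinity>k. cmod (a (n - k)) * cmod (u k))"
    and l: "\<bar>l - potential \<eta> m\<bar> \<le> g" and b: "\<And>n. \<bar>b n\<bar> \<le> B"
  shows "cmod (u n) \<le> (2 / \<eta> * (A + g + B) + 2) ^ (nat \<lceil>r\<rceil> + 1) * max 1 (weight m n) powr (- (r + 1))"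
proof -
  \<comment> \<open>\<open>A\<close> comes from the convolution, \<open>g\<close> from the distance
    of the eigenvalue to \<open>potential \<eta> m\<close>, \<open>B\<close> from the bounded term;
    \<open>m\<close> enters the final bound only through the weight.\<close>
  define Q where "Q = 2 / \<eta> * (A + g + B) + 2"
  define W where "W n = max 1 (weight m n)" for n
  have W: "1 \<le> W n" for n by (simp add: W_def)
  have W0: "0 < W n" for n using W[of n] by linarith
  have "0 \<le> A" unfolding A[symmetric] by (intro infsum_nonneg) simp
  moreover have "0 \<le> g" "0 \<le> B" using l b[of 0] by linarith+
  ultimately have Q: "0 \<le> Q" using \<eta> by (simp add: Q_def)
  have bij: "bij_betw (\<lambda>k. n - k) (UNIV :: int set) UNIV" for n
    by (rule bij_betwI[of _ _ _ "\<lambda>k. n - k"]) auto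
  have an: "(\<lambda>k. cmod (a (n - k)) * bracket (n - k) powr r) summable_on UNIV" for n
    using summable_on_reindex_bij_betw[OF bij[of n], of "\<lambda>j. cmod (a j) * bracket j powr r"] a by simp
  have An: "(\<Sum>\<^sub>\<infinity>k. cmod (a (n - k)) * bracket (n - k) powr r) = A" for n
    using infsum_reindex_bij_betw[OF bij[of n], of "\<lambda>j. cmod (a j) * bracket j powr r"] A by simp
  \<comment> \<open>Decay with power \<open>s\<close> is first moved through the convolution at the
    cost \<open>bracket (n - k) powr (\<eta> * s)\<close>, which the \<open>r\<close>-th moment
    covers; dividing by the gap then adds 1 to the power.\<close>
  have step: "cmod (u n) \<le> Q * C * W n powr (- (s + 1))"
    if C: "0 \<le> C" "\<And>k. cmod (u k) \<le> C * W k powr (- s)" and s: "0 \<le> s" "s \<le> r" for C s n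
  proof -
    have term_le: "cmod (a (n - k)) * cmod (u k)
        \<le> C * W n powr (- s) * (cmod (a (n - k)) * bracket (n - k) powr r)" for k
    proof -
      have "W n powr s \<le> (bracket (n - k) powr \<eta> * W k) powr s"
        unfolding W_def using s weight_submult by (intro powr_mono2) auto
      also have "\<dots> = bracket (n - k) powr (\<eta> * s) * W k powr s"
        using W0[of k] by (simp add: powr_mult powr_powr)
      also have "\<dots> \<le> bracket (n - k) powr r * W k powr s"
      proof (intro mult_right_mono powr_mono)
        have "\<eta> * s \<le> 1 * s" using \<eta> s by (intro mult_right_mono) auto
        then show "\<eta> * s \<le> r" using s by simp
      qed (use bracket_ge_1 in auto)
      finally have "W k powr (- s) \<le> bracket (n - k) powr r * W n powr (- s)"
        using W0[of n] W0[of k] by (simp add: powr_minus field_simps)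
      then have "C * W k powr (- s) \<le> C * (bracket (n - k) powr r * W n powr (- s))"
        by (intro mult_left_mono C)
      then have "cmod (u k) \<le> C * (bracket (n - k) powr r * W n powr (- s))"
        using C(2)[of k] by linarith
      then have "cmod (a (n - k)) * cmod (u k)
          \<le> cmod (a (n - k)) * (C * (bracket (n - k) powr r * W n powr (- s)))"
        by (intro mult_left_mono) auto
      then show ?thesis by (simp add: mult_ac)
    qed
    have summ: "(\<lambda>k. C * W n powr (- s) * (cmod (a (n - k)) * bracket (n - k) powr r)) summable_on UNIV"
      by (intro summable_on_cmult_right an)
    have "(\<Sum>\<^sub>\<infinity>k. cmod (a (n - k)) * cmod (u k))
        \<le> (\<Sum>\<^sub>\<infinity>k. C * W n powr (- s) * (cmod (a (n - k)) * bracket (n - k) powr r))"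
      by (intro infsum_mono summable_on_comparison_test[OF summ] summ term_le) auto
    also have "\<dots> = C * W n powr (- s) * A" by (simp add: infsum_cmult_right' An)
    finally have S: "\<bar>l - potential \<eta> n - b n\<bar> * cmod (u n) \<le> C * W n powr (- s) * A"
      using eq[of n] by linarith
    have "\<bar>potential \<eta> n - potential \<eta> m\<bar> \<le> \<bar>l - potential \<eta> n - b n\<bar> + (g + B)"
      using l b[of n] by linarith
    then have "2 / \<eta> * \<bar>potential \<eta> n - potential \<eta> m\<bar>
        \<le> 2 / \<eta> * (\<bar>l - potential \<eta> n - b n\<bar> + (g + B))"
      using \<eta> by (intro mult_left_mono) auto
    then have "W n \<le> 2 / \<eta> * (\<bar>l - potential \<eta> n - b n\<bar> + (g + B)) + 2"
      using weight_le_potential_gap[of m n] weight_pos[of m n] by (simp add: W_def max_def)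
    then have "W n * cmod (u n) \<le> (2 / \<eta> * (\<bar>l - potential \<eta> n - b n\<bar> + (g + B)) + 2) * cmod (u n)"
      by (intro mult_right_mono) auto
    also have "\<dots> = 2 / \<eta> * (\<bar>l - potential \<eta> n - b n\<bar> * cmod (u n)) + (2 / \<eta> * (g + B) + 2) * cmod (u n)"
      using \<eta> by (simp add: field_simps)
    also have "\<dots> \<le> 2 / \<eta> * (C * W n powr (- s) * A) + (2 / \<eta> * (g + B) + 2) * (C * W n powr (- s))"
      using S C(2)[of n] \<eta> \<open>0 \<le> g\<close> \<open>0 \<le> B\<close> by (intro add_mono mult_left_mono) auto
    also have "\<dots> = Q * C * W n powr (- s)" by (simp add: Q_def algebra_simps add_divide_distrib)
    finally have "W n * cmod (u n) \<le> Q * C * W n powr (- s)" .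
    then have "cmod (u n) \<le> Q * C * W n powr (- s) / W n"
      using W0[of n] by (simp add: pos_le_divide_eq mult.commute)
    also have "\<dots> = Q * C * W n powr (- (s + 1))"
      using W0[of n] powr_diff[of "W n" "- s" 1] by simp
    finally show ?thesis .
  qed
  \<comment> \<open>The power grows by 1 per round and is cut off at \<open>r\<close>, the last
    value that \<open>step\<close> accepts. After \<open>\<lceil>r\<rceil>\<close> rounds it equals
    \<open>r\<close>, and one more application gives \<open>r + 1\<close>.\<close>
  have iter: "cmod (u n) \<le> Q ^ N * W n powr (- min (real N) r)" for N n
  proof (induction N arbitrary: n)
    case 0
    then show ?case using u[of n] W0[of n] r by simp
  next
    case (Suc N)
    have "cmod (u n) \<le> Q * Q ^ N * W n powr (- (min (real N) r + 1))"
      by (rule step) (use Suc Q r in auto)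
    also have "\<dots> \<le> Q * Q ^ N * W n powr (- min (real (Suc N)) r)"
      using W[of n] Q by (intro mult_left_mono powr_mono) auto
    finally show ?case by simp
  qed
  have "min (real (nat \<lceil>r\<rceil>)) r = r" using real_nat_ceiling_ge[of r] by (simp add: min_def)
  then have "cmod (u n) \<le> Q ^ nat \<lceil>r\<rceil> * W n powr (- r)" for n using iter[of n "nat \<lceil>r\<rceil>"] by simp
  then have "cmod (u n) \<le> Q * Q ^ nat \<lceil>r\<rceil> * W n powr (- (r + 1))"
    using step[of "Q ^ nat \<lceil>r\<rceil>" r n] Q r by simp
  then show ?thesis by (simp add: Q_def W_def)
qed

section \<open>From decay of eigenvectors to moments\<close>

lemma weight_powr_le:
  assumes "0 \<le> p"
  shows "max 1 (weight m n) powr (- p) \<le> bracket m powr (p * (1 - \<eta>)) / bracket (m - n) powr (p * \<eta>)"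
proof -
  have "max 1 (weight m n) powr (- p) \<le> weight m n powr (- p)"
    using weight_pos[of m n] assms by (intro powr_mono2') auto
  also have "\<dots> = 1 / weight m n powr p" by (simp add: powr_minus_divide)
  also have "\<dots> = bracket m powr (p * (1 - \<eta>)) / bracket (m - n) powr (p * \<eta>)"
    by (simp add: weight_def powr_divide powr_powr mult.commute)
  finally show ?thesis .
qed

text \<open>Where \<open>bracket n \<le> 2 * bracket m\<close>, the factor
  \<open>bracket n powr q\<close> is charged to \<open>m\<close>. Otherwise
  \<open>bracket (m - n)\<close> is at least half of \<open>bracket n\<close>, and the decay leaves
  a summable \<open>bracket n powr (- 2)\<close> uniformly in \<open>m\<close>.\<close>

lemma moment_term_le:
  assumes p: "0 \<le> p" and q: "0 < q" "q < p * (4 * \<eta> - 2) - 2"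
    and x: "0 \<le> x" "x \<le> \<gamma> * (bracket m powr (p * (1 - \<eta>)) / bracket (m - n) powr (p * \<eta>))"
  shows "bracket n powr q * x\<^sup>2 \<le> 2 powr q * bracket m powr q * x\<^sup>2
    + \<gamma>\<^sup>2 * 2 powr (2 * p * \<eta>) * bracket n powr (- 2)"
proof (cases "bracket n \<le> 2 * bracket m")
  case True
  have "bracket n powr q \<le> (2 * bracket m) powr q"
    using True bracket_pos[of n] q by (intro powr_mono2) auto
  also have "\<dots> = 2 powr q * bracket m powr q" using bracket_pos[of m] by (simp add: powr_mult)
  finally have "bracket n powr q * x\<^sup>2 \<le> 2 powr q * bracket m powr q * x\<^sup>2"
    by (intro mult_right_mono) auto
  then show ?thesis by (simp add: add_increasing2)
next
  case False
  let ?bm = "bracket m" and ?bn = "bracket n"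
  have pos: "0 < ?bm" "0 < ?bn" "1 \<le> ?bm" using bracket_pos bracket_ge_1 by auto
  have arith: "N \<le> a + c \<Longrightarrow> \<not> N + 1 \<le> 2 * (a + 1) \<Longrightarrow> (N + 1) / 2 \<le> c + 1" for N a c :: real
    by (simp add: field_simps)
  have "\<bar>n\<bar> \<le> \<bar>m\<bar> + \<bar>m - n\<bar>" by linarith
  then have "real_of_int \<bar>n\<bar> \<le> real_of_int (\<bar>m\<bar> + \<bar>m - n\<bar>)" by (simp only: of_int_le_iff)
  then have "?bn / 2 \<le> bracket (m - n)"
    using False arith unfolding bracket_def of_int_add by blast
  then have "(?bn / 2) powr (p * \<eta>) \<le> bracket (m - n) powr (p * \<eta>)"
    using pos p \<eta> by (intro powr_mono2) auto
  then have inv: "1 / bracket (m - n) powr (p * \<eta>) \<le> 1 / (?bn / 2) powr (p * \<eta>)"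
    using pos by (intro frac_le) auto
  have y: "0 \<le> ?bm powr (p * (1 - \<eta>)) / bracket (m - n) powr (p * \<eta>)" by simp
  have "x\<^sup>2 \<le> (\<gamma> * (?bm powr (p * (1 - \<eta>)) / bracket (m - n) powr (p * \<eta>)))\<^sup>2"
    using x by (intro power_mono) auto
  also have "\<dots> = \<gamma>\<^sup>2 * (?bm powr (p * (1 - \<eta>)) * (1 / bracket (m - n) powr (p * \<eta>)))\<^sup>2"
    by (simp add: power_mult_distrib power_divide)
  also have "\<dots> \<le> \<gamma>\<^sup>2 * (?bm powr (p * (1 - \<eta>)) * (1 / (?bn / 2) powr (p * \<eta>)))\<^sup>2"
    using inv by (intro mult_left_mono power_mono) auto
  also have "\<dots> = \<gamma>\<^sup>2 * 2 powr (2 * p * \<eta>) * (?bm powr (2 * p * (1 - \<eta>)) * ?bn powr (- (2 * p * \<eta>)))"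
  proof -
    have sq: "(z powr w)\<^sup>2 = z powr (2 * w)" for z w :: real
      by (simp add: power2_eq_square flip: powr_add)
    have "(1 / (?bn / 2) powr (p * \<eta>))\<^sup>2 = 2 powr (2 * p * \<eta>) * ?bn powr (- (2 * p * \<eta>))"
      using pos by (simp add: powr_divide power_divide sq powr_minus_divide mult.assoc)
    then show ?thesis by (simp only: power_mult_distrib sq mult_ac)
  qed
  finally have x2: "x\<^sup>2 \<le> \<gamma>\<^sup>2 * 2 powr (2 * p * \<eta>) * (?bm powr (2 * p * (1 - \<eta>)) * ?bn powr (- (2 * p * \<eta>)))" .
  \<comment> \<open>\<open>e\<close> is the power of \<open>bracket n\<close> left after splitting
    off \<open>- 2\<close>. It is at most 0, so \<open>bracket m\<close> may replace
    \<open>bracket n\<close>; the total power of \<open>bracket m\<close> is then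
    \<open>q + 2 - p * (4 * \<eta> - 2)\<close>, negative by the hypothesis on
    \<open>q\<close>.\<close>
  define e where "e = q + 2 - 2 * p * \<eta>"
  have "2 * p * \<eta> \<le> 2 * p * 1" using p \<eta> by (intro mult_left_mono) auto
  then have e: "e \<le> 0" "2 * p * (1 - \<eta>) + e \<le> 0" using q by (simp_all add: e_def algebra_simps)
  have "?bn powr q * (?bm powr (2 * p * (1 - \<eta>)) * ?bn powr (- (2 * p * \<eta>)))
      = ?bm powr (2 * p * (1 - \<eta>)) * ?bn powr e * ?bn powr (- 2)"
  proof -
    have "?bn powr q * ?bn powr (- (2 * p * \<eta>)) = ?bn powr e * ?bn powr (- 2)"
      unfolding powr_add[symmetric] by (simp add: e_def)
    then show ?thesis by (simp add: mult_ac)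
  qed
  also have "\<dots> \<le> 1 * ?bn powr (- 2)"
  proof (rule mult_right_mono)
    have "?bm powr (2 * p * (1 - \<eta>)) * ?bn powr e \<le> ?bm powr (2 * p * (1 - \<eta>)) * ?bm powr e"
      using e False pos by (intro mult_left_mono powr_mono2') auto
    also have "\<dots> = ?bm powr (2 * p * (1 - \<eta>) + e)" by (simp add: powr_add)
    also have "\<dots> \<le> ?bm powr 0" using e pos by (intro powr_mono) auto
    finally show "?bm powr (2 * p * (1 - \<eta>)) * ?bn powr e \<le> 1" using pos by simp
  qed simp
  finally have fin: "?bn powr q * (?bm powr (2 * p * (1 - \<eta>)) * ?bn powr (- (2 * p * \<eta>))) \<le> ?bn powr (- 2)"
    by simp
  have "?bn powr q * x\<^sup>2 \<le> ?bn powr q * (\<gamma>\<^sup>2 * 2 powr (2 * p * \<eta>)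
      * (?bm powr (2 * p * (1 - \<eta>)) * ?bn powr (- (2 * p * \<eta>))))"
    by (intro mult_left_mono x2) auto
  also have "\<dots> = \<gamma>\<^sup>2 * 2 powr (2 * p * \<eta>)
      * (?bn powr q * (?bm powr (2 * p * (1 - \<eta>)) * ?bn powr (- (2 * p * \<eta>))))"
    by (simp add: mult_ac)
  also have "\<dots> \<le> \<gamma>\<^sup>2 * 2 powr (2 * p * \<eta>) * ?bn powr (- 2)"
    by (intro mult_left_mono fin) auto
  finally show ?thesis by (simp add: add_increasing)
qed

text \<open>The weights \<open>bracket m powr (q / 2)\<close> in the Cauchy-Schwarz inequality match the growth in
  \<open>m\<close> of the \<open>q\<close>-th moment of the \<open>m\<close>-th row.\<close>

lemma moment_bound:
  fixes x :: "int \<Rightarrow> int \<Rightarrow> real"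
  assumes p: "0 \<le> p" and q: "0 < q" "q < p * (4 * \<eta> - 2) - 2"
    and x0: "\<And>m n. 0 \<le> x m n"
    and x1: "\<And>m. (\<lambda>n. (x m n)\<^sup>2) summable_on UNIV" "\<And>m. (\<Sum>\<^sub>\<infinity>n. (x m n)\<^sup>2) \<le> 1"
    and x: "\<And>m n. x m n \<le> \<gamma> * (bracket m powr (p * (1 - \<eta>)) / bracket (m - n) powr (p * \<eta>))"
  obtains g where "g summable_on UNIV"
    "\<And>n. bracket n powr q * (\<Sum>\<^sub>\<infinity>m. x m k * x m n)\<^sup>2 \<le> g n"
proof -
  have x_le1: "(x m n)\<^sup>2 \<le> 1" for m n
  proof -
    have "(\<Sum>j\<in>{n}. (x m j)\<^sup>2) \<le> (\<Sum>\<^sub>\<infinity>j. (x m j)\<^sup>2)"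
      by (rule finite_sum_le_infsum[OF x1(1)]) auto
    then show ?thesis using x1(2)[of m] by simp
  qed
  define \<beta> where "\<beta> m = bracket m powr (q / 2)" for m
  define D where "D = \<gamma>\<^sup>2 * 2 powr (2 * p * \<eta>)"
  \<comment> \<open>For fixed \<open>k\<close>, the decay of \<open>x m k\<close> in
    \<open>m\<close> has power \<open>p * \<eta> - p * (1 - \<eta>)\<close>, and
    \<open>\<beta>\<close> spends \<open>q / 2\<close> of it; summability over \<open>m\<close> asks
    for \<open>\<sigma> > 1\<close>, which is the hypothesis on \<open>q\<close>.\<close>
  define \<sigma> where "\<sigma> = p * (2 * \<eta> - 1) - q / 2"
  have \<sigma>: "1 < \<sigma>" using q(2) by (simp add: \<sigma>_def algebra_simps)
  have \<beta>: "1 \<le> \<beta> m" for m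
    unfolding \<beta>_def using bracket_ge_1 q by (intro ge_one_powr_ge_zero) auto
  have \<beta>0: "0 < \<beta> m" for m using \<beta>[of m] by linarith
  have \<beta>2: "\<beta> m * \<beta> m = bracket m powr q" for m
    unfolding \<beta>_def powr_add[symmetric] by simp
  have \<gamma>: "0 \<le> \<gamma>"
  proof -
    have "0 \<le> \<gamma> * (bracket 0 powr (p * (1 - \<eta>)) / bracket (0 - 0) powr (p * \<eta>))"
      using order_trans[OF x0 x] .
    then show ?thesis by (simp add: bracket_def)
  qed
  have xk: "x m k * \<beta> m \<le> \<gamma> * bracket k powr (p * \<eta>) * bracket m powr (- \<sigma>)" for m
  proof -
    have pos: "0 < bracket m" "0 < bracket k" "0 < bracket (m - k)" using bracket_pos by auto
    have "bracket m powr (p * \<eta>) \<le> (bracket (m - k) * bracket k) powr (p * \<eta>)"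
      using bracket_add_le[of "m - k" k] pos p \<eta> by (intro powr_mono2) auto
    also have "\<dots> = bracket (m - k) powr (p * \<eta>) * bracket k powr (p * \<eta>)"
      using pos by (simp add: powr_mult)
    finally have "1 / bracket (m - k) powr (p * \<eta>) \<le> bracket k powr (p * \<eta>) * bracket m powr (- (p * \<eta>))"
      using pos by (simp add: powr_minus_divide field_simps)
    then have "bracket m powr (p * (1 - \<eta>)) * (1 / bracket (m - k) powr (p * \<eta>))
        \<le> bracket m powr (p * (1 - \<eta>)) * (bracket k powr (p * \<eta>) * bracket m powr (- (p * \<eta>)))"
      by (intro mult_left_mono) auto
    also have "\<dots> = bracket k powr (p * \<eta>) * bracket m powr (p * (1 - \<eta>) - p * \<eta>)"
      using powr_add[of "bracket m" "p * (1 - \<eta>)" "- (p * \<eta>)"] by (simp add: mult_ac)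
    finally have "\<gamma> * (bracket m powr (p * (1 - \<eta>)) / bracket (m - k) powr (p * \<eta>))
        \<le> \<gamma> * (bracket k powr (p * \<eta>) * bracket m powr (p * (1 - \<eta>) - p * \<eta>))"
      using \<gamma> by (intro mult_left_mono) auto
    then have "x m k * \<beta> m \<le> \<gamma> * (bracket k powr (p * \<eta>) * bracket m powr (p * (1 - \<eta>) - p * \<eta>)) * \<beta> m"
      using x[of m k] \<beta>0[of m] by (intro mult_right_mono) auto
    also have "\<dots> = \<gamma> * bracket k powr (p * \<eta>) * (bracket m powr (p * (1 - \<eta>) - p * \<eta>) * bracket m powr (q / 2))"
      by (simp add: \<beta>_def mult_ac)
    also have "bracket m powr (p * (1 - \<eta>) - p * \<eta>) * bracket m powr (q / 2) = bracket m powr (- \<sigma>)"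
      unfolding powr_add[symmetric] by (simp add: \<sigma>_def algebra_simps)
    finally show ?thesis .
  qed
  have ab0: "0 \<le> x m k * \<beta> m" for m
    by (intro mult_nonneg_nonneg x0 less_imp_le[OF \<beta>0])
  have ab: "(\<lambda>m. x m k * \<beta> m) summable_on UNIV"
    by (rule summable_on_comparison_test[OF summable_on_cmult_right[OF bracket_powr_summable[OF \<sigma>]]])
       (use xk ab0 in auto)
  have Z: "(\<lambda>n. bracket n powr (- 2)) summable_on UNIV" by (rule bracket_powr_summable) simp
  define A where "A = (\<Sum>\<^sub>\<infinity>m. x m k * \<beta> m)"
  have A: "0 \<le> A" unfolding A_def by (intro infsum_nonneg ab0)
  \<comment> \<open>\<open>G\<close> is summable in both variables by Tonelli: the squares in each
    row \<open>x m\<close> sum to at most 1, and the factors \<open>x m k * \<beta> m\<close> are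
    summable.\<close>
  define G where "G m n = x m k * \<beta> m * (2 powr q * (x m n)\<^sup>2 + D * bracket n powr (- 2))" for m n
  have D: "0 \<le> D" by (simp add: D_def)
  have G0: "0 \<le> G m n" for m n
    unfolding G_def using x0 \<beta>0 D by (auto intro!: mult_nonneg_nonneg add_nonneg_nonneg intro: less_imp_le)
  have Gsum: "((\<lambda>n. G m n) has_sum x m k * \<beta> m * (2 powr q * (\<Sum>\<^sub>\<infinity>n. (x m n)\<^sup>2) + D * (\<Sum>\<^sub>\<infinity>n. bracket n powr (- 2)))) UNIV" for m
    unfolding G_def by (intro has_sum_cmult_right has_sum_add has_sum_infsum x1 Z)
  have "(\<lambda>(m, n). G m n) summable_on UNIV \<times> UNIV"
  proof (rule summable_on_SigmaI)
    show "((\<lambda>n. case (m, n) of (m, n) \<Rightarrow> G m n) has_sum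
        x m k * \<beta> m * (2 powr q * (\<Sum>\<^sub>\<infinity>n. (x m n)\<^sup>2) + D * (\<Sum>\<^sub>\<infinity>n. bracket n powr (- 2)))) UNIV" for m
      using Gsum by simp
    show "(\<lambda>m. x m k * \<beta> m * (2 powr q * (\<Sum>\<^sub>\<infinity>n. (x m n)\<^sup>2) + D * (\<Sum>\<^sub>\<infinity>n. bracket n powr (- 2)))) summable_on UNIV"
    proof (rule summable_on_comparison_test)
      show "(\<lambda>m. x m k * \<beta> m * (2 powr q + D * (\<Sum>\<^sub>\<infinity>n. bracket n powr (- 2)))) summable_on UNIV"
        by (rule summable_on_cmult_left[OF ab])
      fix m
      have "2 powr q * (\<Sum>\<^sub>\<infinity>n. (x m n)\<^sup>2) \<le> 2 powr q * 1" by (intro mult_left_mono x1) auto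
      then have "2 powr q * (\<Sum>\<^sub>\<infinity>n. (x m n)\<^sup>2) \<le> 2 powr q" by simp
      then show "x m k * \<beta> m * (2 powr q * (\<Sum>\<^sub>\<infinity>n. (x m n)\<^sup>2) + D * (\<Sum>\<^sub>\<infinity>n. bracket n powr (- 2)))
          \<le> x m k * \<beta> m * (2 powr q + D * (\<Sum>\<^sub>\<infinity>n. bracket n powr (- 2)))"
        by (intro mult_left_mono add_mono ab0 order_refl)
      show "0 \<le> x m k * \<beta> m * (2 powr q * (\<Sum>\<^sub>\<infinity>n. (x m n)\<^sup>2) + D * (\<Sum>\<^sub>\<infinity>n. bracket n powr (- 2)))"
        by (rule has_sum_nonneg[OF Gsum G0])
    qed
  qed (use G0 in auto)
  then have joint: "(\<lambda>(n, m). G m n) summable_on UNIV \<times> UNIV"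
    by (subst (asm) summable_on_swap) (simp add: case_prod_unfold)
  have Gm: "(\<lambda>m. G m n) summable_on UNIV" for n
    by (rule summable_on_SigmaD1[OF joint]) (auto simp: G0)
  have Gn: "(\<lambda>n. \<Sum>\<^sub>\<infinity>m. G m n) summable_on UNIV"
    by (rule summable_on_Sigma_banach[OF joint])
  have "bracket n powr q * (\<Sum>\<^sub>\<infinity>m. x m k * x m n)\<^sup>2 \<le> A * (\<Sum>\<^sub>\<infinity>m. G m n)" for n
  proof -
    \<comment> \<open>Cauchy-Schwarz with \<open>x m k\<close> split as a weight on both sides,
      \<open>\<beta> m\<close> on one and its inverse on the other;
      \<open>\<beta> m * \<beta> m = bracket m powr q\<close> then absorbs the near part of
      \<open>moment_term_le\<close>.\<close>
    let ?f = "\<lambda>m. sqrt (x m k * \<beta> m)" and ?g = "\<lambda>m. sqrt (x m k / \<beta> m) * x m n"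
    have f2: "(?f m)\<^sup>2 = x m k * \<beta> m" for m using x0 \<beta>0[of m] by simp
    have g2: "(?g m)\<^sup>2 = x m k / \<beta> m * (x m n)\<^sup>2" for m
      using x0 \<beta>0[of m] by (simp add: power_mult_distrib)
    have fg: "?f m * ?g m = x m k * x m n" for m
      using x0[of m k] \<beta>0[of m] by (simp add: real_sqrt_mult real_sqrt_divide)
    have term_le: "bracket n powr q * (x m k / \<beta> m * (x m n)\<^sup>2) \<le> G m n" for m
    proof -
      have "bracket n powr q * (x m n)\<^sup>2 \<le> \<beta> m * \<beta> m * (2 powr q * (x m n)\<^sup>2 + D * bracket n powr (- 2))"
      proof -
        have "bracket n powr q * (x m n)\<^sup>2 \<le> 2 powr q * bracket m powr q * (x m n)\<^sup>2 + D * bracket n powr (- 2)"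
          unfolding D_def by (rule moment_term_le[OF p q x0 x])
        also have "D * bracket n powr (- 2) \<le> \<beta> m * \<beta> m * (D * bracket n powr (- 2))"
          using mult_right_mono[of 1 "\<beta> m * \<beta> m" "D * bracket n powr (- 2)"] D mult_mono[of 1 "\<beta> m" 1 "\<beta> m"] \<beta>[of m]
          by simp
        finally show ?thesis by (simp add: \<beta>2 algebra_simps)
      qed
      then have "x m k / \<beta> m * (bracket n powr q * (x m n)\<^sup>2)
          \<le> x m k / \<beta> m * (\<beta> m * \<beta> m * (2 powr q * (x m n)\<^sup>2 + D * bracket n powr (- 2)))"
        using x0 \<beta>0[of m] by (intro mult_left_mono) auto
      also have "\<dots> = G m n" using \<beta>0[of m] by (simp add: G_def)
      finally show ?thesis by (simp add: mult_ac)
    qed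
    have g_sum: "(\<lambda>m. x m k / \<beta> m * (x m n)\<^sup>2) summable_on UNIV"
    proof (rule summable_on_comparison_test[OF ab])
      fix m
      have "x m k / \<beta> m * (x m n)\<^sup>2 \<le> x m k / 1 * 1"
        using x0[of m k] \<beta>[of m] x_le1[of m n] by (intro mult_mono frac_le) auto
      also have "\<dots> \<le> x m k * \<beta> m" using x0[of m k] \<beta>[of m] by (simp add: mult_le_cancel_left1)
      finally show "x m k / \<beta> m * (x m n)\<^sup>2 \<le> x m k * \<beta> m" .
    qed (use x0 \<beta>0[THEN less_imp_le] in simp)
    have "(\<Sum>\<^sub>\<infinity>m. ?f m * ?g m)\<^sup>2 \<le> (\<Sum>\<^sub>\<infinity>m. (?f m)\<^sup>2) * (\<Sum>\<^sub>\<infinity>m. (?g m)\<^sup>2)"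
      by (rule infsum_Cauchy_Schwarz) (simp_all only: f2 g2 ab g_sum)
    then have "(\<Sum>\<^sub>\<infinity>m. x m k * x m n)\<^sup>2 \<le> A * (\<Sum>\<^sub>\<infinity>m. x m k / \<beta> m * (x m n)\<^sup>2)"
      unfolding f2 g2 fg A_def .
    then have "bracket n powr q * (\<Sum>\<^sub>\<infinity>m. x m k * x m n)\<^sup>2
        \<le> bracket n powr q * (A * (\<Sum>\<^sub>\<infinity>m. x m k / \<beta> m * (x m n)\<^sup>2))"
      by (intro mult_left_mono) auto
    also have "\<dots> = A * (\<Sum>\<^sub>\<infinity>m. bracket n powr q * (x m k / \<beta> m * (x m n)\<^sup>2))"
      by (subst infsum_cmult_right') (rule mult.left_commute)
    also have "\<dots> \<le> A * (\<Sum>\<^sub>\<infinity>m. G m n)"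
      by (intro mult_left_mono infsum_mono Gm summable_on_cmult_right g_sum term_le A)
    finally show ?thesis .
  qed
  then show thesis by (rule that[OF summable_on_cmult_right[OF Gn, of A]])
qed

end

section \<open>Convolution operators\<close>

lemma bij_shift_int: "bij_betw (\<lambda>n. n - k) (UNIV :: int set) UNIV"
  by (rule bij_betwI[of _ _ _ "\<lambda>n. n + k"]) auto

lift_definition shift :: "int \<Rightarrow> l2 \<Rightarrow> l2" is "\<lambda>k u n. u (n - k)"
proof -
  fix k :: int and u :: "int \<Rightarrow> complex"
  assume "(\<lambda>n. (cmod (u n))\<^sup>2) summable_on UNIV"
  then show "(\<lambda>n. (cmod (u (n - k)))\<^sup>2) summable_on UNIV"
    using summable_on_reindex_bij_betw[OF bij_shift_int, of "\<lambda>n. (cmod (u n))\<^sup>2" k] by simp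
qed

lemma norm_shift: "norm (shift k u) = norm u"
  unfolding norm_l2_def shift.rep_eq
  using infsum_reindex_bij_betw[OF bij_shift_int, of "\<lambda>n. (cmod (Rep_l2 u n))\<^sup>2" k] by simp

lemma shift_add: "shift k (u + v) = shift k u + shift k v"
  by (rule l2_eqI) (simp add: shift.rep_eq)

lemma shift_scaleC: "shift k (c *\<^sub>C u) = c *\<^sub>C shift k u"
  by (rule l2_eqI) (simp add: shift.rep_eq)

lemma cinner_shift: "cinner (shift k u) v = cinner u (shift (- k) v)"
  unfolding cinner_def shift.rep_eq
  using infsum_reindex_bij_betw[OF bij_shift_int, of "\<lambda>n. Rep_l2 u n * cnj (Rep_l2 v (n - - k))" k] by simp

text \<open>Written as a series of isometric shifts, absolutely convergent in l2 for summable
  \<open>a\<close>, so that linearity, the norm bound and symmetry hold term by term.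
  \<open>Rep_l2_convolution\<close> recovers the coordinate formula of \<open>T_seq\<close>.\<close>

definition convolution :: "(int \<Rightarrow> complex) \<Rightarrow> l2 \<Rightarrow> l2" where
  "convolution a u = (\<Sum>\<^sub>\<infinity>k. a k *\<^sub>C shift k u)"

lemma
  assumes a: "(\<lambda>k. cmod (a k)) summable_on UNIV"
  shows convolution_has_sum: "((\<lambda>k. a k *\<^sub>C shift k u) has_sum convolution a u) UNIV"
    and norm_convolution_le: "norm (convolution a u) \<le> (\<Sum>\<^sub>\<infinity>k. cmod (a k)) * norm u"
proof -
  have abs: "(\<lambda>k. a k *\<^sub>C shift k u) abs_summable_on UNIV"
    by (simp add: norm_scaleC norm_shift summable_on_cmult_left a)
  then show "((\<lambda>k. a k *\<^sub>C shift k u) has_sum convolution a u) UNIV"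
    unfolding convolution_def by (rule has_sum_infsum[OF abs_summable_summable])
  show "norm (convolution a u) \<le> (\<Sum>\<^sub>\<infinity>k. cmod (a k)) * norm u"
    unfolding convolution_def using norm_infsum_bound[OF abs]
    by (simp add: norm_scaleC norm_shift infsum_cmult_left')
qed

lemma Rep_l2_convolution:
  assumes a: "(\<lambda>k. cmod (a k)) summable_on UNIV"
  shows "Rep_l2 (convolution a u) n = (\<Sum>\<^sub>\<infinity>m. a (n - m) * Rep_l2 u m)"
proof -
  have "Rep_l2 (convolution a u) n = (\<Sum>\<^sub>\<infinity>k. a k * Rep_l2 u (n - k))"
    using has_sum_bounded_linear[OF bounded_linear_Rep_l2 convolution_has_sum[OF a, of u], of n]
    by (simp add: shift.rep_eq infsumI)
  also have "\<dots> = (\<Sum>\<^sub>\<infinity>m. a (n - m) * Rep_l2 u m)"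
    by (rule infsum_reindex_bij_witness[of _ "\<lambda>m. n - m" "\<lambda>k. n - k"]) auto
  finally show ?thesis .
qed

lemma convolution_add:
  assumes a: "(\<lambda>k. cmod (a k)) summable_on UNIV"
  shows "convolution a (u + v) = convolution a u + convolution a v"
  using has_sum_add[OF convolution_has_sum[OF a, of u] convolution_has_sum[OF a, of v]]
  unfolding convolution_def[of a "u + v"] by (simp add: shift_add l2.scale_right_distrib infsumI)

lemma convolution_scaleC:
  assumes a: "(\<lambda>k. cmod (a k)) summable_on UNIV"
  shows "convolution a (c *\<^sub>C u) = c *\<^sub>C convolution a u"
  using has_sum_bounded_linear[OF bounded_linear_scaleC convolution_has_sum[OF a, of u], of c]
  unfolding convolution_def[of a "c *\<^sub>C u"] by (simp add: shift_scaleC mult.commute infsumI)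

text \<open>The adjoint of a shift is the opposite shift, and the reflection of \<open>k\<close> to
  \<open>- k\<close> exchanges \<open>a k\<close> with its conjugate.\<close>

lemma convolution_sym:
  assumes a: "(\<lambda>k. cmod (a k)) summable_on UNIV" and sym: "\<And>k. a k = cnj (a (- k))"
  shows "cinner (convolution a u) v = cinner u (convolution a v)"
proof -
  have "cinner (convolution a u) v = (\<Sum>\<^sub>\<infinity>k. a k * cinner (shift k u) v)"
    using has_sum_bounded_linear[OF bounded_linear_cinner_left convolution_has_sum[OF a, of u], of v]
    by (simp add: cinner_scaleC_left infsumI)
  also have "\<dots> = (\<Sum>\<^sub>\<infinity>k. cnj (a k) * cinner u (shift k v))"
    by (rule infsum_reindex_bij_witness[of _ uminus uminus]) (auto simp: cinner_shift sym[symmetric])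
  also have "\<dots> = cinner u (convolution a v)"
    using has_sum_bounded_linear[OF bounded_linear_cinner_right convolution_has_sum[OF a, of v], of u]
    by (simp add: cinner_scaleC_right infsumI)
  finally show ?thesis .
qed

section \<open>Assembly of the three claims\<close>

lemma mult_op_eq_dmul: "mult_op b = dmul (\<lambda>n. complex_of_real (b n))"
  by (rule ext) (simp add: mult_op_def dmul_def)

text \<open>The moments in the theorem are extended reals, so that divergence would show as
  infinity; a real summable majorant bounds them.\<close>

lemma infsum_ennreal_le:
  fixes f g :: "'a \<Rightarrow> real"
  assumes "\<And>n. 0 \<le> f n" "\<And>n. f n \<le> g n" "g summable_on UNIV"
  shows "(\<Sum>\<^sub>\<infinity>n. ennreal (f n)) \<le> ennreal (\<Sum>\<^sub>\<infinity>n. g n)"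
proof (rule infsum_le_finite_sums)
  fix F :: "'a set" assume F: "finite F"
  have "(\<Sum>n\<in>F. ennreal (f n)) = ennreal (sum f F)" by (rule sum_ennreal) (rule assms(1))
  also have "\<dots> \<le> ennreal (\<Sum>\<^sub>\<infinity>n. g n)"
  proof (rule ennreal_leI)
    have "sum f F \<le> sum g F" by (rule sum_mono) (rule assms(2))
    also have "\<dots> \<le> (\<Sum>\<^sub>\<infinity>n. g n)"
      by (rule finite_sum_le_infsum[OF assms(3) F]) (auto intro: order_trans[OF assms(1,2)])
    finally show "sum f F \<le> (\<Sum>\<^sub>\<infinity>n. g n)" .
  qed
  finally show "(\<Sum>n\<in>F. ennreal (f n)) \<le> ennreal (\<Sum>\<^sub>\<infinity>n. g n)" .
qed (rule nonneg_summable_on_complete, simp)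

text \<open>Brackets, unlike moduli, are submultiplicative and never 0, so the decay argument uses
  them; at \<open>j = 0\<close>, where the two are not comparable, \<open>a\<close>
  vanishes.\<close>

lemma bracket_powr_le: "j \<noteq> 0 \<Longrightarrow> 0 \<le> r \<Longrightarrow> bracket j powr r \<le> 2 powr r * real_of_int \<bar>j\<bar> powr r"
proof -
  assume j: "j \<noteq> 0" and r: "0 \<le> r"
  then have "1 \<le> real_of_int \<bar>j\<bar>" by linarith
  then have "bracket j powr r \<le> (2 * real_of_int \<bar>j\<bar>) powr r"
    using r by (intro powr_mono2) (auto simp: bracket_def)
  then show ?thesis by (simp add: powr_mult)
qed

theorem theorem2p1:
  fixes r \<eta> :: real and a :: "int \<Rightarrow> complex" and b :: "int \<Rightarrow> real"
  assumes "r \<ge> 0"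
    and "(\<lambda>m. cmod (a m) * real_of_int \<bar>m\<bar> powr r) summable_on UNIV"
    and "a 0 = 0"
    and "\<forall>m. a m = cnj (a (- m))"
    and "0 < \<eta>" and "\<eta> < 1"
    and "bounded (range b)"
  shows "let H = add_bounded (T_op a \<eta>) (mult_op b) in
    (purely_discrete_spectrum H \<and>
     (\<exists>ev. eigenvalue_enumeration H ev) \<and>
     (\<exists>\<gamma>>0. \<forall>ev. eigenvalue_enumeration H ev \<longrightarrow>
        (\<forall>n. \<bar>ev n - real_of_int (sgn n) * real_of_int \<bar>n\<bar> powr \<eta>\<bar> \<le> \<gamma>)))
    \<and>
    (\<exists>\<gamma>>0. \<forall>ev \<phi>. eigenvalue_enumeration H ev \<longrightarrow> orthonormal_basis \<phi> \<longrightarrow>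
        (\<forall>m. \<phi> m \<in> eigenspace H (complex_of_real (ev m))) \<longrightarrow>
        (\<forall>m n. cmod (Rep_l2 (\<phi> m) n) \<le>
           \<gamma> * (bracket m powr ((r + 1) * (1 - \<eta>)) / bracket (m - n) powr ((r + 1) * \<eta>))))
    \<and>
    (\<forall>k q. 0 < q \<longrightarrow> q < (r + 1) * (4 * \<eta> - 2) - 2 \<longrightarrow>
        (SUP t::real. \<Sum>\<^sub>\<infinity>n. ennreal (bracket n powr q *
           (cmod (cinner (exp_group H t (delta k)) (delta n)))\<^sup>2)) < \<infinity>)"
proof -
  define H where "H = add_bounded (T_op a \<eta>) (mult_op b)"
  have ar: "(\<lambda>j. cmod (a j) * bracket j powr r) summable_on UNIV"
  proof (rule summable_on_comparison_test[OF summable_on_cmult_right[OF assms(2)]])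
    fix j
    show "cmod (a j) * bracket j powr r \<le> 2 powr r * (cmod (a j) * real_of_int \<bar>j\<bar> powr r)"
      using mult_left_mono[OF bracket_powr_le[of j r], of "cmod (a j)"] assms(1,3)
      by (cases "j = 0") (simp_all add: mult_ac)
  qed simp
  have a1: "(\<lambda>j. cmod (a j)) summable_on UNIV"
  proof (rule summable_on_comparison_test[OF ar])
    fix j
    have "1 \<le> bracket j powr r" using bracket_ge_1 assms(1) by (intro ge_one_powr_ge_zero)
    then show "cmod (a j) \<le> cmod (a j) * bracket j powr r" by (simp add: mult_le_cancel_left1)
  qed simp
  define A where "A = (\<Sum>\<^sub>\<infinity>j. cmod (a j))"
  define Ar where "Ar = (\<Sum>\<^sub>\<infinity>j. cmod (a j) * bracket j powr r)"
  have A0: "0 \<le> A" "0 \<le> Ar" by (simp_all add: A_def Ar_def infsum_nonneg)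
  obtain B where B: "0 < B" "\<And>n. \<bar>b n\<bar> \<le> B"
    using assms(7) by (auto simp: bounded_pos)
  define K where "K u = convolution a u + mult_op b u" for u
  have Rmul: "Rep_l2 (mult_op b u) n = complex_of_real (b n) * Rep_l2 u n" for u n
    by (rule Rep_l2_mult_op[OF assms(7)])
  have dom: "op_dom H = T_dom \<eta>" by (simp add: H_def add_bounded_def T_op_def)
  have app: "Rep_l2 (op_app H u) n = Rep_l2 (K u) n + complex_of_real (potential \<eta> n) * Rep_l2 u n"
    if "u \<in> op_dom H" for u n
  proof -
    have Hu: "op_app H u = op_app (T_op a \<eta>) u + mult_op b u" and u: "u \<in> op_dom (T_op a \<eta>)"
      using that unfolding H_def add_bounded_def by simp_all
    have "Rep_l2 (op_app H u) n = Rep_l2 (op_app (T_op a \<eta>) u) n + complex_of_real (b n) * Rep_l2 u n"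
      by (simp only: Hu plus_l2.rep_eq Rmul)
    also have "Rep_l2 (op_app (T_op a \<eta>) u) n = Rep_l2 (convolution a u) n
        + of_int (sgn n) * complex_of_real (real_of_int \<bar>n\<bar> powr \<eta>) * Rep_l2 u n"
      unfolding Rep_l2_convolution[OF a1] by (rule Rep_l2_T_op[OF assms(2,1,3) u])
    finally show ?thesis by (simp add: K_def Rmul potential_def)
  qed
  interpret power_potential \<eta> by standard (fact assms)+
  interpret perturbed_diagonal H "potential \<eta>" K "A + B"
  proof
    have "real_of_int \<bar>n\<bar> powr (2 * \<eta>) = (potential \<eta> n)\<^sup>2" for n
    proof -
      have "(potential \<eta> n)\<^sup>2 = (real_of_int \<bar>n\<bar> powr \<eta>)\<^sup>2"
        unfolding abs_potential[symmetric] by simp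
      then show ?thesis by (simp add: power2_eq_square flip: powr_add)
    qed
    then show "op_dom H = {u. (\<lambda>n. (potential \<eta> n * cmod (Rep_l2 u n))\<^sup>2) summable_on UNIV}"
      by (simp add: dom T_dom_def power_mult_distrib)
    show "K (u + v) = K u + K v" for u v
      by (rule l2_eqI) (simp add: K_def convolution_add[OF a1] Rmul algebra_simps)
    show "K (c *\<^sub>C u) = c *\<^sub>C K u" for c u
      by (rule l2_eqI) (simp add: K_def convolution_scaleC[OF a1] Rmul algebra_simps)
    show "norm (K u) \<le> (A + B) * norm u" for u
    proof -
      have "norm (mult_op b u) \<le> B * norm u"
        unfolding mult_op_eq_dmul using B by (intro norm_dmul_le) simp
      then show ?thesis
        using norm_triangle_ineq[of "convolution a u" "mult_op b u"] norm_convolution_le[OF a1, of u]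
        by (simp add: K_def A_def algebra_simps)
    qed
    show "cinner (K u) v = cinner u (K v)" for u v
    proof -
      have "cinner (mult_op b u) v = cinner u (mult_op b v)"
        unfolding cinner_def by (simp add: Rmul mult_ac)
      then show ?thesis
        using convolution_sym[OF a1 assms(4)[rule_format], of u v]
        by (simp add: K_def cinner_add_left cinner_add_right)
    qed
  qed (use app A0 B finite_potential infinite_potential in auto)
  obtain \<phi>0 :: "int \<Rightarrow> l2" and ev0 where ev0: "eigenbasis UNIV \<phi>0 ev0" "mono ev0"
    "\<And>n. 0 \<le> n \<Longrightarrow> 0 \<le> ev0 n" "\<And>n. n < 0 \<Longrightarrow> ev0 n < 0"
    using ordered_eigenbasis by metis
  interpret diagonalized H "potential \<eta>" K "A + B" \<phi>0 ev0 by standard (rule ev0(1))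
  let ?M = "A + B"
  \<comment> \<open>\<open>q\<close> serves twice: \<open>potential \<eta> q\<close> exceeds
    \<open>?M\<close>, and by oddness \<open>- q\<close> is a point where the potential lies below
    \<open>- ?M\<close>.\<close>
  obtain q where q: "0 < q" "?M < potential \<eta> q" using potential_unbounded by blast
  obtain p where p: "0 < p" "potential \<eta> q + 2 * ?M < potential \<eta> p" using potential_unbounded by blast
  define L where "L = max p q"
  have close: "\<bar>ev n - potential \<eta> n\<bar> \<le> ?M + real_of_int L" if ev: "eigenvalue_enumeration H ev" for ev n
  proof -
    have fin: "finite {n. \<alpha> \<le> potential \<eta> n \<and> potential \<eta> n \<le> \<beta>}" for \<alpha> \<beta>
      by (rule finite_subset[OF _ finite_potential[of "max \<bar>\<alpha>\<bar> \<bar>\<beta>\<bar>"]]) auto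
    have ev': "mono ev" "0 \<le> ev 0" "\<And>n. 0 \<le> ev n \<Longrightarrow> ev 0 \<le> ev n"
      using ev by (auto simp: eigenvalue_enumeration_def)
    have "ev n \<le> potential \<eta> (n + L) + ?M" "potential \<eta> (n - L) - ?M \<le> ev n"
      using enumeration_close[OF ev' strict_mono_potential enumeration_interval(1)[OF ev] fin
          enumeration_interval(2,3)[OF ev], of q p "- q" L n] p q A0 B(1)
      by (auto simp: potential_minus L_def)
    moreover have "0 \<le> L" using p by (simp add: L_def)
    ultimately show ?thesis
      using potential_add_le[of L n] potential_add_le[of L "n - L"] by simp
  qed
  define \<gamma> where "\<gamma> = ?M + real_of_int L"
  have \<gamma>: "0 < \<gamma>" using A0 B p by (simp add: \<gamma>_def L_def add_nonneg_pos add_pos_pos)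
  \<comment> \<open>Built from \<open>\<gamma>\<close>, which bounds the eigenvalue shifts of all
    enumerations at once, so it can be fixed before \<open>m\<close> and the basis.\<close>
  define \<Gamma> where "\<Gamma> = (2 / \<eta> * (Ar + \<gamma> + B) + 2) ^ (nat \<lceil>r\<rceil> + 1)"
  have \<Gamma>: "0 < \<Gamma>" unfolding \<Gamma>_def using A0 B \<gamma> assms(5) by (intro zero_less_power add_nonneg_pos) auto
  \<comment> \<open>Stated for a single normalised eigenvector, so that it applies both to the
    arbitrary basis in the claim and to \<open>\<phi>0\<close> in the moment bound.\<close>
  have decay: "cmod (Rep_l2 u n) \<le> \<Gamma> * (bracket m powr ((r + 1) * (1 - \<eta>)) / bracket (m - n) powr ((r + 1) * \<eta>))"
    if ev: "eigenvalue_enumeration H ev" and u: "u \<in> eigenspace H (complex_of_real (ev m))" "cinner u u = 1"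
    for ev u m n
  proof -
    have nu: "norm u = 1"
    proof -
      have "(norm u)\<^sup>2 = 1\<^sup>2" using u(2) unfolding cinner_self by (simp del: of_real_power)
      then show ?thesis by (simp only: power2_eq_iff_nonneg norm_ge_zero zero_le_one)
    qed
    have "cmod (Rep_l2 u n) \<le> \<Gamma> * max 1 (weight m n) powr (- (r + 1))"
      unfolding \<Gamma>_def
    proof (rule eigenvector_decay[OF ar assms(1) Ar_def[symmetric]])
      show "cmod (Rep_l2 u n) \<le> 1" for n using cmod_Rep_l2_le[of u n] nu by simp
      show "\<bar>ev m - potential \<eta> m\<bar> \<le> \<gamma>" unfolding \<gamma>_def by (rule close[OF ev])
      show "\<bar>b n\<bar> \<le> B" for n by (rule B)
      fix n
      have uD: "u \<in> op_dom H" and Hu: "op_app H u = complex_of_real (ev m) *\<^sub>C u"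
        using u by (auto simp: eigenspace_def)
      have "complex_of_real (ev m - potential \<eta> n - b n) * Rep_l2 u n = (\<Sum>\<^sub>\<infinity>k. a (n - k) * Rep_l2 u k)"
        using app[OF uD, of n] by (simp add: Hu K_def Rmul Rep_l2_convolution[OF a1] algebra_simps)
      then have "\<bar>ev m - potential \<eta> n - b n\<bar> * cmod (Rep_l2 u n) = cmod (\<Sum>\<^sub>\<infinity>k. a (n - k) * Rep_l2 u k)"
        by (metis norm_mult norm_of_real)
      also have "\<dots> \<le> (\<Sum>\<^sub>\<infinity>k. cmod (a (n - k) * Rep_l2 u k))"
        by (rule norm_infsum_bound) (rule square_summable_convolution(1)[OF a1])
      finally show "\<bar>ev m - potential \<eta> n - b n\<bar> * cmod (Rep_l2 u n)
          \<le> (\<Sum>\<^sub>\<infinity>k. cmod (a (n - k)) * cmod (Rep_l2 u k))"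
        by (simp add: norm_mult)
    qed
    also have "\<dots> \<le> \<Gamma> * (bracket m powr ((r + 1) * (1 - \<eta>)) / bracket (m - n) powr ((r + 1) * \<eta>))"
      using \<Gamma> assms(1) by (intro mult_left_mono weight_powr_le) auto
    finally show ?thesis .
  qed
  have enum0: "eigenvalue_enumeration H ev0" by (rule eigenvalue_enumeration_ev[OF ev0(2-4)])
  have "(SUP t::real. \<Sum>\<^sub>\<infinity>n. ennreal (bracket n powr s *
      (cmod (cinner (exp_group H t (delta k)) (delta n)))\<^sup>2)) < \<infinity>"
    if s: "0 < s" "s < (r + 1) * (4 * \<eta> - 2) - 2" for k s
  proof -
    have one: "(\<Sum>\<^sub>\<infinity>n. (cmod (Rep_l2 (\<phi>0 m) n))\<^sup>2) \<le> 1" for m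
      using coeff_\<phi>[of m m] unfolding cinner_self norm_l2_square by (simp del: of_real_power)
    obtain g where g: "g summable_on UNIV"
      "\<And>n. bracket n powr s * (\<Sum>\<^sub>\<infinity>m. cmod (Rep_l2 (\<phi>0 m) k) * cmod (Rep_l2 (\<phi>0 m) n))\<^sup>2 \<le> g n"
    proof (rule moment_bound[of "r + 1" s "\<lambda>m n. cmod (Rep_l2 (\<phi>0 m) n)" \<Gamma> k])
      show "cmod (Rep_l2 (\<phi>0 m) n)
          \<le> \<Gamma> * (bracket m powr ((r + 1) * (1 - \<eta>)) / bracket (m - n) powr ((r + 1) * \<eta>))" for m n
        by (rule decay[OF enum0 \<phi>_eigenspace]) (simp add: coeff_\<phi>)
    qed (use assms(1) s one in auto)
    have "(\<Sum>\<^sub>\<infinity>n. ennreal (bracket n powr s * (cmod (cinner (exp_group H t (delta k)) (delta n)))\<^sup>2))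
        \<le> ennreal (\<Sum>\<^sub>\<infinity>n. g n)" for t
    proof (rule infsum_ennreal_le[OF _ _ g(1)])
      fix n
      have "bracket n powr s * (cmod (cinner (exp_group H t (delta k)) (delta n)))\<^sup>2
          \<le> bracket n powr s * (\<Sum>\<^sub>\<infinity>m. cmod (Rep_l2 (\<phi>0 m) k) * cmod (Rep_l2 (\<phi>0 m) n))\<^sup>2"
        by (intro mult_left_mono power_mono cmod_exp_group_entry_le) auto
      also have "\<dots> \<le> g n" by (rule g(2))
      finally show "bracket n powr s * (cmod (cinner (exp_group H t (delta k)) (delta n)))\<^sup>2 \<le> g n" .
    qed simp
    then have "(SUP t::real. \<Sum>\<^sub>\<infinity>n. ennreal (bracket n powr s *
      (cmod (cinner (exp_group H t (delta k)) (delta n)))\<^sup>2)) \<le> ennreal (\<Sum>\<^sub>\<infinity>n. g n)"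
      by (intro SUP_least)
    also have "\<dots> < \<infinity>" by simp
    finally show ?thesis .
  qed
  moreover have "\<exists>\<gamma>>0. \<forall>ev. eigenvalue_enumeration H ev \<longrightarrow>
      (\<forall>n. \<bar>ev n - real_of_int (sgn n) * real_of_int \<bar>n\<bar> powr \<eta>\<bar> \<le> \<gamma>)"
    using close \<gamma> unfolding \<gamma>_def potential_def by blast
  moreover have "\<exists>\<gamma>>0. \<forall>ev \<phi>. eigenvalue_enumeration H ev \<longrightarrow> orthonormal_basis \<phi> \<longrightarrow>
      (\<forall>m. \<phi> m \<in> eigenspace H (complex_of_real (ev m))) \<longrightarrow>
      (\<forall>m n. cmod (Rep_l2 (\<phi> m) n) \<le>
        \<gamma> * (bracket m powr ((r + 1) * (1 - \<eta>)) / bracket (m - n) powr ((r + 1) * \<eta>)))"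
    using \<Gamma> decay by (intro exI[of _ \<Gamma>]) (auto simp: orthonormal_basis_def)
  ultimately show ?thesis
    unfolding Let_def H_def[symmetric] using purely_discrete enum0 by blast
qed

end
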